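(* Let $(p_1,p_2,p_3)$ be a H\"older related triplet, let $J=[-\frac12,\frac12)$ and let $p=\min(1,p_3)$. Let $\phi\in M_{p_1,p_2}^{p_3}(\mathbb{T})$. Let $S$ be an integrable function on $\mathbb{R}^2$ supported in $\frac12 J\times\frac12 J$, and let $S^\sharp$ be the function on $\mathbb{R}^2$ that is $1$-periodic in each variable and equals $S$ on $J\times J$. Assume that the Fourier coefficients of $S^\sharp$ satisfy $\sum_{n,m\in\mathbb{Z}}|\widehat{S^\sharp}(n,m)|^p<\infty$. Then the function $$\psi(\xi,\eta):=\sum_{n,m\in\mathbb{Z}}\phi(n,m)\,\hat S(\xi-n,\eta-m)$$ belongs to $M_{p_1,p_2}^{p_3}(\mathbb{R})$. Moreover, $\|\psi\|\le c\|\phi\|$, where $c=2^{1/p}\Big(\sum_{n,m\in\mathbb{Z}}|\widehat{S^\sharp}(n,m)|^p\Big)^{1/p}$.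
   Context: A triplet $(p_1,p_2,p_3)$ is H\"older related if $\frac1{p_1}+\frac1{p_2}=\frac1{p_3}$, where $p_1,p_2\ge 1$ and $p_3\ge \frac12$ (the value $\infty$ is allowed, with $1/\infty=0$). $\hat f(\xi)=\int_{\mathbb{R}} f(x)e^{-2\pi i x\xi}\,dx$ denotes the Fourier transform on $\mathbb{R}$; similarly $\hat S(\xi,\eta)=\int_{\mathbb{R}^2}S(x,y)e^{-2\pi i(x\xi+y\eta)}\,dx\,dy$ on $\mathbb{R}^2$. $\mathbb{T}=\mathbb{R}/\mathbb{Z}$ is identified with $J=[-\frac12,\frac12)$ with Lebesgue measure; Fourier coefficients are $\hat F(n)=\int_J F(x)e^{-2\pi i nx}\,dx$ and $\widehat{S^\sharp}(n,m)=\int_J\int_J S^\sharp(x,y)e^{-2\pi i(nx+my)}\,dx\,dy$. $\frac12 J=[-\frac14,\frac14)$. Multipliers on $\mathbb{R}$: for $\psi\in L^\infty(\mathbb{R}^2)$ and Schwartz functions $f,g\in\mathcal{S}(\mathbb{R})$ put $C_\psi(f,g)(x)=\int_{\mathbb{R}}\int_{\mathbb{R}}\hat f(\xi)\hat g(\eta)\psi(\xi,\eta)e^{2\pi i x(\xi+\eta)}\,d\xi\,d\eta$. Then $\psi\in M_{p_1,p_2}^{p_3}(\mathbb{R})$ means that there is a constant $C$ with $\|C_\psi(f,g)\|_{L^{p_3}(\mathbb{R})}\le C\|f\|_{L^{p_1}(\mathbb{R})}\|g\|_{L^{p_2}(\mathbb{R})}$ for all $f,g\in\mathcal{S}(\mathbb{R})$;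 $\|\psi\|$ denotes the least such $C$. Multipliers on $\mathbb{T}$: $\phi:\mathbb{Z}^2\to\mathbb{C}$ belongs to $M_{p_1,p_2}^{p_3}(\mathbb{T})$ if there is a constant $C$ such that, for all trigonometric polynomials $F,G$ on $\mathbb{T}$, the function $P_\phi(F,G)(x)=\sum_{n,m}\hat F(n)\hat G(m)\phi(n,m)e^{2\pi i x(n+m)}$ satisfies $\|P_\phi(F,G)\|_{L^{p_3}(\mathbb{T})}\le C\|F\|_{L^{p_1}(\mathbb{T})}\|G\|_{L^{p_2}(\mathbb{T})}$; $\|\phi\|$ denotes the least such $C$. *)

theory Defs
  imports "HOL-Analysis.Analysis" "HOL-Probability.Essential_Supremum"
begin

section \<open>Exponents and Lebesgue (quasi-)norms\<close>

text \<open>Exponents live in \<^typ>\<open>ennreal\<close>, where \<open>1 / \<infinity> = 0\<close>.\<close>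

definition Hoelder_related :: "ennreal \<Rightarrow> ennreal \<Rightarrow> ennreal \<Rightarrow> bool" where
  "Hoelder_related p1 p2 p3 \<longleftrightarrow>
     1 \<le> p1 \<and> 1 \<le> p2 \<and> 1 / 2 \<le> p3 \<and> 1 / p1 + 1 / p2 = 1 / p3"

text \<open>Power of an extended nonnegative number, for exponents \<open>a > 0\<close> only.\<close>

definition ennreal_pow :: "ennreal \<Rightarrow> real \<Rightarrow> ennreal" where
  "ennreal_pow t a = (if t = \<infinity> then \<infinity> else ennreal (enn2real t powr a))"

text \<open>
  The value is \<open>\<infinity>\<close> when the \<open>p\<close>-th power is not integrable or the function is
  essentially unbounded; \<^const>\<open>esssup\<close> of a non-measurable function is \<open>\<infinity>\<close>.
\<close>

definition Lp_norm :: "ennreal \<Rightarrow> 'a measure \<Rightarrow> ('a \<Rightarrow> complex) \<Rightarrow> ennreal" where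
  "Lp_norm p M f =
     (if p = \<infinity> then esssup M (\<lambda>x. ennreal (cmod (f x)))
      else ennreal_pow (\<integral>\<^sup>+ x. ennreal (cmod (f x) powr enn2real p) \<partial>M) (1 / enn2real p))"

definition Linfty :: "'a measure \<Rightarrow> ('a \<Rightarrow> complex) set" where
  "Linfty M = {f. f \<in> borel_measurable M \<and> Lp_norm \<infinity> M f < \<infinity>}"


section \<open>Fourier transforms and multipliers on the line\<close>

text \<open>The \<open>D k\<close> below are necessarily the iterated derivatives of \<open>f\<close>.\<close>

definition schwartz :: "(real \<Rightarrow> complex) set" where
  "schwartz = {f. \<exists>D :: nat \<Rightarrow> real \<Rightarrow> complex. D 0 = f \<and>
     (\<forall>k x. (D k has_vector_derivative D (Suc k) x) (at x)) \<and>
     (\<forall>j k. bounded (range (\<lambda>x. x ^ j *\<^sub>R D k x)))}"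

definition fourier :: "(real \<Rightarrow> complex) \<Rightarrow> real \<Rightarrow> complex" where
  "fourier f \<xi> = (LINT x|lebesgue. f x * cis (- 2 * pi * x * \<xi>))"

definition fourier2 :: "(real \<times> real \<Rightarrow> complex) \<Rightarrow> real \<times> real \<Rightarrow> complex" where
  "fourier2 S = (\<lambda>(\<xi>, \<eta>).
     LINT (x, y)|lebesgue. S (x, y) * cis (- 2 * pi * (x * \<xi> + y * \<eta>)))"

definition bilin_R ::
    "(real \<times> real \<Rightarrow> complex) \<Rightarrow> (real \<Rightarrow> complex) \<Rightarrow> (real \<Rightarrow> complex) \<Rightarrow> real \<Rightarrow> complex" where
  "bilin_R \<psi> f g x =
     (LINT \<xi>|lebesgue. LINT \<eta>|lebesgue.
        fourier f \<xi> * fourier g \<eta> * \<psi> (\<xi>, \<eta>) * cis (2 * pi * x * (\<xi> + \<eta>)))"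

text \<open>
  An admissible constant is required to be nonnegative because \<^const>\<open>ennreal\<close> sends
  negative reals to \<open>0\<close>; with real-valued norms negative constants are never admissible.
\<close>

definition bilin_bound_R ::
    "ennreal \<Rightarrow> ennreal \<Rightarrow> ennreal \<Rightarrow> (real \<times> real \<Rightarrow> complex) \<Rightarrow> real \<Rightarrow> bool" where
  "bilin_bound_R p1 p2 p3 \<psi> C \<longleftrightarrow> 0 \<le> C \<and>
     (\<forall>f \<in> schwartz. \<forall>g \<in> schwartz.
        Lp_norm p3 lebesgue (bilin_R \<psi> f g)
          \<le> ennreal C * Lp_norm p1 lebesgue f * Lp_norm p2 lebesgue g)"

definition multipliers_R ::
    "ennreal \<Rightarrow> ennreal \<Rightarrow> ennreal \<Rightarrow> (real \<times> real \<Rightarrow> complex) set" where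
  "multipliers_R p1 p2 p3 = {\<psi> \<in> Linfty lebesgue. \<exists>C. bilin_bound_R p1 p2 p3 \<psi> C}"

definition mult_norm_R ::
    "ennreal \<Rightarrow> ennreal \<Rightarrow> ennreal \<Rightarrow> (real \<times> real \<Rightarrow> complex) \<Rightarrow> real" where
  "mult_norm_R p1 p2 p3 \<psi> = Inf {C. bilin_bound_R p1 p2 p3 \<psi> C}"


section \<open>Fourier coefficients and multipliers on the torus\<close>

definition J :: "real set" where "J = {-1/2..<1/2}"

definition half_J :: "real set" where "half_J = {-1/4..<1/4}"

text \<open>Functions on the torus are represented by \<open>1\<close>-periodic functions on the line.\<close>

definition trig_poly :: "(real \<Rightarrow> complex) set" where
  "trig_poly = {F. \<exists>(A :: int set) c. finite A \<and>
     F = (\<lambda>x. \<Sum>n\<in>A. c n * cis (2 * pi * real_of_int n * x))}"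

definition fcoeff :: "(real \<Rightarrow> complex) \<Rightarrow> int \<Rightarrow> complex" where
  "fcoeff F n = (LINT x|lebesgue_on J. F x * cis (- 2 * pi * real_of_int n * x))"

definition fcoeff2 :: "(real \<times> real \<Rightarrow> complex) \<Rightarrow> int \<times> int \<Rightarrow> complex" where
  "fcoeff2 F = (\<lambda>(n, m).
     LINT x|lebesgue_on J. LINT y|lebesgue_on J.
       F (x, y) * cis (- 2 * pi * (real_of_int n * x + real_of_int m * y)))"

text \<open>For trigonometric polynomials only finitely many terms of this sum are nonzero.\<close>

definition bilin_T ::
    "(int \<times> int \<Rightarrow> complex) \<Rightarrow> (real \<Rightarrow> complex) \<Rightarrow> (real \<Rightarrow> complex) \<Rightarrow> real \<Rightarrow> complex" where
  "bilin_T \<phi> F G x =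
     (\<Sum>\<^sub>\<infinity>(n, m)\<in>UNIV.
        fcoeff F n * fcoeff G m * \<phi> (n, m) * cis (2 * pi * x * real_of_int (n + m)))"

definition bilin_bound_T ::
    "ennreal \<Rightarrow> ennreal \<Rightarrow> ennreal \<Rightarrow> (int \<times> int \<Rightarrow> complex) \<Rightarrow> real \<Rightarrow> bool" where
  "bilin_bound_T p1 p2 p3 \<phi> C \<longleftrightarrow> 0 \<le> C \<and>
     (\<forall>F \<in> trig_poly. \<forall>G \<in> trig_poly.
        Lp_norm p3 (lebesgue_on J) (bilin_T \<phi> F G)
          \<le> ennreal C * Lp_norm p1 (lebesgue_on J) F * Lp_norm p2 (lebesgue_on J) G)"

definition multipliers_T ::
    "ennreal \<Rightarrow> ennreal \<Rightarrow> ennreal \<Rightarrow> (int \<times> int \<Rightarrow> complex) set" where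
  "multipliers_T p1 p2 p3 = {\<phi>. \<exists>C. bilin_bound_T p1 p2 p3 \<phi> C}"

definition mult_norm_T ::
    "ennreal \<Rightarrow> ennreal \<Rightarrow> ennreal \<Rightarrow> (int \<times> int \<Rightarrow> complex) \<Rightarrow> real" where
  "mult_norm_T p1 p2 p3 \<phi> = Inf {C. bilin_bound_T p1 p2 p3 \<phi> C}"

end

theory Submission
  imports Defs "HOL-Probability.Sinc_Integral"
    "HOL-Probability.Characteristic_Functions" "HOL-Real_Asymp.Real_Asymp"
begin

text \<open>
Write \<open>e(x) = exp (2 \<pi> i x)\<close> and let \<open>a(k, l)\<close> be the Fourier coefficients of \<open>Ssharp\<close>. Fourier
inversion puts the operator with symbol \<open>\<psi>\<close> into kernel form,
\<open>C(f, g)(x) = \<Sum> \<phi>(n, m) \<integral>\<integral> f(x - s) g(x - t) S(s, t) e(n s + m t) ds dt\<close>.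
Since \<open>S\<close> lives on a square of side \<open>1/2\<close>, at the points \<open>u + x\<close> with \<open>\<bar>x\<bar> < 1/4\<close> only the values of
\<open>f\<close> and \<open>g\<close> on the unit interval centred at \<open>u\<close> enter. There both functions may be replaced by
\<open>1\<close>-periodic functions \<open>F\<close> and \<open>G\<close>. Inserting their Fourier series, the integrals of \<open>S\<close> against
exponentials become the numbers \<open>a(k, l)\<close>, and
\<open>C(f, g)(u + x) = \<Sum> a(k, l) \<Sum> \<phi>(n - k, m - l) F^(n) G^(m) e((n + m) x)\<close>
(lemma \<open>bilin_R_local_limit\<close>). The inner sum has the modulus of \<open>P_\<phi>(e_{-k} F, e_{-l} G)(x)\<close>, which the
hypothesis on \<open>\<phi>\<close> controls uniformly in \<open>k\<close> and \<open>l\<close>. The \<open>p\<close>-triangle inequality then bounds \<open>C(f, g)\<close> on an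
interval of length \<open>1/2\<close> by \<open>(\<Sum> \<bar>a\<bar>^p)^(1/p) \<parallel>\<phi>\<parallel>\<close> times the norms of \<open>f\<close> and \<open>g\<close> on the concentric
interval of length \<open>1\<close> (lemmas \<open>torus_estimate\<close> and \<open>local_estimate\<close>).

To globalise, the local estimate is averaged over all centres \<open>u\<close>. A point of the line lies in the
short interval for a set of centres of measure \<open>1/2\<close> and in the long one for a set of measure \<open>1\<close>;
Hoelder's inequality, used as the weighted inequality of arithmetic and geometric means, turns
this ratio into the factor \<open>2^(1/p3)\<close>, which is at most \<open>2^(1/p)\<close> (lemma \<open>bilin_bound_R_extended_symbol\<close>).

Two devices keep every series absolutely convergent. The periodic functions are built from
\<open>f\<close> and \<open>g\<close> with twice differentiable cutoffs, so that their Fourier coefficients decay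
quadratically; this loses a margin \<open>\<delta>\<close> of the short interval, which tends to \<open>0\<close> at the end. And if \<open>h\<close> is
such a cutoff that equals \<open>1\<close> on the side of the support of \<open>S\<close>, then
\<open>S^(\<xi>, \<eta>) = \<Sum> h^(\<xi> + j) h^(\<eta> + l) a(-j, -l)\<close>, whence \<open>\<Sum> \<bar>S^(\<xi> - n, \<eta> - m)\<bar>\<close> is bounded
uniformly in \<open>\<xi>\<close> and \<open>\<eta>\<close> (lemma \<open>lattice_sum_bound\<close>) and \<open>\<psi>\<close> is a bounded measurable function.
\<close>

section \<open>Characters, Fourier transforms and inversion on the line\<close>

definition echar :: "real \<Rightarrow> complex" where
  "echar x = cis (2 * pi * x)"

lemma echar_add: "echar (x + y) = echar x * echar y"
  by (simp add: echar_def cis_mult distrib_left)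

lemma echar_0 [simp]: "echar 0 = 1"
  by (simp add: echar_def)

lemma norm_echar [simp]: "cmod (echar x) = 1"
  by (simp add: echar_def)

lemma echar_nonzero [simp]: "echar x \<noteq> 0"
  by (simp add: echar_def)

lemma echar_of_int [simp]: "echar (of_int n) = 1"
  using cis_multiple_2pi[of "of_int n"] by (simp add: echar_def mult.commute)

lemma echar_diff: "echar (x - y) = echar x * echar (- y)"
  using echar_add[of x "- y"] by simp

lemma continuous_on_echar [continuous_intros]:
  "continuous_on A f \<Longrightarrow> continuous_on A (\<lambda>x. echar (f x))"
  unfolding echar_def by (intro continuous_intros)

lemma borel_measurable_echar [measurable]: "echar \<in> borel_measurable borel"
  by (intro borel_measurable_continuous_onI continuous_intros)

lemma echar_has_vector_derivative:
  "((\<lambda>x. echar (a * x)) has_vector_derivative (2 * pi * a * \<i>) * echar (a * x)) (at x)"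
proof -
  have "((\<lambda>x. cis (2 * pi * (a * x))) has_vector_derivative (2 * pi * a) *\<^sub>R (\<i> * cis (2 * pi * (a * x)))) (at x)"
    unfolding has_vector_derivative_def
    by (rule has_derivative_eq_rhs, rule has_derivative_cis) (auto intro!: derivative_eq_intros)
  then show ?thesis
    by (simp add: echar_def scaleR_conv_of_real mult_ac)
qed

lemma borel_measurable_lebesgue_AE_eq:
  fixes f g :: "'a::euclidean_space \<Rightarrow> 'b::topological_space"
  assumes g: "g \<in> borel_measurable borel" and "AE x in lborel. f x = g x"
  shows "f \<in> borel_measurable lebesgue"
proof (rule measurableI)
  have ae: "AE x in lebesgue. f x = g x"
    using assms(2) by (rule AE_completion)
  have g': "g \<in> borel_measurable lebesgue"
    using g by (simp add: measurable_completion)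
  fix A :: "'b set" assume A: "A \<in> sets borel"
  show "f -` A \<inter> space lebesgue \<in> sets lebesgue"
  proof (rule completion.in_sets_AE)
    show "AE x in lebesgue. x \<in> g -` A \<inter> space lebesgue \<longleftrightarrow> x \<in> f -` A \<inter> space lebesgue"
      using ae by eventually_elim auto
    show "g -` A \<inter> space lebesgue \<in> sets lebesgue"
      using measurable_sets[OF g' A] .
  qed auto
qed auto

text \<open>
The operators are defined with the completed measure \<open>lebesgue\<close>, whereas product measures and the
theorems of Fubini and Tonelli are at home on \<open>lborel\<close>. This is the passage from one to the other.
\<close>

lemma lebesgue_integral_eq_lborel_AE:
  fixes f g :: "'a::euclidean_space \<Rightarrow> 'b::{banach, second_countable_topology}"
  assumes "g \<in> borel_measurable borel" "AE x in lborel. f x = g x"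
  shows "integral\<^sup>L lebesgue f = integral\<^sup>L lborel g"
proof -
  have g: "g \<in> borel_measurable lebesgue"
    using assms(1) by (simp add: measurable_completion)
  have "integral\<^sup>L lebesgue f = integral\<^sup>L lebesgue g"
    using borel_measurable_lebesgue_AE_eq[OF assms] g AE_completion[OF assms(2)]
    by (rule integral_cong_AE)
  then show ?thesis
    using assms(1) by (simp add: integral_completion)
qed

lemma fourier_eq_lborel:
  assumes "f \<in> borel_measurable borel"
  shows "fourier f \<xi> = (LINT x|lborel. f x * echar (- (\<xi> * x)))"
proof -
  have [measurable]: "f \<in> borel_measurable borel" by fact
  show ?thesis
    unfolding fourier_def
    by (rule lebesgue_integral_eq_lborel_AE) (measurable, simp add: echar_def mult_ac)
qed

text \<open>
A common roof over Schwartz functions and twice differentiable functions of compact support: two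
derivatives, all of quadratic decay.
\<close>

definition C2_decay :: "(real \<Rightarrow> complex) \<Rightarrow> bool" where
  "C2_decay f \<longleftrightarrow> (\<exists>f' f'' K.
     (\<forall>x. (f has_vector_derivative f' x) (at x)) \<and>
     (\<forall>x. (f' has_vector_derivative f'' x) (at x)) \<and>
     continuous_on UNIV f'' \<and>
     (\<forall>x. cmod (f x) \<le> K / (1 + x\<^sup>2) \<and> cmod (f' x) \<le> K / (1 + x\<^sup>2) \<and>
          cmod (f'' x) \<le> K / (1 + x\<^sup>2)))"

lemma integrable_decay_majorant: "integrable lborel (\<lambda>x::real. K / (1 + x\<^sup>2))"
proof -
  have "set_integrable lborel (einterval (-\<infinity>) \<infinity>) (\<lambda>x. inverse (1 + x^2))"
    using integrable_inverse_1_plus_square .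
  then have "integrable lborel (\<lambda>x::real. inverse (1 + x^2))"
    by (simp add: set_integrable_def)
  from integrable_mult_right[OF this, of K] show ?thesis
    by (simp add: divide_inverse)
qed

lemma integrable_decay:
  assumes "f \<in> borel_measurable borel" "\<And>x. cmod (f x) \<le> K / (1 + x\<^sup>2)"
  shows "integrable lborel f"
  by (rule Bochner_Integration.integrable_bound[OF integrable_decay_majorant[of K]])
     (use assms in \<open>auto intro!: AE_I2 order_trans[OF assms(2)] divide_right_mono\<close>)

lemma decay_tendsto_0:
  assumes "\<And>x. cmod (f x) \<le> K / (1 + x\<^sup>2)"
  shows "(f \<longlongrightarrow> 0) at_top" "(f \<longlongrightarrow> 0) at_bot"
proof -
  have 1: "((\<lambda>x::real. K / (1 + x\<^sup>2)) \<longlongrightarrow> 0) at_top"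
    by real_asymp
  have 2: "((\<lambda>x::real. K / (1 + x\<^sup>2)) \<longlongrightarrow> 0) at_bot"
    by real_asymp
  show "(f \<longlongrightarrow> 0) at_top"
    by (rule Lim_null_comparison[OF _ 1]) (use assms in auto)
  show "(f \<longlongrightarrow> 0) at_bot"
    by (rule Lim_null_comparison[OF _ 2]) (use assms in auto)
qed

lemma norm_fourier_le:
  assumes "f \<in> borel_measurable borel" "\<And>x. cmod (f x) \<le> K / (1 + x\<^sup>2)"
  shows "cmod (fourier f \<xi>) \<le> (LINT x|lborel. K / (1 + x\<^sup>2))"
proof -
  have [measurable]: "f \<in> borel_measurable borel" by fact
  have "cmod (fourier f \<xi>) \<le> (LINT x|lborel. cmod (f x * echar (- (\<xi> * x))))"
    unfolding fourier_eq_lborel[OF assms(1)] by (rule integral_norm_bound)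
  also have "\<dots> \<le> (LINT x|lborel. K / (1 + x\<^sup>2))"
    using integrable_decay[OF assms] assms(2)
    by (intro integral_mono integrable_decay_majorant) (auto simp: norm_mult)
  finally show ?thesis .
qed

text \<open>
The integral of the derivative of \<open>f(x) e(-\<xi> x)\<close> vanishes because \<open>f\<close> tends to \<open>0\<close> at both ends.
\<close>

lemma fourier_deriv:
  assumes f: "\<And>x. (f has_vector_derivative f' x) (at x)" and f': "continuous_on UNIV f'"
    and bnd: "\<And>x. cmod (f x) \<le> K / (1 + x\<^sup>2)" "\<And>x. cmod (f' x) \<le> K / (1 + x\<^sup>2)"
  shows "fourier f' \<xi> = 2 * pi * \<xi> * \<i> * fourier f \<xi>"
proof -
  have cf: "continuous_on UNIV f"
    using f by (intro continuous_at_imp_continuous_on) (auto intro: has_vector_derivative_continuous)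
  have [measurable]: "f \<in> borel_measurable borel" "f' \<in> borel_measurable borel"
    using cf f' by (auto intro: borel_measurable_continuous_onI)
  define F where "F = (\<lambda>x. f x * echar (- \<xi> * x))"
  define G where "G = (\<lambda>x. f' x * echar (- \<xi> * x) - 2 * pi * \<xi> * \<i> * (f x * echar (- \<xi> * x)))"
  have i1: "integrable lborel (\<lambda>x. f' x * echar (- \<xi> * x))"
    by (rule integrable_decay[of _ K]) (use bnd in \<open>auto simp: norm_mult\<close>)
  have i2: "integrable lborel (\<lambda>x. f x * echar (- \<xi> * x))"
    by (rule integrable_decay[of _ K]) (use bnd in \<open>auto simp: norm_mult\<close>)
  have iG: "integrable lborel G"
    unfolding G_def by (intro Bochner_Integration.integrable_diff integrable_mult_right i1 i2)
  have dF: "(F has_vector_derivative G x) (at x)" for x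
    unfolding F_def G_def
    by (rule has_vector_derivative_eq_rhs[OF has_vector_derivative_mult[OF f echar_has_vector_derivative]])
       (simp add: algebra_simps)
  have cG: "continuous_on UNIV G"
    unfolding G_def by (intro continuous_intros cf f')
  have lims: "(F \<longlongrightarrow> 0) at_top" "(F \<longlongrightarrow> 0) at_bot"
    by (rule decay_tendsto_0[of F K]; use bnd in \<open>simp add: F_def norm_mult\<close>)+
  have "(LBINT x=-\<infinity>..\<infinity>. G x) = 0 - 0"
  proof (rule interval_integral_FTC_integrable[where F = F])
    show "set_integrable lborel (einterval (- \<infinity>) \<infinity>) G"
      using iG by (simp add: set_integrable_def)
    show "isCont G x" for x
      using cG by (simp add: continuous_on_eq_continuous_at)
  qed (use dF lims in \<open>auto simp: ereal_tendsto_simps\<close>)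
  then have "(LINT x|lborel. G x) = 0"
    by (simp add: interval_lebesgue_integral_def set_lebesgue_integral_def)
  then have "(LINT x|lborel. f' x * echar (- \<xi> * x)) =
      2 * pi * \<xi> * \<i> * (LINT x|lborel. f x * echar (- \<xi> * x))"
    unfolding G_def using i1 i2 by (subst (asm) Bochner_Integration.integral_diff) auto
  then show ?thesis
    by (simp add: fourier_eq_lborel)
qed

lemma integrable_tensor:
  fixes f :: "'a::euclidean_space \<Rightarrow> complex" and g :: "'b::euclidean_space \<Rightarrow> complex"
  assumes f: "integrable lborel f" and g: "integrable lborel g"
  shows "integrable (lborel \<Otimes>\<^sub>M lborel) (\<lambda>(x, y). f x * g y)"
proof (rule lborel_pair.Fubini_integrable)
  have [measurable]: "f \<in> borel_measurable borel" "g \<in> borel_measurable borel"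
    using f g by auto
  show "(\<lambda>(x, y). f x * g y) \<in> borel_measurable (lborel \<Otimes>\<^sub>M lborel)"
    by measurable
  show "integrable lborel (\<lambda>x. LINT y|lborel. cmod (case (x, y) of (x, y) \<Rightarrow> f x * g y))"
    using f by (simp add: norm_mult)
  show "AE x in lborel. integrable lborel (\<lambda>y. case (x, y) of (x, y) \<Rightarrow> f x * g y)"
    using g by simp
qed

lemma C2_decay_continuous: "C2_decay f \<Longrightarrow> continuous_on UNIV f"
  unfolding C2_decay_def
  by (intro continuous_at_imp_continuous_on) (auto intro: has_vector_derivative_continuous)

lemma C2_decay_measurable [measurable_dest]: "C2_decay f \<Longrightarrow> f \<in> borel_measurable borel"
  by (intro borel_measurable_continuous_onI C2_decay_continuous)

lemma C2_decay_integrable: "C2_decay f \<Longrightarrow> integrable lborel f"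
  using integrable_decay[OF C2_decay_measurable] unfolding C2_decay_def by metis

text \<open>
Applying the derivative rule twice, \<open>\<xi>^2\<close> times the transform of \<open>f\<close> is up to a constant the
transform of \<open>f''\<close>, hence bounded.
\<close>

lemma fourier_decay:
  assumes "C2_decay f"
  obtains K where "0 \<le> K" "\<And>\<xi>. cmod (fourier f \<xi>) \<le> K / (1 + \<xi>\<^sup>2)"
proof -
  obtain f' f'' K where f: "\<And>x. (f has_vector_derivative f' x) (at x)"
    and f': "\<And>x. (f' has_vector_derivative f'' x) (at x)"
    and f'': "continuous_on UNIV f''"
    and b: "\<And>x. cmod (f x) \<le> K / (1 + x\<^sup>2)" "\<And>x. cmod (f' x) \<le> K / (1 + x\<^sup>2)"
      "\<And>x. cmod (f'' x) \<le> K / (1 + x\<^sup>2)"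
    using assms unfolding C2_decay_def by metis
  define I where "I = (LINT x|lborel. K / (1 + x\<^sup>2))"
  have cf': "continuous_on UNIV f'"
    using f' by (intro continuous_at_imp_continuous_on) (auto intro: has_vector_derivative_continuous)
  have [measurable]: "f \<in> borel_measurable borel" "f'' \<in> borel_measurable borel"
    using f'' C2_decay_measurable[OF assms] by (auto intro: borel_measurable_continuous_onI)
  have 1: "cmod (fourier f \<xi>) \<le> I" for \<xi>
    unfolding I_def by (rule norm_fourier_le) (use b in auto)
  have 2: "cmod (fourier f'' \<xi>) \<le> I" for \<xi>
    unfolding I_def by (rule norm_fourier_le) (use b in auto)
  have 3: "\<xi>\<^sup>2 * cmod (fourier f \<xi>) \<le> I" for \<xi>
  proof -
    have "fourier f'' \<xi> = (2 * pi * \<xi> * \<i>)\<^sup>2 * fourier f \<xi>"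
      using fourier_deriv[OF f cf' b(1,2), of \<xi>] fourier_deriv[OF f' f'' b(2,3), of \<xi>]
      by (simp add: power2_eq_square)
    then have "cmod (fourier f'' \<xi>) = (2 * pi)\<^sup>2 * (\<xi>\<^sup>2 * cmod (fourier f \<xi>))"
      by (simp add: norm_mult norm_power power_mult_distrib)
    moreover have "1 * (\<xi>\<^sup>2 * cmod (fourier f \<xi>)) \<le> (2 * pi)\<^sup>2 * (\<xi>\<^sup>2 * cmod (fourier f \<xi>))"
      using pi_gt3 by (intro mult_right_mono one_le_power) auto
    ultimately show ?thesis
      using 2[of \<xi>] by simp
  qed
  show ?thesis
  proof
    show "0 \<le> 2 * I"
      using 1[of 0] norm_ge_zero[of "fourier f 0"] by linarith
    show "cmod (fourier f \<xi>) \<le> 2 * I / (1 + \<xi>\<^sup>2)" for \<xi>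
      using 1[of \<xi>] 3[of \<xi>] by (simp add: field_simps add_pos_nonneg)
  qed
qed

lemma borel_measurable_fourier [measurable (raw)]:
  assumes "f \<in> borel_measurable borel"
  shows "fourier f \<in> borel_measurable borel"
proof -
  have [measurable]: "f \<in> borel_measurable borel" by fact
  have "fourier f = (\<lambda>\<xi>. LINT x|lborel. f x * echar (- (\<xi> * x)))"
    using fourier_eq_lborel[OF assms] by auto
  also have "\<dots> \<in> borel_measurable borel"
    by measurable
  finally show ?thesis .
qed

lemma fourier_integrable:
  assumes "C2_decay f"
  shows "integrable lborel (fourier f)"
proof -
  obtain K where "0 \<le> K" "\<And>\<xi>. cmod (fourier f \<xi>) \<le> K / (1 + \<xi>\<^sup>2)"
    using fourier_decay[OF assms] by blast
  then show ?thesis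
    using C2_decay_measurable[OF assms] by (intro integrable_decay[of _ K]) auto
qed

lemma schwartz_C2_decay:
  assumes "f \<in> schwartz"
  shows "C2_decay f"
proof -
  obtain D :: "nat \<Rightarrow> real \<Rightarrow> complex" where D0: "D 0 = f"
    and D: "\<And>k x. (D k has_vector_derivative D (Suc k) x) (at x)"
    and bd: "\<And>j k. bounded (range (\<lambda>x. x ^ j *\<^sub>R D k x))"
    using assms unfolding schwartz_def by blast
  have "\<exists>K. \<forall>x. cmod (D k x) \<le> K / (1 + x\<^sup>2)" for k
  proof -
    obtain A where A: "\<And>x. norm (x ^ 0 *\<^sub>R D k x) \<le> A"
      using bd[of 0 k] unfolding bounded_iff by auto
    obtain B where B: "\<And>x. norm (x ^ 2 *\<^sub>R D k x) \<le> B"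
      using bd[of 2 k] unfolding bounded_iff by auto
    have "cmod (D k x) \<le> (A + B) / (1 + x\<^sup>2)" for x
      using A[of x] B[of x] by (simp add: field_simps add_pos_nonneg)
    then show ?thesis by blast
  qed
  then obtain K where K: "\<And>k x. cmod (D k x) \<le> K k / (1 + x\<^sup>2)"
    by metis
  define M where "M = max (K 0) (max (K 1) (K 2))"
  have M: "cmod (D k x) \<le> M / (1 + x\<^sup>2)" if "k \<in> {0, 1, 2}" for k x
  proof -
    have "K k / (1 + x\<^sup>2) \<le> M / (1 + x\<^sup>2)"
      using that by (intro divide_right_mono) (auto simp: M_def)
    then show ?thesis using K[of k x] by linarith
  qed
  have c: "continuous_on UNIV (D 2)"
    using D by (intro continuous_at_imp_continuous_on) (auto intro: has_vector_derivative_continuous)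
  show ?thesis
    unfolding C2_decay_def
    by (rule exI[of _ "D 1"], rule exI[of _ "D 2"], rule exI[of _ M])
       (use D[of 0] D[of 1] D0 M[of 0] M[of 1] M[of 2] c in \<open>auto simp: numeral_2_eq_2\<close>)
qed


text \<open>
The characteristic function of the standard normal distribution after rescaling.
\<close>

lemma gaussian_integral_echar:
  assumes "0 < \<epsilon>"
  shows "(LINT \<xi>|lborel. echar (\<xi> * w) * exp (- ((\<epsilon> * \<xi>)\<^sup>2 / 2))) =
      sqrt (2 * pi) / \<epsilon> * exp (- ((2 * pi * w / \<epsilon>)\<^sup>2 / 2))"
proof -
  have "char std_normal_distribution (2 * pi * w / \<epsilon>) =
      (LINT v|lborel. std_normal_density v *\<^sub>R iexp (2 * pi * w / \<epsilon> * v))"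
    unfolding char_def by (subst integral_density) auto
  then have 1: "(LINT v|lborel. std_normal_density v *\<^sub>R iexp (2 * pi * w / \<epsilon> * v)) =
      exp (- ((2 * pi * w / \<epsilon>)\<^sup>2 / 2))"
    by (simp add: char_std_normal_distribution)
  have "(LINT \<xi>|lborel. echar (\<xi> * w) * exp (- ((\<epsilon> * \<xi>)\<^sup>2 / 2))) =
      \<bar>1 / \<epsilon>\<bar> *\<^sub>R (LINT v|lborel. echar ((0 + 1 / \<epsilon> * v) * w) * exp (- ((\<epsilon> * (0 + 1 / \<epsilon> * v))\<^sup>2 / 2)))"
    using assms by (intro lborel_integral_real_affine) auto
  also have "(\<lambda>v. echar ((0 + 1 / \<epsilon> * v) * w) * exp (- ((\<epsilon> * (0 + 1 / \<epsilon> * v))\<^sup>2 / 2))) =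
      (\<lambda>v. complex_of_real (sqrt (2 * pi)) * (std_normal_density v *\<^sub>R iexp (2 * pi * w / \<epsilon> * v)))"
    using assms by (auto simp: fun_eq_iff std_normal_density_def echar_def cis_conv_exp scaleR_conv_of_real mult_ac)
  also have "(LINT v|lborel. complex_of_real (sqrt (2 * pi)) * (std_normal_density v *\<^sub>R iexp (2 * pi * w / \<epsilon> * v))) =
      sqrt (2 * pi) * exp (- ((2 * pi * w / \<epsilon>)\<^sup>2 / 2))"
    unfolding integral_mult_right_zero 1 by simp
  finally show ?thesis
    using assms by (simp add: scaleR_conv_of_real)
qed

text \<open>
Damp the inversion integral by a Gaussian of width \<open>1/\<epsilon>\<close>. By Fubini it equals the average of \<open>f\<close> over a
normal distribution centred at \<open>x\<close> of width proportional to \<open>\<epsilon>\<close>. As \<open>\<epsilon> \<rightarrow> 0\<close> the damped integral tends to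
the undamped one and the average tends to \<open>f x\<close>, both by dominated convergence.
\<close>

lemma fourier_inversion:
  assumes f: "integrable lborel f" and cont: "continuous_on UNIV f" and bound: "\<And>x. cmod (f x) \<le> M"
    and Ff: "integrable lborel (fourier f)"
  shows "(LINT \<xi>|lborel. fourier f \<xi> * echar (\<xi> * x)) = f x"
proof -
  have [measurable]: "f \<in> borel_measurable borel"
    using cont by (rule borel_measurable_continuous_onI)
  define g where "g = (\<lambda>\<xi>::real. exp (- (\<xi>\<^sup>2 / 2)))"
  have [measurable]: "g \<in> borel_measurable borel" unfolding g_def by measurable
  have g01: "0 \<le> g \<xi>" "g \<xi> \<le> 1" for \<xi> by (auto simp: g_def)
  define \<epsilon> where "\<epsilon> = (\<lambda>k. 1 / real (Suc k))"
  have \<epsilon>: "0 < \<epsilon> k" for k by (simp add: \<epsilon>_def)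
  have \<epsilon>0: "\<epsilon> \<longlonglongrightarrow> 0" unfolding \<epsilon>_def by real_asymp
  have gi: "integrable lborel (\<lambda>\<xi>. g (\<epsilon> k * \<xi>))" for k
  proof -
    have "integrable lborel (\<lambda>\<xi>. sqrt (2 * pi) * std_normal_density \<xi>)"
      by (intro integrable_mult_right) simp
    then have "integrable lborel g"
      by (rule Bochner_Integration.integrable_cong[THEN iffD1, rotated 2]) (auto simp: g_def std_normal_density_def)
    from lborel_integrable_real_affine[OF this, of "\<epsilon> k" 0] show ?thesis
      using \<epsilon>[of k] by simp
  qed
  define L where "L = (\<lambda>k. LINT \<xi>|lborel. fourier f \<xi> * echar (\<xi> * x) * g (\<epsilon> k * \<xi>))"
  have L1: "L \<longlonglongrightarrow> (LINT \<xi>|lborel. fourier f \<xi> * echar (\<xi> * x))"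
    unfolding L_def
  proof (rule integral_dominated_convergence[where w = "\<lambda>\<xi>. cmod (fourier f \<xi>)"])
    show "AE \<xi> in lborel. (\<lambda>k. fourier f \<xi> * echar (\<xi> * x) * complex_of_real (g (\<epsilon> k * \<xi>)))
        \<longlonglongrightarrow> fourier f \<xi> * echar (\<xi> * x)"
    proof (rule AE_I2)
      fix \<xi>
      have "(\<lambda>k. complex_of_real (g (\<epsilon> k * \<xi>))) \<longlonglongrightarrow> complex_of_real (exp (- ((0 * \<xi>)\<^sup>2 / 2)))"
        unfolding g_def by (intro tendsto_intros \<epsilon>0) simp
      from tendsto_mult[OF tendsto_const this, of "fourier f \<xi> * echar (\<xi> * x)"]
      show "(\<lambda>k. fourier f \<xi> * echar (\<xi> * x) * complex_of_real (g (\<epsilon> k * \<xi>)))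
        \<longlonglongrightarrow> fourier f \<xi> * echar (\<xi> * x)" by simp
    qed
    show "AE \<xi> in lborel. cmod (fourier f \<xi> * echar (\<xi> * x) * complex_of_real (g (\<epsilon> k * \<xi>))) \<le> cmod (fourier f \<xi>)" for k
      using g01 by (auto simp: norm_mult intro!: mult_left_le)
  qed (use Ff in auto)
  have Leq: "L k = (LINT u|lborel. std_normal_density u *\<^sub>R f (x + \<epsilon> k / (2 * pi) * u))" for k
  proof -
    have int: "integrable (lborel \<Otimes>\<^sub>M lborel) (\<lambda>(\<xi>, y). f y * echar (- (\<xi> * y)) * (echar (\<xi> * x) * g (\<epsilon> k * \<xi>)))"
    proof -
      have "integrable (lborel \<Otimes>\<^sub>M lborel) (\<lambda>(\<xi>, y). complex_of_real (g (\<epsilon> k * \<xi>)) * f y)"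
        by (rule integrable_tensor) (use gi f in auto)
      then show ?thesis
        by (rule Bochner_Integration.integrable_bound) (auto simp: norm_mult split_beta)
    qed
    have "L k = (LINT \<xi>|lborel. LINT y|lborel. f y * echar (- (\<xi> * y)) * (echar (\<xi> * x) * g (\<epsilon> k * \<xi>)))"
      unfolding L_def integral_mult_left_zero by (simp add: fourier_eq_lborel mult.assoc)
    also have "\<dots> = (LINT y|lborel. LINT \<xi>|lborel. f y * echar (- (\<xi> * y)) * (echar (\<xi> * x) * g (\<epsilon> k * \<xi>)))"
      by (rule lborel_pair.Fubini_integral[symmetric]) (use int in \<open>simp add: split_beta\<close>)
    also have "\<dots> = (LINT y|lborel. f y * (sqrt (2 * pi) / \<epsilon> k * exp (- ((2 * pi * (x - y) / \<epsilon> k)\<^sup>2 / 2))))"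
    proof (rule Bochner_Integration.integral_cong[OF refl])
      fix y
      have "(\<lambda>\<xi>. f y * echar (- (\<xi> * y)) * (echar (\<xi> * x) * g (\<epsilon> k * \<xi>))) =
         (\<lambda>\<xi>. f y * (echar (\<xi> * (x - y)) * exp (- ((\<epsilon> k * \<xi>)\<^sup>2 / 2))))"
        by (auto simp: g_def right_diff_distrib echar_diff mult_ac fun_eq_iff)
      then show "(LINT \<xi>|lborel. f y * echar (- (\<xi> * y)) * (echar (\<xi> * x) * g (\<epsilon> k * \<xi>))) =
          f y * (sqrt (2 * pi) / \<epsilon> k * exp (- ((2 * pi * (x - y) / \<epsilon> k)\<^sup>2 / 2)))"
        by (simp only: integral_mult_right_zero gaussian_integral_echar[OF \<epsilon>])
    qed
    also have "\<dots> = \<bar>\<epsilon> k / (2 * pi)\<bar> *\<^sub>R (LINT u|lborel. f (x + \<epsilon> k / (2 * pi) * u) *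
        (sqrt (2 * pi) / \<epsilon> k * exp (- ((2 * pi * (x - (x + \<epsilon> k / (2 * pi) * u)) / \<epsilon> k)\<^sup>2 / 2))))"
      using \<epsilon>[of k] by (intro lborel_integral_real_affine) auto
    also have "\<dots> = (LINT u|lborel. std_normal_density u *\<^sub>R f (x + \<epsilon> k / (2 * pi) * u))"
    proof (subst integral_scaleR_right[symmetric], rule Bochner_Integration.integral_cong[OF refl])
      fix u
      have s: "complex_of_real (sqrt (2 * pi)) * complex_of_real (sqrt (2 * pi)) = 2 * complex_of_real pi"
        by (subst of_real_mult[symmetric]) simp
      have "2 * pi * (x - (x + \<epsilon> k / (2 * pi) * u)) / \<epsilon> k = - u"
        using \<epsilon>[of k] by (simp add: field_simps)
      then show "\<bar>\<epsilon> k / (2 * pi)\<bar> *\<^sub>R (f (x + \<epsilon> k / (2 * pi) * u) *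
        (sqrt (2 * pi) / \<epsilon> k * exp (- ((2 * pi * (x - (x + \<epsilon> k / (2 * pi) * u)) / \<epsilon> k)\<^sup>2 / 2))))
        = std_normal_density u *\<^sub>R f (x + \<epsilon> k / (2 * pi) * u)"
        using \<epsilon>[of k] s by (simp add: std_normal_density_def scaleR_conv_of_real field_simps)
    qed
    finally show ?thesis .
  qed
  have L2: "L \<longlonglongrightarrow> (LINT u|lborel. std_normal_density u *\<^sub>R f x)"
    unfolding Leq
  proof (rule integral_dominated_convergence[where w = "\<lambda>u. std_normal_density u * M"])
    show "AE u in lborel. (\<lambda>k. std_normal_density u *\<^sub>R f (x + \<epsilon> k / (2 * pi) * u)) \<longlonglongrightarrow> std_normal_density u *\<^sub>R f x"
    proof (rule AE_I2)
      fix u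
      have "(\<lambda>k. x + \<epsilon> k / (2 * pi) * u) \<longlonglongrightarrow> x"
        unfolding \<epsilon>_def by real_asymp
      then have "(\<lambda>k. f (x + \<epsilon> k / (2 * pi) * u)) \<longlonglongrightarrow> f x"
        using cont by (intro isCont_tendsto_compose[of x f]) (auto simp: continuous_on_eq_continuous_at)
      then show "(\<lambda>k. std_normal_density u *\<^sub>R f (x + \<epsilon> k / (2 * pi) * u)) \<longlonglongrightarrow> std_normal_density u *\<^sub>R f x"
        by (intro tendsto_intros)
    qed
    show "AE u in lborel. norm (std_normal_density u *\<^sub>R f (x + \<epsilon> k / (2 * pi) * u)) \<le> std_normal_density u * M" for k
      using bound by (auto intro!: mult_left_mono)
  qed auto
  have "(LINT u|lborel. std_normal_density u *\<^sub>R f x) = f x"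
    by simp
  with L1 L2 show ?thesis
    using LIMSEQ_unique by auto
qed


section \<open>Fourier series of compactly supported functions\<close>

text \<open>
Unordered sums are evaluated along a sequence of finite sets, because dominated convergence and
Fatou's lemma are statements about sequences.
\<close>

lemma has_sum_tendsto_exhaustion:
  assumes "(f has_sum s) UNIV" and fin: "\<And>n. finite (K n)"
    and ev: "\<And>z. \<forall>\<^sub>F n in sequentially. z \<in> K n"
  shows "(\<lambda>n. sum f (K n)) \<longlonglongrightarrow> s"
proof -
  have "filterlim K (finite_subsets_at_top UNIV) sequentially"
    unfolding filterlim_iff
  proof (intro allI impI)
    fix P :: "'a set \<Rightarrow> bool"
    assume "eventually P (finite_subsets_at_top UNIV)"
    then obtain X where X: "finite X" "\<And>Y. finite Y \<Longrightarrow> X \<subseteq> Y \<Longrightarrow> P Y"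
      unfolding eventually_finite_subsets_at_top by auto
    have "\<forall>\<^sub>F n in sequentially. \<forall>z\<in>X. z \<in> K n"
      using X(1) ev by (intro eventually_ball_finite) auto
    then show "\<forall>\<^sub>F n in sequentially. P (K n)"
      by eventually_elim (use X fin in auto)
  qed
  then show ?thesis
    using assms(1) unfolding has_sum_def by (rule filterlim_compose[rotated])
qed

lemma finite_sym_int: "finite {- int n..int n}" by simp

lemma eventually_mem_sym_int: "\<forall>\<^sub>F n in sequentially. k \<in> {- int n..int n}"
  using eventually_ge_at_top[of "nat \<bar>k\<bar>"] by eventually_elim auto

lemma cesaro_mean:
  fixes T :: "nat \<Rightarrow> complex"
  assumes "T \<longlonglongrightarrow> L"
  shows "(\<lambda>N. (\<Sum>n<N. T n) / of_nat N) \<longlonglongrightarrow> L"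
proof -
  have "(\<lambda>N. (\<Sum>n<N. T n - L) / of_nat N) \<longlonglongrightarrow> 0"
  proof (rule LIMSEQ_I)
    fix r :: real assume r: "0 < r"
    have "(\<lambda>n. T n - L) \<longlonglongrightarrow> 0" using assms LIM_zero by blast
    from LIMSEQ_D[OF this half_gt_zero[OF r]] obtain m where m: "\<And>n. m \<le> n \<Longrightarrow> cmod (T n - L) < r / 2"
      by auto
    define A where "A = (\<Sum>n<m. cmod (T n - L))"
    obtain M where M: "2 * A / r < real M" using reals_Archimedean2 by blast
    have "cmod ((\<Sum>n<N. T n - L) / of_nat N) < r" if N: "N \<ge> Suc (max m M)" for N
    proof -
      have "cmod (\<Sum>n<N. T n - L) \<le> (\<Sum>n<N. cmod (T n - L))"
        by (rule norm_sum)
      also have "\<dots> = A + (\<Sum>n=m..<N. cmod (T n - L))"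
        unfolding A_def using N by (simp add: lessThan_atLeast0 sum.atLeastLessThan_concat)
      also have "(\<Sum>n=m..<N. cmod (T n - L)) \<le> (\<Sum>n=m..<N. r / 2)"
        by (intro sum_mono) (use m in \<open>auto intro: less_imp_le\<close>)
      also have "\<dots> \<le> real N * (r / 2)"
        using r N by (simp add: mult_right_mono)
      also have "A < real N * (r / 2)"
      proof -
        have "2 * A / r < real N" using M N by linarith
        then show ?thesis using r by (simp add: field_simps)
      qed
      finally have "cmod (\<Sum>n<N. T n - L) < real N * r" by (simp add: mult.commute)
      then show ?thesis using N by (simp add: norm_divide divide_less_eq mult.commute)
    qed
    then show "\<exists>no. \<forall>n\<ge>no. cmod ((\<Sum>n<n. T n - L) / of_nat n - 0) < r"
      by auto
  qed
  then have "(\<lambda>N. (\<Sum>n<N. T n - L) / of_nat N + L) \<longlonglongrightarrow> 0 + L"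
    by (intro tendsto_intros)
  moreover have "\<forall>\<^sub>F N in sequentially. (\<Sum>n<N. T n - L) / of_nat N + L = (\<Sum>n<N. T n) / of_nat N"
    using eventually_gt_at_top[of 0] by eventually_elim (simp add: sum_subtractf field_simps)
  ultimately show ?thesis
    by (simp add: Lim_transform_eventually)
qed

lemma echar_of_nat_mult: "echar (real n * y) = echar y ^ n"
  by (induction n) (simp_all add: echar_add distrib_right)

lemma integral_echar_unit_interval:
  "(LINT t|lborel. indicator {-1/2..1/2} t *\<^sub>R echar (of_int n * t)) = (if n = 0 then 1 else 0)"
proof (cases "n = 0")
  case False
  define c where "c = 2 * pi * of_int n * \<i>"
  have c: "c \<noteq> 0" using False by (simp add: c_def)
  have "(LINT t|lborel. indicator {-1/2..1/2} t *\<^sub>R echar (of_int n * t)) =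
     inverse c * echar (of_int n * (1/2)) - inverse c * echar (of_int n * (- 1/2))"
  proof (rule integral_FTC_atLeastAtMost)
    show "((\<lambda>t. inverse c * echar (of_int n * t)) has_vector_derivative echar (of_int n * t)) (at t within {- 1/2..1/2})" for t
      by (rule has_vector_derivative_at_within,
          rule has_vector_derivative_eq_rhs[OF has_vector_derivative_mult_right[OF echar_has_vector_derivative]])
         (use c in \<open>simp add: c_def field_simps\<close>)
  qed (auto intro!: continuous_intros)
  also have "echar (of_int n * (1/2)) = echar (of_int n * (- 1/2))"
    using echar_add[of "of_int n * (- 1/2)" "of_int n"] by simp
  finally show ?thesis using False by simp
qed simp

text \<open>
\<open>\<bar>e(\<tau>) - 1\<bar> = 2 \<bar>sin (\<pi> \<tau>)\<bar>\<close>, and the concave function \<open>sin\<close> lies above its chords on \<open>[0, \<pi>]\<close>.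
\<close>

lemma echar_minus_1_lower_bound:
  assumes "0 < r" "r < 1"
  obtains c where "0 < c" "\<And>\<tau>. \<bar>\<tau>\<bar> \<le> r \<Longrightarrow> c * \<bar>\<tau>\<bar> \<le> cmod (echar \<tau> - 1)"
proof -
  have cx: "convex_on {0..pi} (\<lambda>y::real. - sin y)"
    by (rule f''_ge0_imp_convex[where f' = "\<lambda>y. - cos y" and f'' = "\<lambda>y. sin y"])
       (auto intro!: derivative_eq_intros sin_ge_zero)
  define c where "c = 2 * sin (pi * r) / r"
  have norm_eq: "cmod (echar \<tau> - 1) = 2 * \<bar>sin (pi * \<tau>)\<bar>" for \<tau>
  proof -
    have "echar \<tau> - 1 = cis (pi * \<tau>) * (cis (pi * \<tau>) - cis (- (pi * \<tau>)))"
      by (simp add: echar_def cis_mult right_diff_distrib mult.assoc)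
    also have "cis (pi * \<tau>) - cis (- (pi * \<tau>)) = 2 * \<i> * sin (pi * \<tau>)"
      by (simp add: complex_eq_iff)
    finally show ?thesis by (simp add: norm_mult)
  qed
  have pos: "c * \<tau> \<le> 2 * sin (pi * \<tau>)" if "0 \<le> \<tau>" "\<tau> \<le> r" for \<tau>
  proof -
    have "- sin ((1 - \<tau> / r) *\<^sub>R 0 + (\<tau> / r) *\<^sub>R (pi * r)) \<le> (1 - \<tau> / r) * - sin 0 + (\<tau> / r) * - sin (pi * r)"
      by (rule convex_onD[OF cx]) (use that assms in auto)
    then have "\<tau> * sin (pi * r) / r \<le> sin (pi * \<tau>)" using assms by (simp add: mult_ac)
    then have "2 * (\<tau> * sin (pi * r) / r) \<le> 2 * sin (pi * \<tau>)" by (rule mult_left_mono) simp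
    then show ?thesis by (simp add: c_def mult_ac)
  qed
  show ?thesis
  proof
    show "0 < c"
      using assms by (auto simp: c_def intro!: divide_pos_pos sin_gt_zero)
    show "c * \<bar>\<tau>\<bar> \<le> cmod (echar \<tau> - 1)" if "\<bar>\<tau>\<bar> \<le> r" for \<tau>
      using pos[of "\<bar>\<tau>\<bar>"] that unfolding norm_eq by (cases "0 \<le> \<tau>") auto
  qed
qed

lemma C2_decay_lipschitz:
  assumes "C2_decay f"
  obtains L where "0 \<le> L" "\<And>x y. cmod (f x - f y) \<le> L * \<bar>x - y\<bar>"
proof -
  obtain f' K where f: "\<And>x. (f has_vector_derivative f' x) (at x)"
    and b: "\<And>x. cmod (f' x) \<le> K / (1 + x\<^sup>2)"
    using assms unfolding C2_decay_def by metis
  have K: "0 \<le> K" using order_trans[OF norm_ge_zero b[of 0]] by simp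
  have b': "cmod (f' x) \<le> K" for x
  proof -
    have "K / (1 + x\<^sup>2) \<le> K / 1" using K by (intro divide_left_mono) (auto simp: add_pos_nonneg)
    then show ?thesis using b[of x] by simp
  qed
  have "cmod (f x - f y) \<le> K * norm (x - y)" for x y
    by (rule differentiable_bound[of UNIV f "\<lambda>x h. h *\<^sub>R f' x"])
       (use f b' in \<open>auto simp: has_vector_derivative_def mult.commute[of K] intro!: onorm_le mult_left_mono\<close>)
  with K that show ?thesis by auto
qed

lemma summable_on_int_decay:
  assumes "\<And>n::int. cmod (f n) \<le> K / (1 + (of_int n)\<^sup>2)"
  shows "(\<lambda>n. cmod (f n)) summable_on UNIV"
proof -
  have s: "summable (\<lambda>n::nat. K / (1 + (real n)\<^sup>2))"
  proof (rule summable_comparison_test_ev)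
    show "\<forall>\<^sub>F n in sequentially. norm (K / (1 + (real n)\<^sup>2)) \<le> \<bar>K\<bar> * (1 / (real n ^ 2))"
      using eventually_gt_at_top[of 0]
    proof eventually_elim
      case (elim n)
      have "\<bar>K\<bar> / (1 + (real n)\<^sup>2) \<le> \<bar>K\<bar> / (real n)\<^sup>2"
        using elim by (intro divide_left_mono) (auto simp: add_pos_nonneg)
      then show ?case by simp
    qed
    show "summable (\<lambda>n. \<bar>K\<bar> * (1 / (real n ^ 2)))"
      using inverse_power_summable[of 2, where 'a = real]
      by (intro summable_mult) (simp add: divide_inverse)
  qed
  have "(\<lambda>n::nat. cmod (f (int n))) summable_on UNIV" "(\<lambda>n::nat. cmod (f (- int n))) summable_on UNIV"
    by (rule norm_summable_imp_summable_on, rule summable_comparison_test[OF _ s],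
        use assms[of "int _"] assms[of "- int _"] in auto)+
  then have "(\<lambda>n. cmod (f n)) summable_on range int" "(\<lambda>n. cmod (f n)) summable_on range (\<lambda>n. - int n)"
    by (subst summable_on_reindex; auto simp: o_def inj_on_def)+
  then have "(\<lambda>n. cmod (f n)) summable_on (range int \<union> range (\<lambda>n. - int n))"
    by (rule summable_on_union)
  also have "range int \<union> range (\<lambda>n. - int n) = UNIV"
  proof -
    have "z \<in> range int \<union> range (\<lambda>n. - int n)" for z
      by (cases z rule: int_cases2) auto
    then show ?thesis by auto
  qed
  finally show ?thesis .
qed

lemma summable_fourier_int:
  assumes "C2_decay h"
  shows "(\<lambda>n::int. cmod (fourier h (of_int n))) summable_on UNIV"
proof -
  obtain K where "\<And>\<xi>. cmod (fourier h \<xi>) \<le> K / (1 + \<xi>\<^sup>2)" using fourier_decay[OF assms] by blast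
  then show ?thesis by (rule summable_on_int_decay)
qed

text \<open>
Chernoff's telescoping argument. With \<open>Q(t) = (h(t) - h(x)) / (e(t - x) - 1)\<close> on the unit interval, a
bounded function because \<open>h\<close> is Lipschitz, the terms of the series for \<open>h(t) - h(x)\<close> at \<open>x\<close> are the
differences \<open>D(n - 1) - D(n)\<close>, where \<open>D(n)\<close> is the \<open>n\<close>-th Fourier coefficient of \<open>Q\<close> times \<open>e(n x)\<close>. So a
symmetric partial sum minus \<open>h(x)\<close> equals \<open>D(-n - 1) - D(n)\<close>. The partial sums are known to converge,
hence it suffices that the Cesaro means of these differences tend to \<open>0\<close>; these are integrals of \<open>Q\<close> against
normalised geometric sums, which are bounded and tend to \<open>0\<close> for \<open>t \<noteq> x\<close>.
\<close>

lemma fourier_series: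
  assumes h: "C2_decay h" and supp: "\<And>t. 1/2 \<le> \<bar>t\<bar> \<Longrightarrow> h t = 0" and x: "\<bar>x\<bar> < 1/2"
  shows "((\<lambda>n. fourier h (of_int n) * echar (of_int n * x)) has_sum h x) UNIV"
proof -
  have [measurable]: "h \<in> borel_measurable borel" using C2_decay_measurable[OF h] .
  define I :: "real set" where "I = {-1/2..1/2}"
  have [measurable]: "I \<in> sets borel" by (simp add: I_def)
  obtain L where L: "0 \<le> L" "\<And>x y. cmod (h x - h y) \<le> L * \<bar>x - y\<bar>"
    using C2_decay_lipschitz[OF h] by blast
  obtain c where c: "0 < c" "\<And>\<tau>. \<bar>\<tau>\<bar> \<le> 1/2 + \<bar>x\<bar> \<Longrightarrow> c * \<bar>\<tau>\<bar> \<le> cmod (echar \<tau> - 1)"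
    by (rule echar_minus_1_lower_bound[of "1/2 + \<bar>x\<bar>"]) (use x in auto)
  \<comment> \<open>At \<open>t = x\<close> the quotient is \<open>0 / 0 = 0\<close>, a harmless value on a null set.\<close>
  define Q where "Q = (\<lambda>t. indicat_real I t *\<^sub>R ((h t - h x) / (echar (t - x) - 1)))"
  have [measurable]: "Q \<in> borel_measurable borel" unfolding Q_def by measurable
  have Qb: "cmod (Q t) \<le> L / c * indicator I t" for t
  proof (cases "t \<in> I \<and> t \<noteq> x")
    case True
    then have "c * \<bar>t - x\<bar> \<le> cmod (echar (t - x) - 1)" by (intro c) (auto simp: I_def)
    moreover have "0 < c * \<bar>t - x\<bar>" using True c(1) by auto
    ultimately have "cmod (h t - h x) / cmod (echar (t - x) - 1) \<le> (L * \<bar>t - x\<bar>) / (c * \<bar>t - x\<bar>)"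
      using L by (intro frac_le) auto
    then show ?thesis using True by (simp add: Q_def norm_divide)
  qed (use L c in \<open>auto simp: Q_def indicator_def\<close>)
  have Qi: "integrable lborel Q"
    by (rule Bochner_Integration.integrable_bound[of _ "\<lambda>t. L / c * indicator I t"])
       (use order_trans[OF Qb abs_ge_self] in \<open>auto simp: I_def\<close>)
  define D where "D = (\<lambda>n::int. LINT t|lborel. Q t * echar (of_int n * (x - t)))"
  have Di: "integrable lborel (\<lambda>t. Q t * echar (of_int n * (x - t)))" for n
    by (rule Bochner_Integration.integrable_bound[OF Qi]) (auto simp: norm_mult)
  have step: "D (n - 1) - D n = fourier h (of_int n) * echar (of_int n * x) - (if n = 0 then h x else 0)" for n
  proof -
    have "D (n - 1) - D n = (LINT t|lborel. Q t * echar (of_int (n - 1) * (x - t)) - Q t * echar (of_int n * (x - t)))"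
      unfolding D_def using Di by (intro Bochner_Integration.integral_diff[symmetric])
    also have "\<dots> = (LINT t|lborel. echar (of_int n * x) * (h t * echar (- (of_int n * t))) -
        h x * echar (of_int n * x) * (indicat_real I t *\<^sub>R echar (of_int (- n) * t)))"
    proof (rule Bochner_Integration.integral_cong[OF refl])
      fix t
      have e: "echar (of_int (n - 1) * (x - t)) = echar (of_int n * (x - t)) * echar (t - x)"
        by (simp add: echar_add[symmetric] algebra_simps)
      have e2: "echar (of_int n * (x - t)) = echar (of_int n * x) * echar (- (of_int n * t))"
        by (simp add: echar_add[symmetric] algebra_simps)
      have ne: "echar (t - x) \<noteq> 1" if "t \<in> I" "t \<noteq> x"
      proof -
        have "0 < c * \<bar>t - x\<bar>" using that c(1) by auto
        also have "\<dots> \<le> cmod (echar (t - x) - 1)" using that by (intro c) (auto simp: I_def)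
        finally show ?thesis by auto
      qed
      have "Q t * (echar (t - x) - 1) = indicat_real I t *\<^sub>R (h t - h x)"
        by (cases "t \<in> I \<and> t \<noteq> x") (use ne in \<open>auto simp: Q_def\<close>)
      moreover have "indicat_real I t *\<^sub>R h t = h t"
        by (cases "t \<in> I") (use supp[of t] in \<open>auto simp: I_def\<close>)
      ultimately have q: "Q t * (echar (t - x) - 1) = h t - indicat_real I t *\<^sub>R h x"
        by (simp add: scaleR_diff_right)
      have "Q t * echar (of_int (n - 1) * (x - t)) - Q t * echar (of_int n * (x - t)) =
         (Q t * (echar (t - x) - 1)) * echar (of_int n * (x - t))"
        unfolding e by (simp add: algebra_simps)
      also have "\<dots> = (h t - indicat_real I t *\<^sub>R h x) * (echar (of_int n * x) * echar (- (of_int n * t)))"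
        unfolding q e2 ..
      finally show "Q t * echar (of_int (n - 1) * (x - t)) - Q t * echar (of_int n * (x - t)) =
        echar (of_int n * x) * (h t * echar (- (of_int n * t))) -
        h x * echar (of_int n * x) * (indicat_real I t *\<^sub>R echar (of_int (- n) * t))"
        by (simp add: algebra_simps scaleR_conv_of_real)
    qed
    also have "\<dots> = echar (of_int n * x) * (LINT t|lborel. h t * echar (- (of_int n * t))) -
        h x * echar (of_int n * x) * (LINT t|lborel. indicat_real I t *\<^sub>R echar (of_int (- n) * t))"
    proof (subst Bochner_Integration.integral_diff)
      show "integrable lborel (\<lambda>t. echar (of_int n * x) * (h t * echar (- (of_int n * t))))"
        by (rule Bochner_Integration.integrable_bound[OF C2_decay_integrable[OF h]]) (auto simp: norm_mult)
      show "integrable lborel (\<lambda>t. h x * echar (of_int n * x) * (indicat_real I t *\<^sub>R echar (of_int (- n) * t)))"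
        by (rule Bochner_Integration.integrable_bound[of _ "\<lambda>t. cmod (h x) * indicator I t"])
           (auto simp: norm_mult I_def)
    qed (simp only: integral_mult_right_zero)
    also have "(LINT t|lborel. h t * echar (- (of_int n * t))) = fourier h (of_int n)"
      by (simp add: fourier_eq_lborel)
    also have "(LINT t|lborel. indicat_real I t *\<^sub>R echar (of_int (- n) * t)) = (if n = 0 then 1 else 0)"
      using integral_echar_unit_interval[of "- n"] by (simp add: I_def)
    finally show ?thesis by (simp add: mult_ac)
  qed
  define a where "a = (\<lambda>n. fourier h (of_int n) * echar (of_int n * x))"
  have part: "sum a {- int n..int n} - h x = D (- int n - 1) - D (int n)" for n
  proof (induction n)
    case 0 then show ?case using step[of 0] by (simp add: a_def)
  next
    case (Suc n)
    have "{- int (Suc n)..int (Suc n)} = insert (- int (Suc n)) (insert (int (Suc n)) {- int n..int n})"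
      by auto
    then have new: "sum a {- int (Suc n)..int (Suc n)} = a (- int (Suc n)) + (a (int (Suc n)) + sum a {- int n..int n})"
      by simp
    have neg: "- int n - 1 = - int (Suc n)" by simp
    have left: "a (- int (Suc n)) = D (- int (Suc n) - 1) - D (- int n - 1)"
      unfolding neg using step[of "- int (Suc n)"] by (simp add: a_def)
    have right: "a (int (Suc n)) = D (int n) - D (int (Suc n))"
      using step[of "int (Suc n)"] by (simp add: a_def)
    have "sum a {- int (Suc n)..int (Suc n)} - h x =
        (D (- int (Suc n) - 1) - D (- int n - 1)) + (D (int n) - D (int (Suc n))) + (sum a {- int n..int n} - h x)"
      unfolding new left right by (simp add: algebra_simps)
    then show ?case unfolding Suc.IH by simp
  qed
  have abs: "(\<lambda>n. cmod (a n)) summable_on UNIV"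
    using summable_fourier_int[OF h] by (simp add: a_def norm_mult)
  then have hs: "(a has_sum infsum a UNIV) UNIV"
    by (rule has_sum_infsum[OF abs_summable_summable])
  have "(\<lambda>n. sum a {- int n..int n} - h x) \<longlonglongrightarrow> infsum a UNIV - h x"
    by (intro tendsto_intros has_sum_tendsto_exhaustion[OF hs] finite_sym_int eventually_mem_sym_int)
  then have lim1: "(\<lambda>N. (\<Sum>n<N. D (- int n - 1) - D (int n)) / of_nat N) \<longlonglongrightarrow> infsum a UNIV - h x"
    unfolding part by (rule cesaro_mean)
  define W where "W = (\<lambda>N t. (\<Sum>n<N. echar (of_int (- int n - 1) * (x - t)) - echar (of_int (int n) * (x - t))) / of_nat N)"
  have Weq: "(\<Sum>n<N. D (- int n - 1) - D (int n)) / of_nat N = (LINT t|lborel. Q t * W N t)" for N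
  proof -
    have "(\<Sum>n<N. D (- int n - 1) - D (int n)) = (\<Sum>n<N. LINT t|lborel. Q t * echar (of_int (- int n - 1) * (x - t)) - Q t * echar (of_int (int n) * (x - t)))"
      unfolding D_def using Di by (intro sum.cong refl Bochner_Integration.integral_diff[symmetric])
    also have "\<dots> = (LINT t|lborel. (\<Sum>n<N. Q t * echar (of_int (- int n - 1) * (x - t)) - Q t * echar (of_int (int n) * (x - t))))"
      using Di by (intro Bochner_Integration.integral_sum[symmetric] Bochner_Integration.integrable_diff)
    finally show ?thesis
      by (simp add: W_def sum_distrib_left right_diff_distrib flip: integral_divide_zero)
  qed
  have lim2: "(\<lambda>N. LINT t|lborel. Q t * W N t) \<longlonglongrightarrow> (LINT t::real|lborel. 0)"
  proof (rule integral_dominated_convergence[where w = "\<lambda>t. 2 * cmod (Q t)"])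
    show "integrable lborel (\<lambda>t. 2 * cmod (Q t))" using Qi by simp
    show "(\<lambda>t. Q t * W N t) \<in> borel_measurable lborel" for N
      unfolding W_def by measurable
    show "AE t in lborel. norm (Q t * W N t) \<le> 2 * cmod (Q t)" for N
    proof (rule AE_I2)
      fix t
      have "cmod (\<Sum>n<N. echar (of_int (- int n - 1) * (x - t)) - echar (of_int (int n) * (x - t))) \<le> (\<Sum>n<N. 2)"
        by (intro sum_norm_le order_trans[OF norm_triangle_ineq4]) simp
      then have "cmod (W N t) \<le> 2"
        by (cases "N = 0") (auto simp: W_def norm_divide field_simps)
      then show "norm (Q t * W N t) \<le> 2 * cmod (Q t)"
        by (simp add: norm_mult mult.commute[of 2] mult_left_mono)
    qed
    show "AE t in lborel. (\<lambda>N. Q t * W N t) \<longlonglongrightarrow> 0"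
    proof (rule AE_I2)
      fix t
      show "(\<lambda>N. Q t * W N t) \<longlonglongrightarrow> 0"
      proof (cases "t \<in> I \<and> t \<noteq> x")
        case False
        then have "Q t = 0" by (auto simp: Q_def)
        then show ?thesis by simp
      next
        case True
        define z where "z = echar (x - t)"
        have "0 < c * \<bar>x - t\<bar>" using True c(1) by auto
        also have "\<dots> \<le> cmod (z - 1)" using True unfolding z_def by (intro c) (auto simp: I_def)
        finally have z1: "z \<noteq> 1" by auto
        define w where "w = echar (t - x)"
        have wz: "w * z = 1" unfolding w_def z_def by (simp flip: echar_add)
        with z1 have w1: "w \<noteq> 1" by auto
        have nz: "cmod z = 1" "cmod w = 1" by (simp_all add: z_def w_def)
        have gp: "cmod (\<Sum>n<N. y ^ n) \<le> 2 / cmod (y - 1)" if "y \<noteq> 1" "cmod y = 1" for y N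
        proof -
          have "(\<Sum>n<N. y ^ n) = (y ^ N - 1) / (y - 1)"
            using that by (simp add: geometric_sum)
          moreover have "cmod (y ^ N - 1) \<le> 2"
            using that norm_triangle_ineq4[of "y ^ N" 1] by (simp add: norm_power)
          ultimately show ?thesis by (simp add: norm_divide divide_right_mono)
        qed
        define B where "B = 2 / cmod (w - 1) + 2 / cmod (z - 1)"
        have "cmod (W N t) \<le> B / real N" for N
        proof -
          have e1: "echar (of_int (- int n - 1) * (x - t)) = w * w ^ n" for n
          proof -
            have "echar (of_int (- int n - 1) * (x - t)) = echar (t - x) * echar (real n * (t - x))"
              by (simp add: echar_add[symmetric] algebra_simps)
            then show ?thesis by (simp add: w_def echar_of_nat_mult)
          qed
          have e2: "echar (of_int (int n) * (x - t)) = z ^ n" for n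
            by (simp add: z_def echar_of_nat_mult)
          have "W N t = (w * (\<Sum>n<N. w ^ n) - (\<Sum>n<N. z ^ n)) / of_nat N"
            unfolding W_def e1 e2 by (simp add: sum_subtractf sum_distrib_left)
          moreover have "cmod (w * (\<Sum>n<N. w ^ n) - (\<Sum>n<N. z ^ n)) \<le> B"
            unfolding B_def using gp[OF w1 nz(2), of N] gp[OF z1 nz(1), of N]
            by (intro order_trans[OF norm_triangle_ineq4] add_mono) (auto simp: norm_mult nz)
          ultimately show ?thesis by (simp add: norm_divide divide_right_mono)
        qed
        moreover have "(\<lambda>N. B / real N) \<longlonglongrightarrow> 0" by real_asymp
        ultimately have "(\<lambda>N. W N t) \<longlonglongrightarrow> 0"
          by (intro Lim_null_comparison[of "\<lambda>N. W N t"]) auto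
        then show ?thesis by (rule tendsto_mult_right_zero)
      qed
    qed
  qed auto
  have "infsum a UNIV - h x = 0"
    using LIMSEQ_unique[OF lim1 lim2[folded Weq]] by simp
  then show ?thesis using hs by (simp add: a_def)
qed


section \<open>Twice differentiable cutoffs and exchange of sum and integral\<close>

definition C2 :: "(real \<Rightarrow> 'a::real_normed_vector) \<Rightarrow> bool" where
  "C2 f \<longleftrightarrow> (\<exists>f' f''. (\<forall>x. (f has_vector_derivative f' x) (at x)) \<and>
     (\<forall>x. (f' has_vector_derivative f'' x) (at x)) \<and> continuous_on UNIV f'')"

lemma C2_I:
  assumes "\<And>x. (f has_vector_derivative f' x) (at x)" "\<And>x. (f' has_vector_derivative f'' x) (at x)"
    "continuous_on UNIV f''"
  shows "C2 f"
  using assms unfolding C2_def by blast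

lemma continuous_on_of_vector_derivative:
  "(\<And>x. (f has_vector_derivative f' x) (at x)) \<Longrightarrow> continuous_on UNIV f"
  by (intro continuous_at_imp_continuous_on) (auto intro: has_vector_derivative_continuous)

lemma C2_decay_imp_C2: "C2_decay f \<Longrightarrow> C2 f"
  unfolding C2_decay_def C2_def by metis

lemma C2_affine: "C2 (\<lambda>x. a + b * x :: real)"
  by (rule C2_I[where f' = "\<lambda>x. b" and f'' = "\<lambda>x. 0"]) (auto intro!: derivative_eq_intros)

lemma C2_echar: "C2 (\<lambda>x. echar (a * x))"
proof (rule C2_I)
  show "((\<lambda>x. echar (a * x)) has_vector_derivative 2 * pi * a * \<i> * echar (a * x)) (at x)" for x
    by (rule echar_has_vector_derivative)
  show "((\<lambda>x. 2 * pi * a * \<i> * echar (a * x)) has_vector_derivative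
      2 * pi * a * \<i> * (2 * pi * a * \<i> * echar (a * x))) (at x)" for x
    by (intro has_vector_derivative_mult_right echar_has_vector_derivative)
qed (intro continuous_intros)

lemma C2_mult:
  fixes f g :: "real \<Rightarrow> 'a::real_normed_algebra"
  assumes "C2 f" "C2 g"
  shows "C2 (\<lambda>x. f x * g x)"
proof -
  obtain f' f'' where f: "\<And>x. (f has_vector_derivative f' x) (at x)"
      "\<And>x. (f' has_vector_derivative f'' x) (at x)" "continuous_on UNIV f''"
    using assms(1) unfolding C2_def by blast
  obtain g' g'' where g: "\<And>x. (g has_vector_derivative g' x) (at x)"
      "\<And>x. (g' has_vector_derivative g'' x) (at x)" "continuous_on UNIV g''"
    using assms(2) unfolding C2_def by blast
  note c = continuous_on_of_vector_derivative[OF f(1)] continuous_on_of_vector_derivative[OF f(2)]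
    continuous_on_of_vector_derivative[OF g(1)] continuous_on_of_vector_derivative[OF g(2)]
  show ?thesis
    by (rule C2_I[where f' = "\<lambda>x. f x * g' x + f' x * g x" and
          f'' = "\<lambda>x. (f x * g'' x + f' x * g' x) + (f' x * g' x + f'' x * g x)"])
       (intro has_vector_derivative_mult has_vector_derivative_add continuous_intros f g c)+
qed

lemma C2_compose:
  fixes f :: "real \<Rightarrow> real" and g :: "real \<Rightarrow> real"
  assumes "C2 f" "C2 g"
  shows "C2 (\<lambda>x. g (f x))"
proof -
  obtain f' f'' where f: "\<And>x. (f has_vector_derivative f' x) (at x)"
      "\<And>x. (f' has_vector_derivative f'' x) (at x)" "continuous_on UNIV f''"
    using assms(1) unfolding C2_def by blast
  obtain g' g'' where g: "\<And>x. (g has_vector_derivative g' x) (at x)"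
      "\<And>x. (g' has_vector_derivative g'' x) (at x)" "continuous_on UNIV g''"
    using assms(2) unfolding C2_def by blast
  note c = continuous_on_of_vector_derivative[OF f(1)] continuous_on_of_vector_derivative[OF f(2)]
    continuous_on_of_vector_derivative[OF g(1)] continuous_on_of_vector_derivative[OF g(2)]
  have chain: "((\<lambda>x. h (f x)) has_vector_derivative f' x * h' (f x)) (at x)"
    if "\<And>x. (h has_vector_derivative h' x) (at x)" for h h' :: "real \<Rightarrow> real" and x
    using vector_diff_chain_at[OF f(1) that, of x] by (simp add: o_def)
  have cc: "continuous_on UNIV (\<lambda>x. h (f x))" if "continuous_on UNIV h" for h :: "real \<Rightarrow> real"
    using continuous_on_compose2[OF that c(1)] by auto
  show ?thesis
    by (rule C2_I[where f' = "\<lambda>x. f' x * g' (f x)" and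
          f'' = "\<lambda>x. f' x * (f' x * g'' (f x)) + f'' x * g' (f x)"])
       (intro has_vector_derivative_mult chain continuous_intros cc f g c)+
qed

lemma C2_shift:
  fixes g :: "real \<Rightarrow> 'a::real_normed_vector"
  assumes "C2 g"
  shows "C2 (\<lambda>x. g (u + x))"
proof -
  obtain g' g'' where g: "\<And>x. (g has_vector_derivative g' x) (at x)"
      "\<And>x. (g' has_vector_derivative g'' x) (at x)" "continuous_on UNIV g''"
    using assms unfolding C2_def by blast
  have chain: "((\<lambda>x. h (u + x)) has_vector_derivative h' (u + x)) (at x)"
    if "\<And>x. (h has_vector_derivative h' x) (at x)" for h h' :: "real \<Rightarrow> 'a" and x
  proof -
    have "((\<lambda>x. u + x) has_vector_derivative 1) (at x)"
      by (auto intro!: derivative_eq_intros)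
    from vector_diff_chain_at[OF this that[of "u + x"]] show ?thesis by (simp add: o_def)
  qed
  show ?thesis
    by (rule C2_I[OF chain[OF g(1)] chain[OF g(2)]])
       (rule continuous_on_compose2[OF g(3)], auto intro!: continuous_intros)
qed

lemma C2_of_real:
  assumes "C2 f"
  shows "C2 (\<lambda>x. complex_of_real (f x))"
proof -
  obtain f' f'' where f: "\<And>x. (f has_vector_derivative f' x) (at x)"
      "\<And>x. (f' has_vector_derivative f'' x) (at x)" "continuous_on UNIV f''"
    using assms unfolding C2_def by blast
  show ?thesis
    by (rule C2_I[where f' = "\<lambda>x. of_real (f' x)" and f'' = "\<lambda>x. of_real (f'' x)"])
       (use f in \<open>auto intro!: has_vector_derivative_of_real continuous_intros
          simp: has_real_derivative_iff_has_vector_derivative\<close>)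
qed

text \<open>
The derivatives vanish off the support as well, and a continuous function is bounded on it.
\<close>

lemma C2_compact_support_decay:
  assumes "C2 f" and supp: "\<And>t. 1/2 \<le> \<bar>t\<bar> \<Longrightarrow> f t = 0"
  shows "C2_decay f"
proof -
  obtain f' f'' where f: "\<And>x. (f has_vector_derivative f' x) (at x)"
      "\<And>x. (f' has_vector_derivative f'' x) (at x)" "continuous_on UNIV f''"
    using assms unfolding C2_def by blast
  note c = continuous_on_of_vector_derivative[OF f(1)] continuous_on_of_vector_derivative[OF f(2)]
  define U where "U = {t::real. 1/2 < \<bar>t\<bar>}"
  have U: "open U" unfolding U_def by (intro open_Collect_less continuous_intros)
  have der0: "g' t = 0" if "\<And>t. t \<in> U \<Longrightarrow> g t = 0" "\<And>x. (g has_vector_derivative g' x) (at x)" "t \<in> U"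
    for g g' :: "real \<Rightarrow> complex" and t
  proof -
    have "((\<lambda>_. 0) has_vector_derivative g' t) (at t)"
      by (rule has_vector_derivative_transform_within_open[OF that(2) U that(3)]) (use that in auto)
    then show ?thesis
      using has_vector_derivative_const vector_derivative_unique_at by blast
  qed
  have z: "f t = 0" "f' t = 0" "f'' t = 0" if "t \<in> U" for t
  proof -
    have 1: "f t = 0" if "t \<in> U" for t using that supp by (auto simp: U_def)
    have 2: "f' t = 0" if "t \<in> U" for t using der0[OF 1 f(1) that] .
    show "f t = 0" "f' t = 0" "f'' t = 0" using 1 2 der0[OF 2 f(2)] that by auto
  qed
  have "\<exists>B. \<forall>t. cmod (g t) \<le> B / (1 + t\<^sup>2)" if "continuous_on UNIV g" "\<And>t. t \<in> U \<Longrightarrow> g t = 0" for g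
  proof -
    have "compact (g ` {-1/2..1/2})"
      using that(1) by (intro compact_continuous_image) (auto intro: continuous_on_subset)
    then obtain B where B: "\<And>t. t \<in> {-1/2..1/2} \<Longrightarrow> cmod (g t) \<le> B"
      using compact_imp_bounded[of "g ` {-1/2..1/2}"] unfolding bounded_iff by blast
    have B0: "0 \<le> B" using order_trans[OF norm_ge_zero B[of 0]] by simp
    have "cmod (g t) \<le> (2 * B) / (1 + t\<^sup>2)" for t
    proof (cases "t \<in> {-1/2..1/2}")
      case True
      then have "t\<^sup>2 \<le> 1" by (simp add: abs_square_le_1 abs_le_iff)
      then have "B * (1 + t\<^sup>2) \<le> B * 2" using B0 by (intro mult_left_mono) auto
      then have "B \<le> (2 * B) / (1 + t\<^sup>2)" by (simp add: pos_le_divide_eq add_pos_nonneg mult.commute)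
      then show ?thesis using B[OF True] by linarith
    next
      case False
      then have "g t = 0" by (intro that(2)) (auto simp: U_def)
      then show ?thesis using B0 by (simp add: add_pos_nonneg)
    qed
    then show ?thesis by blast
  qed
  then obtain B1 B2 B3 where B: "\<And>t. cmod (f t) \<le> B1 / (1 + t\<^sup>2)" "\<And>t. cmod (f' t) \<le> B2 / (1 + t\<^sup>2)"
      "\<And>t. cmod (f'' t) \<le> B3 / (1 + t\<^sup>2)"
    using c f(3) z by metis
  define K where "K = max B1 (max B2 B3)"
  have "B1 / (1 + t\<^sup>2) \<le> K / (1 + t\<^sup>2)" "B2 / (1 + t\<^sup>2) \<le> K / (1 + t\<^sup>2)" "B3 / (1 + t\<^sup>2) \<le> K / (1 + t\<^sup>2)" for t
    by (intro divide_right_mono; simp add: K_def)+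
  then have "cmod (f t) \<le> K / (1 + t\<^sup>2)" "cmod (f' t) \<le> K / (1 + t\<^sup>2)" "cmod (f'' t) \<le> K / (1 + t\<^sup>2)" for t
    using B order_trans by blast+
  then show ?thesis
    unfolding C2_decay_def
    by (intro exI[of _ f'] exI[of _ f''] exI[of _ K] conjI allI f)
qed

lemma pos_part_power_derivative:
  assumes "1 \<le> k"
  shows "((\<lambda>t::real. max 0 t ^ Suc k) has_vector_derivative (of_nat (Suc k) * max 0 t ^ k)) (at t)"
proof -
  consider "t < 0" | "t = 0" | "0 < t" by linarith
  then have "((\<lambda>t::real. max 0 t ^ Suc k) has_real_derivative (of_nat (Suc k) * max 0 t ^ k)) (at t)"
  proof cases
    case 1
    have "((\<lambda>t. 0) has_real_derivative 0) (at t)" by simp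
    then have "((\<lambda>t::real. max 0 t ^ Suc k) has_real_derivative 0) (at t)"
      by (rule has_field_derivative_transform_within_open[where S = "{..<0}"]) (use 1 in auto)
    then show ?thesis using 1 assms by (simp add: power_0_left)
  next
    case 3
    have "((\<lambda>t. t ^ Suc k) has_real_derivative (of_nat (Suc k) * t ^ k)) (at t)"
      using DERIV_pow[of "Suc k" t] by simp
    then have "((\<lambda>t::real. max 0 t ^ Suc k) has_real_derivative (of_nat (Suc k) * t ^ k)) (at t)"
      by (rule has_field_derivative_transform_within_open[where S = "{0<..}"]) (use 3 in auto)
    then show ?thesis using 3 by simp
  next
    case 2
    have "((\<lambda>h::real. max 0 h ^ Suc k / h) \<longlongrightarrow> 0) (at 0)"
    proof (rule Lim_null_comparison)
      show "\<forall>\<^sub>F h in at 0. norm (max 0 h ^ Suc k / h) \<le> \<bar>h :: real\<bar> ^ k"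
        by (rule always_eventually) (auto simp: max_def)
      have "((\<lambda>h::real. \<bar>h\<bar> ^ k) \<longlongrightarrow> \<bar>0\<bar> ^ k) (at 0)" by (intro tendsto_intros)
      then show "((\<lambda>h::real. \<bar>h\<bar> ^ k) \<longlongrightarrow> 0) (at 0)"
        by (rule tendsto_eq_rhs) (use assms in \<open>simp add: power_0_left\<close>)
    qed
    then show ?thesis using 2 assms by (simp add: DERIV_def power_0_left)
  qed
  then show ?thesis by (simp add: has_real_derivative_iff_has_vector_derivative)
qed

text \<open>
The positive part of \<open>t\<close>, cubed, is twice differentiable and vanishes on a half-line: the building
block of the cutoff below.
\<close>

lemma C2_pos_part_cube: "C2 (\<lambda>t::real. max 0 t ^ 3)"
proof (rule C2_I)
  show "((\<lambda>t::real. max 0 t ^ 3) has_vector_derivative 3 * max 0 t ^ 2) (at t)" for t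
    using pos_part_power_derivative[of 2 t] by (simp add: numeral_3_eq_3 numeral_2_eq_2)
  have "((\<lambda>t::real. max 0 t ^ 2) has_vector_derivative 2 * max 0 t ^ 1) (at t)" for t
    using pos_part_power_derivative[of 1 t] by (simp add: numeral_2_eq_2)
  from has_vector_derivative_mult_right[OF this, of 3]
  show "((\<lambda>t::real. 3 * max 0 t ^ 2) has_vector_derivative 3 * (2 * max 0 t)) (at t)" for t
    by simp
qed (intro continuous_intros)

text \<open>
The function \<open>s(t) = 1 - max 0 (1 - max 0 t^3)^3\<close> rises from \<open>0\<close> to \<open>1\<close> on \<open>[0, 1]\<close> and is constant outside.
The cutoff is the product of a rising and a falling rescaled copy, each with its transition in a
margin of width \<open>\<delta>\<close>.
\<close>

lemma smooth_cutoff: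
  assumes "0 < \<delta>"
  obtains \<kappa> :: "real \<Rightarrow> real" where "C2 \<kappa>" "\<And>t. 0 \<le> \<kappa> t" "\<And>t. \<kappa> t \<le> 1"
    "\<And>t. \<bar>t\<bar> \<le> 1/2 - \<delta> \<Longrightarrow> \<kappa> t = 1" "\<And>t. 1/2 \<le> \<bar>t\<bar> \<Longrightarrow> \<kappa> t = 0"
proof -
  define m where "m = (\<lambda>t::real. max 0 t ^ 3)"
  define s where "s = (\<lambda>t. 1 + (-1) * m (1 + (-1) * m t))"
  have m: "C2 m" unfolding m_def by (rule C2_pos_part_cube)
  have m0: "0 \<le> m t" and m_neg: "t \<le> 0 \<Longrightarrow> m t = 0" and m1: "1 \<le> t \<Longrightarrow> 1 \<le> m t"
    and m_le1: "t \<le> 1 \<Longrightarrow> m t \<le> 1" for t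
    unfolding m_def by (auto simp: max_def intro: power_le_one)
  have s: "C2 s" unfolding s_def by (intro C2_compose[OF _ C2_affine] C2_compose[OF _ m] m)
  have s01: "0 \<le> s t" "s t \<le> 1" for t
    using m0[of t] m0[of "1 - m t"] m_le1[of "1 - m t"] by (auto simp: s_def)
  have s_neg: "s t = 0" if "t \<le> 0" for t
    using m_neg[OF that] by (simp add: s_def m_def)
  have s_1: "s t = 1" if "1 \<le> t" for t
    using m1[OF that] m_neg[of "1 - m t"] by (simp add: s_def)
  define \<kappa> where "\<kappa> = (\<lambda>t. s (1 / (2 * \<delta>) + (- 1 / \<delta>) * t) * s (1 / (2 * \<delta>) + (1 / \<delta>) * t))"
  show ?thesis
  proof
    show "C2 \<kappa>" unfolding \<kappa>_def by (intro C2_mult C2_compose[OF C2_affine s])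
    show "0 \<le> \<kappa> t" "\<kappa> t \<le> 1" for t
      unfolding \<kappa>_def using s01 by (auto intro: mult_le_one)
    show "\<kappa> t = 1" if "\<bar>t\<bar> \<le> 1/2 - \<delta>" for t
      unfolding \<kappa>_def using that assms by (subst s_1, simp add: field_simps abs_le_iff)+ simp
    show "\<kappa> t = 0" if "1/2 \<le> \<bar>t\<bar>" for t
      unfolding \<kappa>_def
    proof (cases "0 \<le> t")
      case True
      then have "1 / (2 * \<delta>) + (- 1 / \<delta>) * t \<le> 0" using that assms by (simp add: field_simps)
      then show "s (1 / (2 * \<delta>) + (- 1 / \<delta>) * t) * s (1 / (2 * \<delta>) + (1 / \<delta>) * t) = 0" by (simp add: s_neg)
    next
      case False
      then have "1 / (2 * \<delta>) + (1 / \<delta>) * t \<le> 0" using that assms by (simp add: field_simps)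
      then show "s (1 / (2 * \<delta>) + (- 1 / \<delta>) * t) * s (1 / (2 * \<delta>) + (1 / \<delta>) * t) = 0" by (simp add: s_neg)
    qed
  qed
qed

text \<open>
A shift of \<open>\<xi>\<close> by an integer permutes the terms of the sum, so \<open>\<xi>\<close> may be taken in \<open>[0, 1)\<close>, where
quadratic decay gives a summable majorant that is independent of \<open>\<xi>\<close>.
\<close>

lemma fourier_lattice_sum_bound:
  assumes "C2_decay h"
  obtains B where "0 \<le> B" "\<And>\<xi>. (\<lambda>n::int. cmod (fourier h (\<xi> + of_int n))) summable_on UNIV"
    "\<And>\<xi>. (\<Sum>\<^sub>\<infinity>n::int. cmod (fourier h (\<xi> + of_int n))) \<le> B"
proof -
  obtain K where K: "0 \<le> K" "\<And>\<xi>. cmod (fourier h \<xi>) \<le> K / (1 + \<xi>\<^sup>2)"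
    using fourier_decay[OF assms] by blast
  define g where "g = (\<lambda>n::int. 3 * K / (1 + (of_int n :: real)\<^sup>2))"
  have g0: "0 \<le> g n" for n using K by (simp add: g_def add_nonneg_nonneg)
  have "(\<lambda>n. cmod (complex_of_real (g n))) summable_on UNIV"
    by (rule summable_on_int_decay[of _ "3 * K"]) (use K(1) in \<open>simp add: g_def del: of_real_divide of_real_mult of_real_add of_real_power\<close>)
  then have gs: "g summable_on UNIV" using g0 by simp
  have le: "cmod (fourier h (\<theta> + of_int n)) \<le> g n" if "0 \<le> \<theta>" "\<theta> \<le> 1" for \<theta> and n :: int
  proof -
    have "(1 + (of_int n :: real)\<^sup>2) \<le> 3 * (1 + (\<theta> + of_int n)\<^sup>2)"
    proof -
      have "\<theta>\<^sup>2 \<le> 1" using that by (simp add: power_le_one)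
      moreover have "0 \<le> (\<theta> + (\<theta> + of_int n))\<^sup>2" by simp
      moreover have "0 \<le> (\<theta> + of_int n)\<^sup>2" by simp
      ultimately show ?thesis by (simp add: power2_eq_square algebra_simps)
    qed
    then have "K * (1 + (of_int n :: real)\<^sup>2) \<le> K * (3 * (1 + (\<theta> + of_int n)\<^sup>2))"
      using K(1) by (rule mult_left_mono)
    then have "K / (1 + (\<theta> + of_int n)\<^sup>2) \<le> g n"
      unfolding g_def by (simp add: divide_le_eq pos_le_divide_eq add_pos_nonneg field_simps)
    then show ?thesis using K(2)[of "\<theta> + of_int n"] by linarith
  qed
  have main: "(\<lambda>n::int. cmod (fourier h (\<xi> + of_int n))) summable_on UNIV \<and>
    (\<Sum>\<^sub>\<infinity>n::int. cmod (fourier h (\<xi> + of_int n))) \<le> infsum g UNIV" for \<xi>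
  proof -
    define r where "r = (\<lambda>n::int. cmod (fourier h (frac \<xi> + of_int n)))"
    have r: "r summable_on UNIV"
      by (rule summable_on_comparison_test[OF gs]) (use le in \<open>auto simp: r_def frac_lt_1 less_imp_le\<close>)
    have rle: "infsum r UNIV \<le> infsum g UNIV"
      by (rule infsum_mono[OF r gs]) (use le in \<open>auto simp: r_def frac_lt_1 less_imp_le\<close>)
    have bij: "bij_betw (\<lambda>n::int. n + \<lfloor>\<xi>\<rfloor>) UNIV UNIV"
      by (rule bij_betwI[where g = "\<lambda>n. n - \<lfloor>\<xi>\<rfloor>"]) auto
    have eq: "(\<lambda>n::int. cmod (fourier h (\<xi> + of_int n))) = (\<lambda>n. r (n + \<lfloor>\<xi>\<rfloor>))"
      by (auto simp: r_def frac_def add_ac)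
    show ?thesis
      unfolding eq using summable_on_reindex_bij_betw[OF bij, of r] infsum_reindex_bij_betw[OF bij, of r] r rle
      by simp
  qed
  show ?thesis
    by (rule that[of "infsum g UNIV"]) (use main g0 in \<open>auto intro: infsum_nonneg\<close>)
qed

lemma countable_exhaustion:
  obtains K :: "nat \<Rightarrow> 'i::countable set"
  where "\<And>n. finite (K n)" "\<And>z. \<forall>\<^sub>F n in sequentially. z \<in> K n"
proof
  show "finite {i::'i. to_nat i < n}" for n
    using finite_vimageI[of "{..<n}" "to_nat :: 'i \<Rightarrow> nat"]
    by (simp add: vimage_def lessThan_def)
  show "\<forall>\<^sub>F n in sequentially. z \<in> {i::'i. to_nat i < n}" for z
    using eventually_gt_at_top[of "to_nat z"] by eventually_elim simp
qed

lemma borel_measurable_infsum: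
  fixes F :: "'i::countable \<Rightarrow> 'a \<Rightarrow> complex"
  assumes meas: "\<And>i. F i \<in> borel_measurable M" and sm: "\<And>x. (\<lambda>i. F i x) summable_on UNIV"
  shows "(\<lambda>x. \<Sum>\<^sub>\<infinity>i. F i x) \<in> borel_measurable M"
proof -
  obtain K :: "nat \<Rightarrow> 'i set" where K: "\<And>n. finite (K n)" "\<And>z. \<forall>\<^sub>F n in sequentially. z \<in> K n"
    using countable_exhaustion by blast
  show ?thesis
    by (rule borel_measurable_LIMSEQ_metric[where f = "\<lambda>n x. \<Sum>i\<in>K n. F i x"])
       (use meas has_sum_tendsto_exhaustion[OF has_sum_infsum[OF sm] K] in auto)
qed

text \<open>
Dominated convergence, stated for unordered sums over a countable index type.
\<close>

lemma has_sum_integral_dominated: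
  fixes F :: "'i::countable \<Rightarrow> 'a \<Rightarrow> complex"
  assumes meas: "\<And>i. F i \<in> borel_measurable M" and G: "integrable M G"
    and sm: "\<And>x. (\<lambda>i. cmod (F i x)) summable_on UNIV" and le: "\<And>x. (\<Sum>\<^sub>\<infinity>i. cmod (F i x)) \<le> G x"
  shows "((\<lambda>i. LINT x|M. F i x) has_sum (LINT x|M. (\<Sum>\<^sub>\<infinity>i. F i x))) UNIV"
proof -
  obtain K :: "nat \<Rightarrow> 'i set" where Kfin: "\<And>n. finite (K n)"
    and Kev: "\<And>z. \<forall>\<^sub>F n in sequentially. z \<in> K n"
    using countable_exhaustion by blast
  have fin_le: "(\<Sum>i\<in>A. cmod (F i x)) \<le> G x" if "finite A" for A x
    using order_trans[OF finite_sum_le_infsum[OF sm that] le] by simp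
  have G0: "0 \<le> G x" for x using fin_le[of "{}" x] by simp
  have Fi: "integrable M (F i)" for i
    by (rule Bochner_Integration.integrable_bound[OF G meas])
       (use fin_le[of "{i}"] G0 in auto)
  have abs: "(\<lambda>i. cmod (LINT x|M. F i x)) summable_on UNIV"
  proof (rule nonneg_bounded_partial_sums_imp_summable_on[where C = "LINT x|M. G x"])
    show "\<forall>\<^sub>F A in finite_subsets_at_top UNIV. (\<Sum>i\<in>A. cmod (LINT x|M. F i x)) \<le> (LINT x|M. G x)"
    proof (rule eventually_finite_subsets_at_top_weakI)
      fix A :: "'i set" assume A: "finite A"
      have "(\<Sum>i\<in>A. cmod (LINT x|M. F i x)) \<le> (\<Sum>i\<in>A. LINT x|M. cmod (F i x))"
        by (intro sum_mono integral_norm_bound)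
      also have "\<dots> = (LINT x|M. (\<Sum>i\<in>A. cmod (F i x)))"
        using Fi by (intro Bochner_Integration.integral_sum[symmetric]) auto
      also have "\<dots> \<le> (LINT x|M. G x)"
        using Fi G fin_le[OF A] by (intro integral_mono) auto
      finally show "(\<Sum>i\<in>A. cmod (LINT x|M. F i x)) \<le> (LINT x|M. G x)" .
    qed
  qed auto
  have conv: "(\<lambda>n. \<Sum>i\<in>K n. F i x) \<longlonglongrightarrow> (\<Sum>\<^sub>\<infinity>i. F i x)" for x
    by (rule has_sum_tendsto_exhaustion[OF has_sum_infsum[OF abs_summable_summable[OF sm]] Kfin Kev])
  have meas2: "(\<lambda>x. \<Sum>\<^sub>\<infinity>i. F i x) \<in> borel_measurable M"
    by (rule borel_measurable_infsum[OF meas abs_summable_summable[OF sm]])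
  have l1: "(\<lambda>n. LINT x|M. (\<Sum>i\<in>K n. F i x)) \<longlonglongrightarrow> (LINT x|M. (\<Sum>\<^sub>\<infinity>i. F i x))"
  proof (rule integral_dominated_convergence[where w = G])
    show "AE x in M. norm (\<Sum>i\<in>K n. F i x) \<le> G x" for n
      using order_trans[OF norm_sum fin_le[OF Kfin]] by auto
  qed (use meas meas2 G conv in auto)
  have "(\<lambda>n. LINT x|M. (\<Sum>i\<in>K n. F i x)) = (\<lambda>n. \<Sum>i\<in>K n. LINT x|M. F i x)"
    using Fi by (auto intro: Bochner_Integration.integral_sum)
  with l1 have l1': "(\<lambda>n. \<Sum>i\<in>K n. LINT x|M. F i x) \<longlonglongrightarrow> (LINT x|M. (\<Sum>\<^sub>\<infinity>i. F i x))" by simp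
  have hs: "((\<lambda>i. LINT x|M. F i x) has_sum (\<Sum>\<^sub>\<infinity>i. LINT x|M. F i x)) UNIV"
    by (rule has_sum_infsum[OF abs_summable_summable[OF abs]])
  from LIMSEQ_unique[OF l1' has_sum_tendsto_exhaustion[OF hs Kfin Kev]] hs
  show "((\<lambda>i. LINT x|M. F i x) has_sum (LINT x|M. (\<Sum>\<^sub>\<infinity>i. F i x))) UNIV" by simp
qed


section \<open>Lebesgue quasi-norms\<close>

lemma ennreal_pow_le_iff:
  assumes "0 < a" "0 \<le> B"
  shows "ennreal_pow t a \<le> ennreal B \<longleftrightarrow> t \<le> ennreal (B powr (1 / a))"
proof (cases t)
  case (real r)
  have "r powr a \<le> B \<longleftrightarrow> r \<le> B powr (1 / a)"
  proof
    assume "r powr a \<le> B"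
    then have "(r powr a) powr (1 / a) \<le> B powr (1 / a)"
      using assms by (intro powr_mono2) auto
    then show "r \<le> B powr (1 / a)" using assms real by (simp add: powr_powr)
  next
    assume "r \<le> B powr (1 / a)"
    then have "r powr a \<le> (B powr (1 / a)) powr a"
      using assms real by (intro powr_mono2) auto
    then show "r powr a \<le> B" using assms by (simp add: powr_powr)
  qed
  then show ?thesis using real assms by (simp add: ennreal_pow_def ennreal_le_iff)
qed (simp add: ennreal_pow_def top_unique)

lemma Lp_norm_le_iff:
  assumes "p \<noteq> \<infinity>" "0 < enn2real p" "0 \<le> B"
  shows "Lp_norm p M f \<le> ennreal B \<longleftrightarrow>
    (\<integral>\<^sup>+ x. ennreal (cmod (f x) powr enn2real p) \<partial>M) \<le> ennreal (B powr enn2real p)"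
  using assms by (simp add: Lp_norm_def ennreal_pow_le_iff)

lemma Lp_norm_infinity_le_iff:
  assumes "f \<in> borel_measurable M" "0 \<le> B"
  shows "Lp_norm \<infinity> M f \<le> ennreal B \<longleftrightarrow> (AE x in M. cmod (f x) \<le> B)"
proof
  assume "Lp_norm \<infinity> M f \<le> ennreal B"
  then have *: "esssup M (\<lambda>x. ennreal (cmod (f x))) \<le> ennreal B" by (simp add: Lp_norm_def)
  have "AE x in M. ennreal (cmod (f x)) \<le> esssup M (\<lambda>x. ennreal (cmod (f x)))"
    by (rule esssup_AE)
  then show "AE x in M. cmod (f x) \<le> B"
  proof eventually_elim
    case (elim x)
    then show ?case using order_trans[OF elim *] assms(2) by (simp add: ennreal_le_iff)
  qed
next
  have [measurable]: "f \<in> borel_measurable M" by fact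
  assume "AE x in M. cmod (f x) \<le> B"
  then have "AE x in M. ennreal (cmod (f x)) \<le> ennreal B"
    by eventually_elim (simp add: ennreal_leI)
  then show "Lp_norm \<infinity> M f \<le> ennreal B"
    by (auto simp: Lp_norm_def intro!: esssup_I)
qed

lemma Lp_norm_cong_cmod:
  assumes "\<And>x. cmod (f x) = cmod (g x)"
  shows "Lp_norm p M f = Lp_norm p M g"
  unfolding Lp_norm_def assms ..

text \<open>
For two summands with positive sum, divide by the \<open>q\<close>-th power of the sum: the two shares lie in \<open>[0, 1]\<close>,
do not exceed their \<open>q\<close>-th powers, and add up to \<open>1\<close>.
\<close>

lemma powr_sum_le_sum_powr:
  fixes y :: "'i \<Rightarrow> real"
  assumes "finite K" "\<And>k. k \<in> K \<Longrightarrow> 0 \<le> y k" "0 < q" "q \<le> 1"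
  shows "(\<Sum>k\<in>K. y k) powr q \<le> (\<Sum>k\<in>K. y k powr q)"
proof -
  have add: "(a + b) powr q \<le> a powr q + b powr q" if "0 \<le> a" "0 \<le> b" for a b :: real
  proof (cases "a + b = 0")
    case True
    then show ?thesis using that assms by (simp add: add_nonneg_eq_0_iff)
  next
    case False
    then have s: "0 < a + b" using that by simp
    have frac: "t \<le> t powr q" if "0 \<le> t" "t \<le> 1" for t :: real
      using powr_mono'[of q 1 t] that assms by simp
    have "1 = a / (a + b) + b / (a + b)" using s by (simp flip: add_divide_distrib)
    also have "\<dots> \<le> (a / (a + b)) powr q + (b / (a + b)) powr q"
      using that s by (intro add_mono frac) auto
    also have "\<dots> = (a powr q + b powr q) / (a + b) powr q"
      using that s by (simp add: powr_divide add_divide_distrib)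
    finally show ?thesis using s by (simp add: pos_le_divide_eq)
  qed
  show ?thesis using assms(1,2)
  proof (induction K rule: finite_induct)
    case (insert k K)
    then show ?case using add[of "y k" "sum y K"] by (fastforce intro: sum_nonneg)
  qed simp
qed

text \<open>
Jensen's inequality for \<open>t^q\<close> without normalising the weights. With \<open>m\<close> the weighted mean, sum Young's
inequality \<open>q t m^(q - 1) \<le> t^q + (q - 1) m^q\<close> over \<open>t = y k\<close> with the weights \<open>w k\<close>.
\<close>

lemma powr_weighted_sum_le:
  fixes w y :: "'i \<Rightarrow> real"
  assumes "finite K" and w: "\<And>k. k \<in> K \<Longrightarrow> 0 \<le> w k" and y: "\<And>k. k \<in> K \<Longrightarrow> 0 \<le> y k" and q: "1 \<le> q"
  shows "(\<Sum>k\<in>K. w k * y k) powr q \<le> (\<Sum>k\<in>K. w k) powr (q - 1) * (\<Sum>k\<in>K. w k * y k powr q)"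
proof (cases "q = 1 \<or> (\<Sum>k\<in>K. w k * y k) = 0")
  case True
  then show ?thesis
  proof
    assume q1: "q = 1"
    show ?thesis
    proof (cases "(\<Sum>k\<in>K. w k) = 0")
      case True
      then have "\<forall>k\<in>K. w k = 0" using assms by (simp add: sum_nonneg_eq_0_iff)
      then show ?thesis by simp
    next
      case False
      have "0 \<le> (\<Sum>k\<in>K. w k * y k)" using w y by (intro sum_nonneg mult_nonneg_nonneg)
      moreover have "(\<Sum>k\<in>K. w k * y k powr q) = (\<Sum>k\<in>K. w k * y k)"
        using q1 y by (intro sum.cong) auto
      ultimately show ?thesis using q1 False by simp
    qed
  qed (use w in \<open>auto intro!: mult_nonneg_nonneg sum_nonneg\<close>)
next
  case False
  define A where "A = (\<Sum>k\<in>K. w k)"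
  define m where "m = (\<Sum>k\<in>K. w k * y k) / A"
  have q1: "1 < q" using q False by auto
  have "A \<noteq> 0"
  proof
    assume "A = 0"
    then have "\<forall>k\<in>K. w k = 0" using assms by (simp add: A_def sum_nonneg_eq_0_iff)
    then show False using False by simp
  qed
  moreover have "0 \<le> A" unfolding A_def using w by (rule sum_nonneg)
  ultimately have A: "0 < A" by simp
  have "0 \<le> (\<Sum>k\<in>K. w k * y k)" using w y by (intro sum_nonneg mult_nonneg_nonneg)
  then have m: "0 < m" using False A by (simp add: m_def less_le)
  have mA: "(\<Sum>k\<in>K. w k * y k) = A * m" using A by (simp add: m_def)
  have young: "q * (t * m powr (q - 1)) \<le> t powr q + (q - 1) * m powr q" if "0 \<le> t" for t
  proof -
    have "t * m powr (q - 1) \<le> t powr q / q + (m powr (q - 1)) powr (q / (q - 1)) / (q / (q - 1))"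
      by (rule Youngs_inequality) (use q1 that in \<open>auto simp: field_simps\<close>)
    also have "(m powr (q - 1)) powr (q / (q - 1)) = m powr q"
      using q1 by (simp add: powr_powr)
    finally have "q * (t * m powr (q - 1)) \<le> q * (t powr q / q + m powr q / (q / (q - 1)))"
      using q1 by (intro mult_left_mono) auto
    also have "\<dots> = t powr q + (q - 1) * m powr q" using q1 by (simp add: field_simps)
    finally show ?thesis .
  qed
  have "q * (A * m powr q) = q * ((\<Sum>k\<in>K. w k * y k) * m powr (q - 1))"
    unfolding mA using m by (simp add: powr_diff)
  also have "\<dots> = (\<Sum>k\<in>K. w k * (q * (y k * m powr (q - 1))))"
    by (simp add: sum_distrib_left sum_distrib_right mult_ac)
  also have "\<dots> \<le> (\<Sum>k\<in>K. w k * (y k powr q + (q - 1) * m powr q))"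
    using w y young by (intro sum_mono mult_left_mono) auto
  also have "\<dots> = (\<Sum>k\<in>K. w k * y k powr q) + A * ((q - 1) * m powr q)"
    by (simp add: distrib_left sum.distrib A_def flip: sum_distrib_right)
  finally have *: "A * m powr q \<le> (\<Sum>k\<in>K. w k * y k powr q)"
    by (simp add: algebra_simps)
  have "(\<Sum>k\<in>K. w k * y k) powr q = A powr (q - 1) * (A * m powr q)"
    unfolding mA using A m by (simp add: powr_mult powr_diff)
  also have "\<dots> \<le> A powr (q - 1) * (\<Sum>k\<in>K. w k * y k powr q)"
    using * by (intro mult_left_mono) auto
  finally show ?thesis by (simp add: A_def)
qed

lemma nn_integral_weighted_sum_le:
  fixes g :: "'i \<Rightarrow> 'a \<Rightarrow> real"
  assumes "finite K" "\<And>k. k \<in> K \<Longrightarrow> g k \<in> borel_measurable M" "\<And>k x. 0 \<le> g k x" "\<And>k. 0 \<le> w k"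
    "\<And>k. k \<in> K \<Longrightarrow> (\<integral>\<^sup>+ x. ennreal (g k x) \<partial>M) \<le> ennreal b" "0 \<le> b"
  shows "(\<integral>\<^sup>+ x. ennreal (\<Sum>k\<in>K. w k * g k x) \<partial>M) \<le> ennreal ((\<Sum>k\<in>K. w k) * b)"
proof -
  have "(\<integral>\<^sup>+ x. ennreal (\<Sum>k\<in>K. w k * g k x) \<partial>M) = (\<integral>\<^sup>+ x. (\<Sum>k\<in>K. ennreal (w k) * ennreal (g k x)) \<partial>M)"
    using assms by (simp add: sum_ennreal[symmetric] ennreal_mult)
  also have "\<dots> = (\<Sum>k\<in>K. ennreal (w k) * (\<integral>\<^sup>+ x. ennreal (g k x) \<partial>M))"
    using assms by (simp add: nn_integral_sum nn_integral_cmult)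
  also have "\<dots> \<le> (\<Sum>k\<in>K. ennreal (w k) * ennreal b)"
    using assms by (intro sum_mono mult_left_mono) auto
  also have "\<dots> = ennreal ((\<Sum>k\<in>K. w k) * b)"
    using assms by (simp add: sum_distrib_right ennreal_mult[symmetric])
  finally show ?thesis .
qed

text \<open>
The \<open>p\<close>-triangle inequality for a family with a common bound. If \<open>p3 < 1\<close> it is the subadditivity of
\<open>t^p3\<close>. If \<open>1 \<le> p3 < \<infinity>\<close>, the common bound allows Jensen's inequality with weights \<open>\<bar>a k\<bar>\<close> to take the place of
Minkowski's inequality.
\<close>

lemma Lp_norm_sum_le:
  assumes p3: "0 < p3" and K: "finite K" and meas: "\<And>k. k \<in> K \<Longrightarrow> H k \<in> borel_measurable M"
    and bnd: "\<And>k. k \<in> K \<Longrightarrow> Lp_norm p3 M (H k) \<le> ennreal B" and B: "0 \<le> B"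
    and p: "p = enn2real (min 1 p3)"
  shows "Lp_norm p3 M (\<lambda>x. \<Sum>k\<in>K. a k * H k x) \<le> ennreal ((\<Sum>k\<in>K. cmod (a k) powr p) powr (1 / p) * B)"
proof -
  have sum_meas: "(\<lambda>x. \<Sum>k\<in>K. a k * H k x) \<in> borel_measurable M"
    using meas by auto
  have tri: "cmod (\<Sum>k\<in>K. a k * H k x) \<le> (\<Sum>k\<in>K. cmod (a k) * cmod (H k x))" for x
    by (rule order_trans[OF norm_sum]) (simp add: norm_mult)
  define q where "q = enn2real p3"
  consider "p3 = \<infinity>" | "p3 \<noteq> \<infinity>" "1 \<le> p3" | "p3 < 1" by fastforce
  then show ?thesis
  proof cases
    case 1
    then have p1: "p = 1" using p by (simp add: min_def)
    have "AE x in M. \<forall>k\<in>K. cmod (H k x) \<le> B"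
      using K bnd meas B 1 by (intro AE_finite_allI) (auto simp: Lp_norm_infinity_le_iff[symmetric])
    then have "AE x in M. cmod (\<Sum>k\<in>K. a k * H k x) \<le> (\<Sum>k\<in>K. cmod (a k)) * B"
    proof eventually_elim
      case (elim x)
      have "cmod (\<Sum>k\<in>K. a k * H k x) \<le> (\<Sum>k\<in>K. cmod (a k) * cmod (H k x))" by (rule tri)
      also have "\<dots> \<le> (\<Sum>k\<in>K. cmod (a k) * B)" using elim by (intro sum_mono mult_left_mono) auto
      finally show ?case by (simp add: sum_distrib_right)
    qed
    then show ?thesis
      using p1 B sum_meas unfolding 1 by (subst Lp_norm_infinity_le_iff) (auto simp: sum_nonneg)
  next
    case 2
    have q: "1 \<le> q" using 2 enn2real_mono[of 1 p3] by (simp add: q_def less_top)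
    have p1: "p = 1" using p 2 by (simp add: min_def)
    define A where "A = (\<Sum>k\<in>K. cmod (a k))"
    have A0: "0 \<le> A" by (simp add: A_def sum_nonneg)
    have "(\<integral>\<^sup>+ x. ennreal (cmod (\<Sum>k\<in>K. a k * H k x) powr q) \<partial>M)
        \<le> (\<integral>\<^sup>+ x. ennreal (\<Sum>k\<in>K. (A powr (q - 1) * cmod (a k)) * cmod (H k x) powr q) \<partial>M)"
    proof (intro nn_integral_mono ennreal_leI)
      fix x
      have "cmod (\<Sum>k\<in>K. a k * H k x) powr q \<le> (\<Sum>k\<in>K. cmod (a k) * cmod (H k x)) powr q"
        using q tri by (intro powr_mono2) auto
      also have "\<dots> \<le> A powr (q - 1) * (\<Sum>k\<in>K. cmod (a k) * cmod (H k x) powr q)"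
        unfolding A_def using K q by (intro powr_weighted_sum_le) auto
      finally show "cmod (\<Sum>k\<in>K. a k * H k x) powr q \<le> (\<Sum>k\<in>K. (A powr (q - 1) * cmod (a k)) * cmod (H k x) powr q)"
        by (simp add: sum_distrib_left mult_ac)
    qed
    also have "\<dots> \<le> ennreal ((\<Sum>k\<in>K. A powr (q - 1) * cmod (a k)) * B powr q)"
      using K meas bnd B 2 q by (intro nn_integral_weighted_sum_le) (auto simp: q_def Lp_norm_le_iff[symmetric])
    also have "(\<Sum>k\<in>K. A powr (q - 1) * cmod (a k)) * B powr q = (A * B) powr q"
    proof (cases "A = 0")
      case False
      have "(\<Sum>k\<in>K. A powr (q - 1) * cmod (a k)) = A powr (q - 1) * A"
        unfolding sum_distrib_left[symmetric] by (simp only: A_def[symmetric])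
      then show ?thesis using False A0 B q by (simp add: powr_mult powr_diff)
    qed (use q in simp)
    finally show ?thesis
      using 2 q p1 A0 B by (subst Lp_norm_le_iff) (auto simp: q_def A_def)
  next
    case 3
    have "p3 < \<infinity>" using 3 by (auto intro: less_trans)
    then have q: "0 < q" "q \<le> 1" "p3 \<noteq> \<infinity>"
      using 3 p3 enn2real_mono[of p3 1] by (auto simp: q_def enn2real_positive_iff less_top)
    have pq: "p = q" using p 3 by (simp add: min_def q_def)
    define A where "A = (\<Sum>k\<in>K. cmod (a k) powr q)"
    have A0: "0 \<le> A" by (simp add: A_def sum_nonneg)
    have "(\<integral>\<^sup>+ x. ennreal (cmod (\<Sum>k\<in>K. a k * H k x) powr q) \<partial>M)
        \<le> (\<integral>\<^sup>+ x. ennreal (\<Sum>k\<in>K. cmod (a k) powr q * cmod (H k x) powr q) \<partial>M)"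
    proof (intro nn_integral_mono ennreal_leI)
      fix x
      have "cmod (\<Sum>k\<in>K. a k * H k x) powr q \<le> (\<Sum>k\<in>K. cmod (a k) * cmod (H k x)) powr q"
        using q tri by (intro powr_mono2) auto
      also have "\<dots> \<le> (\<Sum>k\<in>K. (cmod (a k) * cmod (H k x)) powr q)"
        using K q by (intro powr_sum_le_sum_powr) auto
      finally show "cmod (\<Sum>k\<in>K. a k * H k x) powr q \<le> (\<Sum>k\<in>K. cmod (a k) powr q * cmod (H k x) powr q)"
        by (simp add: powr_mult)
    qed
    also have "\<dots> \<le> ennreal (A * B powr q)"
      unfolding A_def
      using K meas bnd B q by (intro nn_integral_weighted_sum_le) (auto simp: q_def Lp_norm_le_iff[symmetric])
    also have "A * B powr q = (A powr (1 / q) * B) powr q"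
      using A0 B q by (simp add: powr_mult powr_powr)
    finally show ?thesis
      using q pq A0 B by (subst Lp_norm_le_iff) (auto simp: q_def A_def)
  qed
qed

section \<open>Trigonometric polynomials and the estimate on the torus\<close>

definition trig :: "int set \<Rightarrow> (int \<Rightarrow> complex) \<Rightarrow> real \<Rightarrow> complex" where
  "trig A c x = (\<Sum>n\<in>A. c n * echar (of_int n * x))"

lemma trig_measurable [measurable]: "trig A c \<in> borel_measurable borel"
  unfolding trig_def by measurable

lemma trig_in_trig_poly: "finite A \<Longrightarrow> trig A c \<in> trig_poly"
  unfolding trig_poly_def trig_def echar_def by (auto simp: fun_eq_iff mult_ac)

lemma sets_J [measurable]: "J \<in> sets borel" by (simp add: J_def)

lemma integral_lebesgue_on_J_echar:
  "(LINT x|lebesgue_on J. echar (of_int n * x)) = (if n = 0 then 1 else 0)"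
proof -
  have "(LINT x|lebesgue_on J. echar (of_int n * x)) = (LINT x|lebesgue. indicator J x *\<^sub>R echar (of_int n * x))"
    by (rule integral_restrict_space) (simp add: J_def)
  also have "\<dots> = (LINT t|lborel. indicator {-1/2..1/2} t *\<^sub>R echar (of_int n * t))"
  proof (rule lebesgue_integral_eq_lborel_AE)
    show "AE x in lborel. indicat_real J x *\<^sub>R echar (of_int n * x) = indicat_real {-1/2..1/2} x *\<^sub>R echar (of_int n * x)"
      using AE_lborel_singleton[of "1/2 :: real"]
      by eventually_elim (auto simp: J_def indicator_def)
  qed measurable
  finally show ?thesis using integral_echar_unit_interval by simp
qed

lemma integrable_lebesgue_on_J_echar: "integrable (lebesgue_on J) (\<lambda>x. echar (a * x))"
proof -
  have "finite_measure (lebesgue_on J)"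
    by (rule finite_measureI) (simp add: J_def emeasure_restrict_space)
  then show ?thesis
    by (rule finite_measure.integrable_const_bound[where B = 1])
       (auto intro!: measurable_restrict_space1 measurable_completion)
qed

lemma fcoeff_trig:
  assumes "finite A"
  shows "fcoeff (trig A c) m = (if m \<in> A then c m else 0)"
proof -
  have "fcoeff (trig A c) m = (LINT x|lebesgue_on J. (\<Sum>n\<in>A. c n * echar (of_int (n - m) * x)))"
    unfolding fcoeff_def trig_def
  proof (intro Bochner_Integration.integral_cong refl)
    fix x
    have "cis (- 2 * pi * real_of_int m * x) = echar (- (of_int m * x))"
      by (simp add: echar_def mult_ac)
    then show "(\<Sum>n\<in>A. c n * echar (of_int n * x)) * cis (- 2 * pi * real_of_int m * x) =
        (\<Sum>n\<in>A. c n * echar (of_int (n - m) * x))"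
      by (simp add: sum_distrib_right mult.assoc left_diff_distrib flip: echar_add)
  qed
  also have "\<dots> = (\<Sum>n\<in>A. c n * (LINT x|lebesgue_on J. echar (of_int (n - m) * x)))"
    using integrable_lebesgue_on_J_echar by (subst Bochner_Integration.integral_sum) auto
  also have "\<dots> = (\<Sum>n\<in>A. if n = m then c n else 0)"
    unfolding integral_lebesgue_on_J_echar by (intro sum.cong) auto
  finally show ?thesis using assms by simp
qed

lemma bilin_T_trig:
  assumes "finite A" "finite B"
  shows "bilin_T \<phi> (trig A c) (trig B d) x =
    (\<Sum>n\<in>A. \<Sum>m\<in>B. c n * d m * \<phi> (n, m) * echar (of_int (n + m) * x))"
proof -
  have "bilin_T \<phi> (trig A c) (trig B d) x =
      (\<Sum>\<^sub>\<infinity>(n, m)\<in>A \<times> B. c n * d m * \<phi> (n, m) * echar (of_int (n + m) * x))"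
    unfolding bilin_T_def
    by (rule infsum_cong_neutral) (use assms in \<open>auto simp: fcoeff_trig echar_def mult_ac split: if_splits\<close>)
  also have "\<dots> = (\<Sum>(n, m)\<in>A \<times> B. c n * d m * \<phi> (n, m) * echar (of_int (n + m) * x))"
    using assms by (intro infsum_finite) auto
  finally show ?thesis by (simp add: sum.cartesian_product)
qed

text \<open>
Shifting the frequencies of a trigonometric polynomial changes it by a unimodular factor, so that all
its norms are preserved.
\<close>

lemma trig_modulate: "trig ((\<lambda>n. n - k) ` A) (\<lambda>n. c (n + k)) x = echar (- (of_int k * x)) * trig A c x"
proof -
  have "echar (of_int (n - k) * x) = echar (- (of_int k * x)) * echar (of_int n * x)" for n
    by (simp add: echar_add[symmetric] algebra_simps)
  then show ?thesis
    unfolding trig_def by (simp add: sum.reindex inj_on_def sum_distrib_left mult_ac del: of_int_diff)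
qed

text \<open>
Tested on the pure frequencies \<open>n\<close> and \<open>m\<close>, the operator multiplies a unimodular function by \<open>\<phi> (n, m)\<close>.
\<close>

lemma bilin_bound_T_imp_bounded:
  assumes "bilin_bound_T p1 p2 p3 \<phi> C" and pos: "0 < p1" "0 < p2" "0 < p3"
  shows "cmod (\<phi> (n, m)) \<le> C"
proof -
  have norm: "Lp_norm p (lebesgue_on J) f = ennreal b" if "0 < p" "\<And>x. cmod (f x) = b"
     for p and f :: "real \<Rightarrow> complex" and b
  proof -
    have b: "0 \<le> b" using that(2)[of 0] norm_ge_zero[of "f 0"] by simp
    have em: "emeasure (lebesgue_on J) (space (lebesgue_on J)) = 1"
      by (simp add: J_def emeasure_restrict_space)
    show ?thesis
    proof (cases "p = \<infinity>")
      case True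
      then show ?thesis using that em by (simp add: Lp_norm_def esssup_const)
    next
      case False
      then have "0 < enn2real p" using that(1) by (simp add: enn2real_positive_iff less_top)
      then show ?thesis using False b that em
        by (simp add: Lp_norm_def ennreal_pow_def powr_powr)
    qed
  qed
  have 1: "cmod (trig {k} (\<lambda>_. 1) x) = 1" for k x by (simp add: trig_def)
  have 2: "cmod (bilin_T \<phi> (trig {n} (\<lambda>_. 1)) (trig {m} (\<lambda>_. 1)) x) = cmod (\<phi> (n, m))" for x
    by (simp add: bilin_T_trig norm_mult)
  have C: "0 \<le> C" using assms(1) by (simp add: bilin_bound_T_def)
  have "Lp_norm p3 (lebesgue_on J) (bilin_T \<phi> (trig {n} (\<lambda>_. 1)) (trig {m} (\<lambda>_. 1)))
      \<le> ennreal C * Lp_norm p1 (lebesgue_on J) (trig {n} (\<lambda>_. 1)) * Lp_norm p2 (lebesgue_on J) (trig {m} (\<lambda>_. 1))"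
    using assms(1) trig_in_trig_poly unfolding bilin_bound_T_def by auto
  then show ?thesis
    using C by (simp add: norm[OF pos(1) 1] norm[OF pos(2) 1] norm[OF pos(3) 2] ennreal_le_iff)
qed

text \<open>
For fixed \<open>(k, l)\<close> the inner sum is, up to the factor \<open>e((k + l) x)\<close>, the torus operator applied to the
modulated polynomials \<open>e(-k x) F(x)\<close> and \<open>e(-l x) G(x)\<close>, whose norms are those of \<open>F\<close> and \<open>G\<close>. The
\<open>p\<close>-triangle inequality adds these pieces with the weights \<open>a(k, l)\<close>.
\<close>

lemma torus_estimate:
  assumes bound: "bilin_bound_T p1 p2 p3 \<phi> C" and p3: "0 < p3" and p: "p = enn2real (min 1 p3)"
    and fin: "finite K" "finite A" "finite B"
    and X: "0 \<le> X" "Lp_norm p1 (lebesgue_on J) (trig A c) \<le> ennreal X"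
    and Y: "0 \<le> Y" "Lp_norm p2 (lebesgue_on J) (trig B d) \<le> ennreal Y"
  shows "Lp_norm p3 (lebesgue_on J) (\<lambda>x. \<Sum>(k, l)\<in>K. a (k, l) *
      (\<Sum>n\<in>A. \<Sum>m\<in>B. c n * d m * \<phi> (n - k, m - l) * echar (of_int (n + m) * x)))
    \<le> ennreal ((\<Sum>z\<in>K. cmod (a z) powr p) powr (1 / p) * (C * X * Y))"
proof -
  have C: "0 \<le> C" using bound by (simp add: bilin_bound_T_def)
  define H where "H = (\<lambda>(k, l) x. \<Sum>n\<in>A. \<Sum>m\<in>B. c n * d m * \<phi> (n - k, m - l) * echar (of_int (n + m) * x))"
  have Hb: "Lp_norm p3 (lebesgue_on J) (H (k, l)) \<le> ennreal (C * X * Y)" for k l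
  proof -
    define A' where "A' = (\<lambda>n. n - k) ` A"
    define B' where "B' = (\<lambda>n. n - l) ` B"
    define F where "F = trig A' (\<lambda>n. c (n + k))"
    define G where "G = trig B' (\<lambda>n. d (n + l))"
    have fin': "finite A'" "finite B'" using fin by (auto simp: A'_def B'_def)
    have "bilin_T \<phi> F G x = echar (- (of_int (k + l) * x)) * H (k, l) x" for x
    proof -
      have "bilin_T \<phi> F G x = (\<Sum>n\<in>A. \<Sum>m\<in>B. c n * d m * \<phi> (n - k, m - l) * echar (of_int ((n - k) + (m - l)) * x))"
        unfolding F_def G_def
        by (subst bilin_T_trig[OF fin']) (simp add: A'_def B'_def sum.reindex inj_on_def)
      also have "\<dots> = echar (- (of_int (k + l) * x)) * H (k, l) x"
      proof -
        have "echar (of_int ((n - k) + (m - l)) * x) = echar (- (of_int (k + l) * x)) * echar (of_int (n + m) * x)" for n m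
          by (simp add: echar_add[symmetric] algebra_simps)
        then show ?thesis by (simp add: H_def sum_distrib_left mult_ac)
      qed
      finally show ?thesis .
    qed
    then have "Lp_norm p3 (lebesgue_on J) (H (k, l)) = Lp_norm p3 (lebesgue_on J) (bilin_T \<phi> F G)"
      by (intro Lp_norm_cong_cmod) (simp add: norm_mult)
    also have "\<dots> \<le> ennreal C * Lp_norm p1 (lebesgue_on J) F * Lp_norm p2 (lebesgue_on J) G"
      using bound fin' unfolding bilin_bound_T_def F_def G_def by (auto intro: trig_in_trig_poly)
    also have "Lp_norm p1 (lebesgue_on J) F = Lp_norm p1 (lebesgue_on J) (trig A c)"
      unfolding F_def A'_def by (intro Lp_norm_cong_cmod) (simp add: trig_modulate norm_mult)
    also have "Lp_norm p2 (lebesgue_on J) G = Lp_norm p2 (lebesgue_on J) (trig B d)"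
      unfolding G_def B'_def by (intro Lp_norm_cong_cmod) (simp add: trig_modulate norm_mult)
    also have "ennreal C * Lp_norm p1 (lebesgue_on J) (trig A c) * Lp_norm p2 (lebesgue_on J) (trig B d)
        \<le> ennreal C * ennreal X * ennreal Y"
      using X Y by (intro mult_mono) auto
    also have "\<dots> = ennreal (C * X * Y)" using C X Y by (simp add: ennreal_mult)
    finally show ?thesis .
  qed
  have meas: "H z \<in> borel_measurable (lebesgue_on J)" for z
  proof -
    have "H z \<in> borel_measurable borel" unfolding H_def split_beta by measurable
    then show ?thesis by (intro measurable_restrict_space1 measurable_completion) simp
  qed
  have "Lp_norm p3 (lebesgue_on J) (\<lambda>x. \<Sum>z\<in>K. a z * H z x)
      \<le> ennreal ((\<Sum>z\<in>K. cmod (a z) powr p) powr (1 / p) * (C * X * Y))"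
    by (rule Lp_norm_sum_le[OF p3 fin(1) meas _ _ p]) (use Hb C X Y in auto)
  then show ?thesis by (simp add: H_def split_beta)
qed


section \<open>The lattice expansion of the kernel transform\<close>

lemma borel_measurable_fst_snd [measurable]:
  "fst \<in> borel_measurable (borel :: (real \<times> real) measure)"
  "snd \<in> borel_measurable (borel :: (real \<times> real) measure)"
  by (intro borel_measurable_continuous_onI continuous_intros)+

lemma has_sum_tensor:
  fixes u :: "'a \<Rightarrow> complex" and v :: "'b \<Rightarrow> complex"
  assumes u: "(\<lambda>i. cmod (u i)) summable_on UNIV" and v: "(\<lambda>j. cmod (v j)) summable_on UNIV"
  shows "(\<lambda>(i, j). cmod (u i * v j)) summable_on UNIV"
    and "(\<Sum>\<^sub>\<infinity>(i, j)\<in>UNIV. cmod (u i * v j)) = (\<Sum>\<^sub>\<infinity>i. cmod (u i)) * (\<Sum>\<^sub>\<infinity>j. cmod (v j))"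
    and "(u has_sum U) UNIV \<Longrightarrow> (v has_sum V) UNIV \<Longrightarrow> ((\<lambda>(i, j). u i * v j) has_sum U * V) UNIV"
proof -
  have "(\<lambda>z. norm (case z of (i, j) \<Rightarrow> u i * v j)) summable_on (UNIV \<times> UNIV)"
    unfolding Infinite_Sum.abs_summable_on_Sigma_iff
    using u v by (auto simp: norm_mult infsum_cmult_right' abs_mult infsum_nonneg summable_on_cmult_left summable_on_cmult_right)
  then show sm: "(\<lambda>(i, j). cmod (u i * v j)) summable_on UNIV"
    by (simp add: case_prod_unfold)
  have prod: "((\<lambda>(i, j). u' i * v' j) has_sum U' * V') UNIV"
    if sm': "(\<lambda>(i, j). u' i * v' j) summable_on UNIV" and U': "(u' has_sum U') UNIV" and V': "(v' has_sum V') UNIV"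
    for u' :: "'a \<Rightarrow> 'c::real_normed_field" and v' :: "'b \<Rightarrow> 'c" and U' V'
  proof -
    obtain S where S: "((\<lambda>(i, j). u' i * v' j) has_sum S) UNIV"
      using sm' unfolding summable_on_def by blast
    have "((\<lambda>i. u' i * V') has_sum S) UNIV"
      by (rule has_sum_SigmaD[where f = "\<lambda>(i, j). u' i * v' j" and A = UNIV and B = "\<lambda>_. UNIV"])
         (use S V' in \<open>auto intro: has_sum_cmult_right\<close>)
    moreover have "((\<lambda>i. u' i * V') has_sum U' * V') UNIV"
      using U' by (rule has_sum_cmult_left)
    ultimately have "S = U' * V'" by (rule has_sum_unique)
    then show ?thesis using S by simp
  qed
  have "((\<lambda>(i, j). cmod (u i) * cmod (v j)) has_sum (\<Sum>\<^sub>\<infinity>i. cmod (u i)) * (\<Sum>\<^sub>\<infinity>j. cmod (v j))) UNIV"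
    using sm u v by (intro prod) (auto simp: norm_mult)
  then show "(\<Sum>\<^sub>\<infinity>(i, j)\<in>UNIV. cmod (u i * v j)) = (\<Sum>\<^sub>\<infinity>i. cmod (u i)) * (\<Sum>\<^sub>\<infinity>j. cmod (v j))"
    by (simp add: norm_mult infsumI)
  show "((\<lambda>(i, j). u i * v j) has_sum U * V) UNIV" if "(u has_sum U) UNIV" "(v has_sum V) UNIV"
  proof (rule prod[OF abs_summable_summable that])
    show "(\<lambda>z. norm (case z of (i, j) \<Rightarrow> u i * v j)) summable_on UNIV"
      using sm by (simp add: case_prod_unfold)
  qed
qed

lemma has_sum_finite_sum:
  fixes f :: "'i \<Rightarrow> 'a \<Rightarrow> real"
  assumes "\<And>i. i \<in> N \<Longrightarrow> (f i has_sum s i) A"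
  shows "((\<lambda>x. \<Sum>i\<in>N. f i x) has_sum (\<Sum>i\<in>N. s i)) A"
proof -
  have "((\<lambda>F. \<Sum>i\<in>N. sum (f i) F) \<longlongrightarrow> (\<Sum>i\<in>N. s i)) (finite_subsets_at_top A)"
    using assms unfolding has_sum_def by (rule tendsto_sum)
  then show ?thesis
    unfolding has_sum_def by (simp add: sum.swap[of _ _ N])
qed

lemma integral_tensor:
  fixes f g :: "real \<Rightarrow> complex"
  assumes "integrable lborel f" "integrable lborel g"
  shows "(LINT z|lborel. f (fst z) * g (snd z)) = (LINT x|lborel. f x) * (LINT y|lborel. g y)"
    and "integrable lborel (\<lambda>z. f (fst z) * g (snd z))"
proof -
  have i: "integrable (lborel \<Otimes>\<^sub>M lborel) (\<lambda>(x, y). f x * g y)"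
    by (rule integrable_tensor[OF assms])
  show "integrable lborel (\<lambda>z. f (fst z) * g (snd z))"
    using i by (simp add: lborel_prod case_prod_unfold)
  have "(LINT z|(lborel \<Otimes>\<^sub>M lborel). (case z of (x, y) \<Rightarrow> f x * g y)) = (LINT x|lborel. LINT y|lborel. f x * g y)"
    using lborel_pair.integral_fst'[OF i] by simp
  then show "(LINT z|lborel. f (fst z) * g (snd z)) = (LINT x|lborel. f x) * (LINT y|lborel. g y)"
    by (simp add: lborel_prod case_prod_unfold)
qed

lemma fourier2_eq_lborel:
  assumes "S \<in> borel_measurable borel"
  shows "fourier2 S (\<xi>, \<eta>) = (LINT z|lborel. S z * echar (- (fst z * \<xi> + snd z * \<eta>)))"
proof -
  have [measurable]: "S \<in> borel_measurable borel" by fact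
  have "fourier2 S (\<xi>, \<eta>) = (LINT z|lebesgue. S z * cis (- 2 * pi * (fst z * \<xi> + snd z * \<eta>)))"
    by (simp add: fourier2_def case_prod_unfold)
  also have "\<dots> = (LINT z|lborel. S z * echar (- (fst z * \<xi> + snd z * \<eta>)))"
    by (rule lebesgue_integral_eq_lborel_AE) (measurable, simp add: echar_def algebra_simps)
  finally show ?thesis .
qed

lemma fourier2_measurable:
  assumes "S \<in> borel_measurable borel"
  shows "fourier2 S \<in> borel_measurable borel"
proof -
  have [measurable]: "S \<in> borel_measurable borel" by fact
  have "fourier2 S = (\<lambda>w. LINT z|lborel. S z * echar (- (fst z * fst w + snd z * snd w)))"
    using fourier2_eq_lborel[OF assms] by (auto simp: fun_eq_iff)
  also have "\<dots> \<in> borel_measurable borel"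
    by measurable
  finally show ?thesis .
qed

text \<open>
Only the values of \<open>U\<close> and \<open>V\<close> on the sides of the support of \<open>S\<close> enter the integral, so both may be expanded
there into arbitrary absolutely convergent exponential sums; each pair of exponentials integrates
against \<open>S\<close> to a value of its Fourier transform.
\<close>

lemma integral_expand_exponentials:
  fixes S :: "real \<times> real \<Rightarrow> complex" and u v :: "int \<Rightarrow> complex"
  assumes S: "integrable lborel S" and supp: "\<And>z. z \<notin> half_J \<times> half_J \<Longrightarrow> S z = 0"
    and u: "(\<lambda>j. cmod (u j)) summable_on UNIV" and v: "(\<lambda>j. cmod (v j)) summable_on UNIV"
    and U: "\<And>s. s \<in> half_J \<Longrightarrow> ((\<lambda>j. u j * echar (\<alpha> j * s)) has_sum U s) UNIV"
    and V: "\<And>t. t \<in> half_J \<Longrightarrow> ((\<lambda>j. v j * echar (\<beta> j * t)) has_sum V t) UNIV"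
  shows "((\<lambda>(j, l). u j * v l * fourier2 S (- \<alpha> j, - \<beta> l)) has_sum
     (LINT z|lborel. S z * (U (fst z) * V (snd z)))) UNIV"
proof -
  have [measurable]: "S \<in> borel_measurable borel" using S by auto
  define F where "F = (\<lambda>(j, l) z. S z * ((u j * echar (\<alpha> j * fst z)) * (v l * echar (\<beta> l * snd z))))"
  define B where "B = (\<Sum>\<^sub>\<infinity>j. cmod (u j)) * (\<Sum>\<^sub>\<infinity>j. cmod (v j))"
  have tens: "(\<lambda>(j, l). cmod (u j * v l)) summable_on UNIV" "(\<Sum>\<^sub>\<infinity>(j, l)\<in>UNIV. cmod (u j * v l)) = B"
    unfolding B_def by (rule has_sum_tensor[OF u v])+
  have nF: "(\<lambda>jl. cmod (F jl z)) = (\<lambda>jl. cmod (S z) * (case jl of (j, l) \<Rightarrow> cmod (u j * v l)))" for z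
    by (auto simp: F_def norm_mult fun_eq_iff)
  have "((\<lambda>jl. LINT z|lborel. F jl z) has_sum (LINT z|lborel. (\<Sum>\<^sub>\<infinity>jl. F jl z))) UNIV"
  proof (rule has_sum_integral_dominated[where G = "\<lambda>z. cmod (S z) * B"])
    show "F jl \<in> borel_measurable lborel" for jl
      unfolding F_def case_prod_unfold by measurable
    show "integrable lborel (\<lambda>z. cmod (S z) * B)" using S by simp
    show "(\<lambda>jl. cmod (F jl z)) summable_on UNIV" for z
      unfolding nF by (intro summable_on_cmult_right tens)
    show "(\<Sum>\<^sub>\<infinity>jl. cmod (F jl z)) \<le> cmod (S z) * B" for z
      unfolding nF infsum_cmult_right' tens(2) by simp
  qed
  moreover have "(\<Sum>\<^sub>\<infinity>jl. F jl z) = S z * (U (fst z) * V (snd z))" for z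
  proof (cases "z \<in> half_J \<times> half_J")
    case True
    then have "((\<lambda>(j, l). (u j * echar (\<alpha> j * fst z)) * (v l * echar (\<beta> l * snd z))) has_sum U (fst z) * V (snd z)) UNIV"
      using u v U[of "fst z"] V[of "snd z"] by (intro has_sum_tensor) (auto simp: norm_mult)
    from has_sum_cmult_right[OF this, of "S z"] show ?thesis
      by (intro infsumI) (simp add: F_def case_prod_unfold)
  next
    case False
    then show ?thesis using supp by (simp add: F_def case_prod_unfold)
  qed
  moreover have "(LINT z|lborel. F jl z) = (case jl of (j, l) \<Rightarrow> u j * v l * fourier2 S (- \<alpha> j, - \<beta> l))" for jl
  proof -
    obtain j l where jl: "jl = (j, l)" by fastforce
    have "(LINT z|lborel. F jl z) = (LINT z|lborel. (u j * v l) * (S z * echar (- (fst z * - \<alpha> j + snd z * - \<beta> l))))"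
    proof (intro Bochner_Integration.integral_cong refl)
      fix z :: "real \<times> real"
      have "echar (- (fst z * - \<alpha> j + snd z * - \<beta> l)) = echar (\<alpha> j * fst z) * echar (\<beta> l * snd z)"
        by (simp add: echar_add[symmetric] algebra_simps)
      then show "F jl z = (u j * v l) * (S z * echar (- (fst z * - \<alpha> j + snd z * - \<beta> l)))"
        by (simp add: F_def jl)
    qed
    then show ?thesis by (simp add: jl fourier2_eq_lborel)
  qed
  ultimately show ?thesis by (simp add: case_prod_unfold)
qed

lemma fourier_mult_echar:
  assumes "f \<in> borel_measurable borel"
  shows "fourier (\<lambda>x. f x * echar (- \<xi> * x)) \<theta> = fourier f (\<xi> + \<theta>)"
proof -
  have [measurable]: "f \<in> borel_measurable borel" by fact
  show ?thesis
    by (simp add: fourier_eq_lborel mult.assoc distrib_right flip: echar_add)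
qed

text \<open>
On the side of the support of \<open>S\<close> the function \<open>e(-\<xi> s)\<close> agrees with \<open>h(s) e(-\<xi> s)\<close> for a cutoff \<open>h\<close>, whose
Fourier series has the coefficients \<open>h^(\<xi> + j)\<close>. This samples the transform of \<open>S\<close> at the integers:
\<open>S^(\<xi>, \<eta>) = \<Sum> h^(\<xi> + j) h^(\<eta> + l) S^(-j, -l)\<close>. Replacing \<open>(\<xi>, \<eta>)\<close> by \<open>(\<xi> - n, \<eta> - m)\<close> and summing over
\<open>(n, m)\<close> first leaves the summable numbers \<open>S^(-j, -l)\<close> times a uniform bound.
\<close>

lemma lattice_sum_bound:
  fixes S :: "real \<times> real \<Rightarrow> complex"
  assumes S: "integrable lborel S" and supp: "\<And>z. z \<notin> half_J \<times> half_J \<Longrightarrow> S z = 0"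
    and a: "(\<lambda>(n, m). cmod (fourier2 S (real_of_int n, real_of_int m))) summable_on UNIV"
  obtains D where "\<And>\<xi> \<eta>. (\<lambda>(n, m). cmod (fourier2 S (\<xi> - real_of_int n, \<eta> - real_of_int m))) summable_on UNIV"
    "\<And>\<xi> \<eta>. (\<Sum>\<^sub>\<infinity>(n, m)\<in>UNIV. cmod (fourier2 S (\<xi> - real_of_int n, \<eta> - real_of_int m))) \<le> D"
proof -
  obtain \<kappa> :: "real \<Rightarrow> real" where \<kappa>: "C2 \<kappa>" "\<And>t. \<bar>t\<bar> \<le> 1/2 - 1/4 \<Longrightarrow> \<kappa> t = 1" "\<And>t. 1/2 \<le> \<bar>t\<bar> \<Longrightarrow> \<kappa> t = 0"
    by (rule smooth_cutoff[of "1/4"], simp, rule that)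
  define h where "h = (\<lambda>t. complex_of_real (\<kappa> t))"
  have h2: "C2 h" unfolding h_def by (rule C2_of_real[OF \<kappa>(1)])
  have hd: "C2_decay h" by (rule C2_compact_support_decay[OF h2]) (simp add: h_def \<kappa>(3))
  obtain B where B: "0 \<le> B" "\<And>\<xi>. (\<lambda>n::int. cmod (fourier h (\<xi> + of_int n))) summable_on UNIV"
    "\<And>\<xi>. (\<Sum>\<^sub>\<infinity>n::int. cmod (fourier h (\<xi> + of_int n))) \<le> B"
    using fourier_lattice_sum_bound[OF hd] by blast
  define a' where "a' = (\<lambda>(j, l). cmod (fourier2 S (- real_of_int j, - real_of_int l)))"
  have a': "a' summable_on UNIV"
  proof -
    have "bij_betw (\<lambda>(j, l). (- j, - l) :: int \<times> int) UNIV UNIV"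
      by (rule bij_betwI[where g = "\<lambda>(j, l). (- j, - l)"]) auto
    from summable_on_reindex_bij_betw[OF this, of "\<lambda>(n, m). cmod (fourier2 S (real_of_int n, real_of_int m))"]
    show ?thesis using a by (simp add: a'_def case_prod_unfold)
  qed
  have expand: "((\<lambda>(j, l). fourier h (\<xi> + of_int j) * fourier h (\<eta> + of_int l) *
      fourier2 S (- real_of_int j, - real_of_int l)) has_sum fourier2 S (\<xi>, \<eta>)) UNIV" for \<xi> \<eta>
  proof -
    have ser: "((\<lambda>j. fourier h (\<xi> + of_int j) * echar (of_int j * s)) has_sum echar (- \<xi> * s)) UNIV"
      if "s \<in> half_J" for \<xi> s
    proof -
      have s: "\<bar>s\<bar> \<le> 1/4" using that by (auto simp: half_J_def)
      define k where "k = (\<lambda>x. h x * echar (- \<xi> * x))"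
      have k0: "k t = 0" if "1/2 \<le> \<bar>t\<bar>" for t using \<kappa>(3)[OF that] by (simp add: k_def h_def)
      have "C2_decay k"
        by (rule C2_compact_support_decay[OF _ k0]) (auto simp: k_def intro!: C2_mult h2 C2_echar[of "- \<xi>", simplified])
      from fourier_series[OF this k0, of s] s
      have "((\<lambda>n. fourier k (of_int n) * echar (of_int n * s)) has_sum k s) UNIV" by auto
      moreover have "k s = echar (- \<xi> * s)" using s \<kappa>(2) by (simp add: k_def h_def)
      ultimately show ?thesis
        unfolding k_def fourier_mult_echar[OF C2_decay_measurable[OF hd]] by simp
    qed
    have "((\<lambda>(j, l). fourier h (\<xi> + of_int j) * fourier h (\<eta> + of_int l) * fourier2 S (- real_of_int j, - real_of_int l))
       has_sum (LINT z|lborel. S z * (echar (- \<xi> * fst z) * echar (- \<eta> * snd z)))) UNIV"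
      by (rule integral_expand_exponentials[OF S supp B(2) B(2) ser ser])
    also have "(LINT z|lborel. S z * (echar (- \<xi> * fst z) * echar (- \<eta> * snd z))) = fourier2 S (\<xi>, \<eta>)"
      using S by (simp add: fourier2_eq_lborel echar_add[symmetric] algebra_simps)
    finally show ?thesis .
  qed
  \<comment> \<open>The order of summation is exchanged for finite sets of \<open>(n, m)\<close>, and \<open>D\<close> bounds all of these partial sums.\<close>
  define D where "D = infsum a' UNIV * (B * B)"
  have fin: "(\<Sum>(n, m)\<in>N. cmod (fourier2 S (\<xi> - real_of_int n, \<eta> - real_of_int m))) \<le> D" if N: "finite N" for N \<xi> \<eta>
  proof -
    define w where "w = (\<lambda>(n, m) (j, l). cmod (fourier h (\<xi> + of_int j - of_int n) * fourier h (\<eta> + of_int l - of_int m)))"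
    have w_le: "(\<Sum>nm\<in>N. w nm jl) \<le> B * B" for jl
    proof -
      obtain j l where jl: "jl = (j, l)" by fastforce
      define p where "p = (\<lambda>n::int. fourier h ((\<xi> + of_int j) + of_int n))"
      define q where "q = (\<lambda>n::int. fourier h ((\<eta> + of_int l) + of_int n))"
      have tens: "(\<lambda>(n, m). cmod (p n * q m)) summable_on UNIV"
        "(\<Sum>\<^sub>\<infinity>(n, m)\<in>UNIV. cmod (p n * q m)) = (\<Sum>\<^sub>\<infinity>n. cmod (p n)) * (\<Sum>\<^sub>\<infinity>n. cmod (q n))"
        unfolding p_def q_def by (rule has_sum_tensor[OF B(2) B(2)])+
      have "(\<Sum>nm\<in>N. w nm jl) = (\<Sum>(n, m)\<in>N. cmod (p (- n) * q (- m)))"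
        by (simp add: w_def jl p_def q_def case_prod_unfold)
      also have "\<dots> = (\<Sum>(n, m)\<in>(\<lambda>(n, m). (- n, - m)) ` N. cmod (p n * q m))"
        by (subst sum.reindex) (auto simp: inj_on_def case_prod_unfold)
      also have "\<dots> \<le> (\<Sum>\<^sub>\<infinity>(n, m)\<in>UNIV. cmod (p n * q m))"
        using N by (intro finite_sum_le_infsum tens) auto
      also have "\<dots> \<le> B * B"
        unfolding tens(2) using B by (intro mult_mono) (auto simp: p_def q_def intro: infsum_nonneg)
      finally show ?thesis .
    qed
    have w_sm: "(\<lambda>jl. w nm jl * a' jl) summable_on UNIV" if "nm \<in> N" for nm
    proof (rule summable_on_comparison_test)
      show "(\<lambda>jl. (B * B) * a' jl) summable_on UNIV" by (intro summable_on_cmult_right a')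
      have w0: "0 \<le> w i jl" for i jl by (simp add: w_def case_prod_unfold)
      have "w nm jl \<le> B * B" for jl
        using member_le_sum[of nm N "\<lambda>nm. w nm jl"] that N w0 w_le[of jl] by fastforce
      then show "w nm jl * a' jl \<le> (B * B) * a' jl" for jl
        by (intro mult_right_mono) (auto simp: a'_def case_prod_unfold)
      show "0 \<le> w nm jl * a' jl" for jl by (simp add: w0 a'_def case_prod_unfold)
    qed
    have "(\<Sum>(n, m)\<in>N. cmod (fourier2 S (\<xi> - real_of_int n, \<eta> - real_of_int m))) \<le> (\<Sum>nm\<in>N. \<Sum>\<^sub>\<infinity>jl. w nm jl * a' jl)"
    proof (rule sum_mono)
      fix nm assume nm: "nm \<in> N"
      obtain n m where nm': "nm = (n, m)" by fastforce
      have eq: "cmod (case jl of (j, l) \<Rightarrow> fourier h ((\<xi> - of_int n) + of_int j) * fourier h ((\<eta> - of_int m) + of_int l) *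
          fourier2 S (- real_of_int j, - real_of_int l)) = w nm jl * a' jl" for jl
        by (simp add: w_def a'_def nm' norm_mult case_prod_unfold algebra_simps)
      have "cmod (fourier2 S (\<xi> - real_of_int n, \<eta> - real_of_int m)) \<le> (\<Sum>\<^sub>\<infinity>jl. w nm jl * a' jl)"
        by (rule norm_has_sum_bound[OF _ expand]) (unfold eq, rule has_sum_infsum[OF w_sm[OF nm]])
      then show "(case nm of (n, m) \<Rightarrow> cmod (fourier2 S (\<xi> - real_of_int n, \<eta> - real_of_int m))) \<le> (\<Sum>\<^sub>\<infinity>jl. w nm jl * a' jl)"
        by (simp add: nm')
    qed
    also have "\<dots> = (\<Sum>\<^sub>\<infinity>jl. \<Sum>nm\<in>N. w nm jl * a' jl)"
      by (rule infsumI[symmetric]) (rule has_sum_finite_sum[OF has_sum_infsum[OF w_sm]])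
    also have "\<dots> \<le> (\<Sum>\<^sub>\<infinity>jl. a' jl * (B * B))"
    proof (rule infsum_mono)
      show "(\<lambda>jl. \<Sum>nm\<in>N. w nm jl * a' jl) summable_on UNIV"
        by (rule has_sum_imp_summable[OF has_sum_finite_sum[OF has_sum_infsum[OF w_sm]]])
      show "(\<lambda>jl. a' jl * (B * B)) summable_on UNIV" by (intro summable_on_cmult_left a')
      show "(\<Sum>nm\<in>N. w nm jl * a' jl) \<le> a' jl * (B * B)" for jl
        unfolding sum_distrib_right[symmetric]
        by (subst mult.commute, intro mult_left_mono w_le) (auto simp: a'_def case_prod_unfold)
    qed
    also have "\<dots> = D" by (simp add: D_def infsum_cmult_left')
    finally show ?thesis .
  qed
  show ?thesis
  proof
    fix \<xi> \<eta>
    show sm: "(\<lambda>(n, m). cmod (fourier2 S (\<xi> - real_of_int n, \<eta> - real_of_int m))) summable_on UNIV"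
      by (rule nonneg_bounded_partial_sums_imp_summable_on[where C = D])
         (use fin in \<open>auto intro!: eventually_finite_subsets_at_top_weakI\<close>)
    show "(\<Sum>\<^sub>\<infinity>(n, m)\<in>UNIV. cmod (fourier2 S (\<xi> - real_of_int n, \<eta> - real_of_int m))) \<le> D"
      by (rule infsum_le_finite_sums[OF sm]) (use fin in auto)
  qed
qed


section \<open>The bilinear operator of the extended symbol\<close>

definition extended_symbol :: "(int \<times> int \<Rightarrow> complex) \<Rightarrow> (real \<times> real \<Rightarrow> complex) \<Rightarrow> real \<times> real \<Rightarrow> complex" where
  "extended_symbol \<phi> S = (\<lambda>(\<xi>, \<eta>). \<Sum>\<^sub>\<infinity>(n, m)\<in>UNIV.
     \<phi> (n, m) * fourier2 S (\<xi> - real_of_int n, \<eta> - real_of_int m))"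

lemma C2_decay_bounded:
  assumes "C2_decay f"
  obtains K where "\<And>x. cmod (f x) \<le> K"
proof -
  obtain K where K: "\<And>x. cmod (f x) \<le> K / (1 + x\<^sup>2)"
    using assms unfolding C2_decay_def by metis
  have "0 \<le> K" using order_trans[OF norm_ge_zero K[of 0]] by simp
  then have "K / (1 + x\<^sup>2) \<le> K / 1" for x
    by (intro divide_left_mono) (auto simp: add_pos_nonneg)
  then show ?thesis using that[of K] K by (metis div_by_1 order_trans)
qed

lemma C2_decay_inversion:
  assumes "C2_decay f"
  shows "(LINT \<xi>|lborel. fourier f \<xi> * echar (\<xi> * x)) = f x"
proof -
  obtain K where "\<And>x. cmod (f x) \<le> K" using C2_decay_bounded[OF assms] by blast
  then show ?thesis
    using C2_decay_integrable[OF assms] C2_decay_continuous[OF assms] fourier_integrable[OF assms]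
    by (intro fourier_inversion)
qed

lemma bilin_R_eq_lborel:
  assumes f: "C2_decay f" and g: "C2_decay g"
    and \<psi>: "\<psi> \<in> borel_measurable borel" and P: "\<And>z. cmod (\<psi> z) \<le> P"
  shows "bilin_R \<psi> f g x =
      (LINT z|lborel. fourier f (fst z) * fourier g (snd z) * \<psi> z * echar (x * (fst z + snd z)))"
    and "bilin_R \<psi> f g \<in> borel_measurable borel"
proof -
  have [measurable]: "f \<in> borel_measurable borel" "g \<in> borel_measurable borel" "\<psi> \<in> borel_measurable borel"
    using C2_decay_measurable f g \<psi> by auto
  have [measurable]: "fourier f \<in> borel_measurable borel" "fourier g \<in> borel_measurable borel"
    by (auto intro: borel_measurable_fourier)
  have \<psi>2 [measurable]: "(\<lambda>(\<xi>, \<eta>). \<psi> (\<xi>, \<eta>)) \<in> borel_measurable (borel \<Otimes>\<^sub>M borel)"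
    using \<psi> by (simp add: borel_prod)
  have eq: "bilin_R \<psi> f g x =
      (LINT z|lborel. fourier f (fst z) * fourier g (snd z) * \<psi> z * echar (x * (fst z + snd z)))" for x
  proof -
    define \<Phi> where "\<Phi> = (\<lambda>\<xi> \<eta>. fourier f \<xi> * fourier g \<eta> * \<psi> (\<xi>, \<eta>) * echar (x * (\<xi> + \<eta>)))"
    have int: "integrable (lborel \<Otimes>\<^sub>M lborel) (\<lambda>z. \<Phi> (fst z) (snd z))"
    proof -
      have i: "integrable lborel (\<lambda>z. P * cmod (fourier f (fst z) * fourier g (snd z)))"
        using integral_tensor(2)[OF fourier_integrable[OF f] fourier_integrable[OF g]] by simp
      have "integrable lborel (\<lambda>z. \<Phi> (fst z) (snd z))"
      proof (rule Bochner_Integration.integrable_bound[OF i])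
        show "(\<lambda>z. \<Phi> (fst z) (snd z)) \<in> borel_measurable lborel" unfolding \<Phi>_def by measurable
        have "0 \<le> P" using order_trans[OF norm_ge_zero P] .
        then show "AE z in lborel. norm (\<Phi> (fst z) (snd z)) \<le> norm (P * cmod (fourier f (fst z) * fourier g (snd z)))"
          using P by (auto simp: \<Phi>_def norm_mult mult.commute[of P] intro!: mult_left_mono)
      qed
      then show ?thesis by (simp add: lborel_prod)
    qed
    have "bilin_R \<psi> f g x = (LINT \<xi>|lebesgue. LINT \<eta>|lebesgue. \<Phi> \<xi> \<eta>)"
      unfolding bilin_R_def \<Phi>_def echar_def by (simp add: mult.assoc)
    also have "\<dots> = (LINT \<xi>|lebesgue. LINT \<eta>|lborel. \<Phi> \<xi> \<eta>)"
      by (intro Bochner_Integration.integral_cong refl lebesgue_integral_eq_lborel_AE)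
         (auto simp: \<Phi>_def)
    also have "\<dots> = (LINT \<xi>|lborel. LINT \<eta>|lborel. \<Phi> \<xi> \<eta>)"
      by (intro lebesgue_integral_eq_lborel_AE) (auto simp: \<Phi>_def)
    also have "\<dots> = (LINT z|(lborel \<Otimes>\<^sub>M lborel). \<Phi> (fst z) (snd z))"
      using lborel_pair.integral_fst'[OF int] by simp
    finally show ?thesis by (simp add: \<Phi>_def lborel_prod)
  qed
  show "bilin_R \<psi> f g x =
      (LINT z|lborel. fourier f (fst z) * fourier g (snd z) * \<psi> z * echar (x * (fst z + snd z)))"
    by (rule eq)
  show "bilin_R \<psi> f g \<in> borel_measurable borel"
    unfolding eq[abs_def] by measurable
qed

text \<open>
Exchanging the frequency integral with the integral that defines the transform of \<open>S\<close> leaves two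
separate inversion integrals, of \<open>f\<close> and of \<open>g\<close>.
\<close>

lemma integral_fourier2_tensor:
  assumes f: "C2_decay f" and g: "C2_decay g" and S: "integrable lborel S"
  shows "(LINT z|lborel. fourier2 S (fst z - r, snd z - s) *
      (fourier f (fst z) * fourier g (snd z) * echar (x * (fst z + snd z)))) =
    (LINT w|lborel. S w * (echar (r * fst w) * f (x - fst w) * (echar (s * snd w) * g (x - snd w))))"
proof -
  have [measurable]: "f \<in> borel_measurable borel" "g \<in> borel_measurable borel" "S \<in> borel_measurable borel"
    using C2_decay_measurable f g S by auto
  have [measurable]: "fourier f \<in> borel_measurable borel" "fourier g \<in> borel_measurable borel"
    by (auto intro: borel_measurable_fourier)
  define E where "E = (\<lambda>z. fourier f (fst z) * fourier g (snd z) * echar (x * (fst z + snd z)))"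
  define e where "e = (\<lambda>z w. echar (- (fst w * (fst z - r) + snd w * (snd z - s))))"
  have [measurable]: "E \<in> borel_measurable borel" unfolding E_def by measurable
  have Ei: "integrable lborel E"
    by (rule Bochner_Integration.integrable_bound[OF integral_tensor(2)[OF fourier_integrable[OF f] fourier_integrable[OF g]]])
       (auto simp: E_def norm_mult)
  have int: "integrable (lborel \<Otimes>\<^sub>M lborel) (\<lambda>(z, w). E z * S w * e z w)"
    by (rule Bochner_Integration.integrable_bound[OF integrable_tensor[OF Ei S]])
       (auto simp: e_def norm_mult case_prod_unfold)
  have "(LINT z|lborel. fourier2 S (fst z - r, snd z - s) * E z) = (LINT z|lborel. LINT w|lborel. E z * S w * e z w)"
  proof (intro Bochner_Integration.integral_cong refl)
    fix z
    have "fourier2 S (fst z - r, snd z - s) * E z = E z * (LINT w|lborel. S w * e z w)"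
      by (simp add: fourier2_eq_lborel e_def)
    then show "fourier2 S (fst z - r, snd z - s) * E z = (LINT w|lborel. E z * S w * e z w)"
      by (simp add: mult.assoc)
  qed
  also have "\<dots> = (LINT w|lborel. LINT z|lborel. E z * S w * e z w)"
    by (rule lborel_pair.Fubini_integral[OF int, symmetric])
  also have "\<dots> = (LINT w|lborel. S w * (echar (r * fst w) * f (x - fst w) * (echar (s * snd w) * g (x - snd w))))"
  proof (intro Bochner_Integration.integral_cong refl)
    fix w :: "real \<times> real"
    define A where "A = (\<lambda>\<xi>. fourier f \<xi> * echar (\<xi> * (x - fst w)))"
    define B where "B = (\<lambda>\<eta>. fourier g \<eta> * echar (\<eta> * (x - snd w)))"
    have AB: "integrable lborel A" "integrable lborel B"
      by (rule Bochner_Integration.integrable_bound[OF fourier_integrable[OF f]], auto simp: A_def norm_mult)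
         (rule Bochner_Integration.integrable_bound[OF fourier_integrable[OF g]], auto simp: B_def norm_mult)
    have "E z * S w * e z w = (S w * (echar (r * fst w) * echar (s * snd w))) * (A (fst z) * B (snd z))" for z
    proof -
      have "echar (x * (fst z + snd z)) * e z w =
          echar (r * fst w) * echar (s * snd w) * (echar (fst z * (x - fst w)) * echar (snd z * (x - snd w)))"
        unfolding e_def echar_add[symmetric] by (simp add: algebra_simps)
      then show ?thesis by (simp add: E_def A_def B_def mult_ac)
    qed
    then have "(LINT z|lborel. E z * S w * e z w) =
        (S w * (echar (r * fst w) * echar (s * snd w))) * ((LINT \<xi>|lborel. A \<xi>) * (LINT \<eta>|lborel. B \<eta>))"
      by (simp only: integral_mult_right_zero integral_tensor(1)[OF AB])
    also have "(LINT \<xi>|lborel. A \<xi>) = f (x - fst w)" unfolding A_def by (rule C2_decay_inversion[OF f])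
    also have "(LINT \<xi>|lborel. B \<xi>) = g (x - snd w)" unfolding B_def by (rule C2_decay_inversion[OF g])
    finally show "(LINT z|lborel. E z * S w * e z w) =
        S w * (echar (r * fst w) * f (x - fst w) * (echar (s * snd w) * g (x - snd w)))"
      by (simp add: mult_ac)
  qed
  finally show ?thesis by (simp add: E_def)
qed

lemma extended_symbol_bounded:
  fixes S :: "real \<times> real \<Rightarrow> complex"
  assumes S: "integrable lborel S" and supp: "\<And>z. z \<notin> half_J \<times> half_J \<Longrightarrow> S z = 0"
    and a: "(\<lambda>(n, m). cmod (fourier2 S (real_of_int n, real_of_int m))) summable_on UNIV"
    and \<phi>: "\<And>z. cmod (\<phi> z) \<le> M"
  obtains P where
    "\<And>\<xi> \<eta>. (\<lambda>(n, m). cmod (\<phi> (n, m) * fourier2 S (\<xi> - real_of_int n, \<eta> - real_of_int m))) summable_on UNIV"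
    "\<And>\<xi> \<eta>. (\<Sum>\<^sub>\<infinity>(n, m)\<in>UNIV. cmod (\<phi> (n, m) * fourier2 S (\<xi> - real_of_int n, \<eta> - real_of_int m))) \<le> P"
    "\<And>z. cmod (extended_symbol \<phi> S z) \<le> P"
    "extended_symbol \<phi> S \<in> borel_measurable borel"
proof -
  have [measurable]: "fourier2 S \<in> borel_measurable borel"
    using S by (intro fourier2_measurable) auto
  obtain D where D: "\<And>\<xi> \<eta>. (\<lambda>(n, m). cmod (fourier2 S (\<xi> - real_of_int n, \<eta> - real_of_int m))) summable_on UNIV"
    "\<And>\<xi> \<eta>. (\<Sum>\<^sub>\<infinity>(n, m)\<in>UNIV. cmod (fourier2 S (\<xi> - real_of_int n, \<eta> - real_of_int m))) \<le> D"
    using lattice_sum_bound[OF S supp a] by blast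
  have M: "0 \<le> M" using order_trans[OF norm_ge_zero \<phi>] .
  have le: "cmod (\<phi> (n, m) * fourier2 S w) \<le> M * cmod (fourier2 S w)" for n m w
    by (simp add: norm_mult mult_right_mono \<phi>)
  have D': "(\<lambda>(n, m). M * cmod (fourier2 S (\<xi> - real_of_int n, \<eta> - real_of_int m))) summable_on UNIV" for \<xi> \<eta>
    using summable_on_cmult_right[OF D(1), of M] by (simp add: case_prod_unfold)
  have sm: "(\<lambda>(n, m). cmod (\<phi> (n, m) * fourier2 S (\<xi> - real_of_int n, \<eta> - real_of_int m))) summable_on UNIV" for \<xi> \<eta>
    by (rule summable_on_comparison_test[OF D']) (use le in auto)
  have bd: "(\<Sum>\<^sub>\<infinity>(n, m)\<in>UNIV. cmod (\<phi> (n, m) * fourier2 S (\<xi> - real_of_int n, \<eta> - real_of_int m))) \<le> M * D" for \<xi> \<eta>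
  proof -
    have "(\<Sum>\<^sub>\<infinity>(n, m)\<in>UNIV. cmod (\<phi> (n, m) * fourier2 S (\<xi> - real_of_int n, \<eta> - real_of_int m)))
        \<le> (\<Sum>\<^sub>\<infinity>(n, m)\<in>UNIV. M * cmod (fourier2 S (\<xi> - real_of_int n, \<eta> - real_of_int m)))"
      by (rule infsum_mono[OF sm D']) (use le in auto)
    also have "\<dots> = M * (\<Sum>\<^sub>\<infinity>(n, m)\<in>UNIV. cmod (fourier2 S (\<xi> - real_of_int n, \<eta> - real_of_int m)))"
      by (simp add: case_prod_unfold infsum_cmult_right')
    also have "\<dots> \<le> M * D" using M D(2) by (intro mult_left_mono)
    finally show ?thesis .
  qed
  have sm': "(\<lambda>nm. norm (case nm of (n, m) \<Rightarrow> \<phi> (n, m) * fourier2 S (\<xi> - real_of_int n, \<eta> - real_of_int m))) summable_on UNIV" for \<xi> \<eta>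
    using sm[of \<xi> \<eta>] by (simp add: case_prod_unfold)
  have bd': "cmod (extended_symbol \<phi> S z) \<le> M * D" for z
  proof -
    obtain \<xi> \<eta> where z: "z = (\<xi>, \<eta>)" by fastforce
    have "cmod (extended_symbol \<phi> S z) \<le>
        (\<Sum>\<^sub>\<infinity>nm. norm (case nm of (n, m) \<Rightarrow> \<phi> (n, m) * fourier2 S (\<xi> - real_of_int n, \<eta> - real_of_int m)))"
      unfolding extended_symbol_def z by simp (rule norm_infsum_bound[OF sm'])
    also have "\<dots> \<le> M * D" using bd[of \<xi> \<eta>] by (simp add: case_prod_unfold)
    finally show ?thesis .
  qed
  have meas: "extended_symbol \<phi> S \<in> borel_measurable borel"
  proof -
    have eq: "extended_symbol \<phi> S = (\<lambda>z. \<Sum>\<^sub>\<infinity>nm. case nm of (n, m) \<Rightarrow>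
        \<phi> (n, m) * fourier2 S (fst z - real_of_int n, snd z - real_of_int m))"
      by (auto simp: extended_symbol_def fun_eq_iff)
    have cont: "(\<lambda>z::real \<times> real. (fst z - r, snd z - s)) \<in> borel_measurable borel" for r s
      by (intro borel_measurable_continuous_onI continuous_intros)
    show ?thesis
      unfolding eq
    proof (rule borel_measurable_infsum)
      show "(\<lambda>z. case nm of (n, m) \<Rightarrow> \<phi> (n, m) * fourier2 S (fst z - real_of_int n, snd z - real_of_int m)) \<in> borel_measurable borel" for nm
        unfolding case_prod_unfold
        by (intro borel_measurable_times measurable_const measurable_compose[OF cont]) measurable
      show "(\<lambda>nm. case nm of (n, m) \<Rightarrow> \<phi> (n, m) * fourier2 S (fst z - real_of_int n, snd z - real_of_int m)) summable_on UNIV" for z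
        by (rule abs_summable_summable[OF sm'])
    qed
  qed
  show ?thesis by (rule that[OF sm bd bd' meas])
qed

text \<open>
The kernel form of the operator. The symbol series is dominated by a constant, so it may be integrated
term by term against the integrable transforms of \<open>f\<close> and \<open>g\<close>.
\<close>

lemma bilin_R_extended_symbol:
  fixes S :: "real \<times> real \<Rightarrow> complex"
  assumes S: "integrable lborel S" and supp: "\<And>z. z \<notin> half_J \<times> half_J \<Longrightarrow> S z = 0"
    and a: "(\<lambda>(n, m). cmod (fourier2 S (real_of_int n, real_of_int m))) summable_on UNIV"
    and \<phi>: "\<And>z. cmod (\<phi> z) \<le> M"
    and f: "C2_decay f" and g: "C2_decay g"
  shows "((\<lambda>(n, m). \<phi> (n, m) * (LINT w|lborel. S w * (echar (real_of_int n * fst w) * f (x - fst w) *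
      (echar (real_of_int m * snd w) * g (x - snd w))))) has_sum bilin_R (extended_symbol \<phi> S) f g x) UNIV"
proof -
  obtain P where P:
    "\<And>\<xi> \<eta>. (\<lambda>(n, m). cmod (\<phi> (n, m) * fourier2 S (\<xi> - real_of_int n, \<eta> - real_of_int m))) summable_on UNIV"
    "\<And>\<xi> \<eta>. (\<Sum>\<^sub>\<infinity>(n, m)\<in>UNIV. cmod (\<phi> (n, m) * fourier2 S (\<xi> - real_of_int n, \<eta> - real_of_int m))) \<le> P"
    "\<And>z. cmod (extended_symbol \<phi> S z) \<le> P"
    "extended_symbol \<phi> S \<in> borel_measurable borel"
    by (rule extended_symbol_bounded[where \<phi> = \<phi> and M = M, OF S supp a \<phi>]) (assumption, rule that)
  have [measurable]: "f \<in> borel_measurable borel" "g \<in> borel_measurable borel" "S \<in> borel_measurable borel"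
    using C2_decay_measurable f g S by auto
  have [measurable]: "fourier f \<in> borel_measurable borel" "fourier g \<in> borel_measurable borel"
      "fourier2 S \<in> borel_measurable borel"
    by (auto intro: borel_measurable_fourier fourier2_measurable)
  have cont [measurable]: "(\<lambda>z::real \<times> real. (fst z - r, snd z - s)) \<in> borel_measurable borel" for r s
    by (intro borel_measurable_continuous_onI continuous_intros)
  define E where "E = (\<lambda>z. fourier f (fst z) * fourier g (snd z) * echar (x * (fst z + snd z)))"
  have [measurable]: "E \<in> borel_measurable borel" unfolding E_def by measurable
  have Ei: "integrable lborel E"
    by (rule Bochner_Integration.integrable_bound[OF integral_tensor(2)[OF fourier_integrable[OF f] fourier_integrable[OF g]]])
       (auto simp: E_def norm_mult)
  define F where "F = (\<lambda>nm z. (case nm of (n, m) \<Rightarrow> \<phi> (n, m) * fourier2 S (fst z - real_of_int n, snd z - real_of_int m)) * E z)"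
  have nF: "(\<lambda>nm. cmod (F nm z)) = (\<lambda>nm. (case nm of (n, m) \<Rightarrow>
      cmod (\<phi> (n, m) * fourier2 S (fst z - real_of_int n, snd z - real_of_int m))) * cmod (E z))" for z
    by (auto simp: F_def norm_mult fun_eq_iff)
  have "((\<lambda>nm. LINT z|lborel. F nm z) has_sum (LINT z|lborel. (\<Sum>\<^sub>\<infinity>nm. F nm z))) UNIV"
  proof (rule has_sum_integral_dominated[where G = "\<lambda>z. P * cmod (E z)"])
    show "F nm \<in> borel_measurable lborel" for nm
      unfolding F_def case_prod_unfold by measurable
    show "integrable lborel (\<lambda>z. P * cmod (E z))" using Ei by simp
    show "(\<lambda>nm. cmod (F nm z)) summable_on UNIV" for z
      unfolding nF by (rule summable_on_cmult_left[OF P(1)])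
    show "(\<Sum>\<^sub>\<infinity>nm. cmod (F nm z)) \<le> P * cmod (E z)" for z
      unfolding nF infsum_cmult_left' by (rule mult_right_mono[OF P(2)]) simp
  qed
  moreover have "(\<Sum>\<^sub>\<infinity>nm. F nm z) =
      fourier f (fst z) * fourier g (snd z) * extended_symbol \<phi> S z * echar (x * (fst z + snd z))" for z
    unfolding F_def infsum_cmult_left' by (simp add: extended_symbol_def E_def case_prod_unfold)
  moreover have "(LINT z|lborel. F nm z) = (case nm of (n, m) \<Rightarrow> \<phi> (n, m) *
      (LINT w|lborel. S w * (echar (real_of_int n * fst w) * f (x - fst w) * (echar (real_of_int m * snd w) * g (x - snd w)))))" for nm
    using integral_fourier2_tensor[OF f g S, of "real_of_int (fst nm)" "real_of_int (snd nm)" x]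
    by (simp add: F_def E_def case_prod_unfold mult.assoc)
  ultimately show ?thesis
    by (simp add: bilin_R_eq_lborel[OF f g P(4,3)] case_prod_unfold)
qed

text \<open>
For \<open>\<bar>x\<bar> \<le> 1/4 - \<delta>\<close> and \<open>s\<close> in the side of the support of \<open>S\<close>, the point \<open>x - s\<close> lies where the compactly supported
\<open>h\<close> copies \<open>f\<close> around \<open>u\<close>. Hence \<open>f(u + x - s)\<close> is given by the Fourier series of \<open>h\<close>, likewise for \<open>g\<close> and
\<open>k\<close>, and each kernel integral expands into the numbers \<open>fourier2 S\<close> at integer points. The resulting
fourfold series converges absolutely. Grouping by the coefficient of \<open>S\<close> instead of by \<open>(n, m)\<close> and
cutting off all four indices at \<open>N\<close> gives the sums to which the torus estimate applies.
\<close>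

lemma bilin_R_local_limit:
  fixes S :: "real \<times> real \<Rightarrow> complex" and \<kappa> :: "real \<Rightarrow> real"
  assumes S: "integrable lborel S" and supp: "\<And>z. z \<notin> half_J \<times> half_J \<Longrightarrow> S z = 0"
    and a: "(\<lambda>(n, m). cmod (fourier2 S (real_of_int n, real_of_int m))) summable_on UNIV"
    and \<phi>: "\<And>z. cmod (\<phi> z) \<le> M"
    and f: "C2_decay f" and g: "C2_decay g"
    and h: "C2_decay h" "\<And>t. 1/2 \<le> \<bar>t\<bar> \<Longrightarrow> h t = 0" "\<And>t. \<bar>t\<bar> \<le> 1/2 - \<delta> \<Longrightarrow> h t = f (u + t)"
    and k: "C2_decay k" "\<And>t. 1/2 \<le> \<bar>t\<bar> \<Longrightarrow> k t = 0" "\<And>t. \<bar>t\<bar> \<le> 1/2 - \<delta> \<Longrightarrow> k t = g (u + t)"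
    and \<delta>: "0 < \<delta>" and x: "\<bar>x\<bar> \<le> 1/4 - \<delta>"
  shows "(\<lambda>N. \<Sum>(p, q)\<in>{- int N..int N} \<times> {- int N..int N}. fourier2 S (real_of_int p, real_of_int q) *
      (\<Sum>n\<in>{- int N..int N}. \<Sum>m\<in>{- int N..int N}. fourier h (of_int n) * fourier k (of_int m) *
         \<phi> (n - p, m - q) * echar (of_int (n + m) * x)))
    \<longlonglongrightarrow> bilin_R (extended_symbol \<phi> S) f g (u + x)"
proof -
  define A where "A = (\<lambda>(p, q). fourier2 S (real_of_int p, real_of_int q))"
  define ch where "ch = (\<lambda>j::int. fourier h (of_int j) * echar (of_int j * x))"
  define ck where "ck = (\<lambda>j::int. fourier k (of_int j) * echar (of_int j * x))"
  have sum_h: "(\<lambda>j. cmod (ch j)) summable_on UNIV"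
    using summable_fourier_int[OF h(1)] by (simp add: ch_def norm_mult)
  have sum_k: "(\<lambda>j. cmod (ck j)) summable_on UNIV"
    using summable_fourier_int[OF k(1)] by (simp add: ck_def norm_mult)
  have expand: "((\<lambda>j. fourier h (of_int j) * echar (of_int j * x) * echar ((of_int n - of_int j) * s))
      has_sum echar (of_int n * s) * f (u + x - s)) UNIV"
    if s: "s \<in> half_J" and h: "C2_decay h" "\<And>t. 1/2 \<le> \<bar>t\<bar> \<Longrightarrow> h t = 0" "\<And>t. \<bar>t\<bar> \<le> 1/2 - \<delta> \<Longrightarrow> h t = f (u + t)"
    for s and n :: int and h f :: "real \<Rightarrow> complex"
  proof -
    have b: "\<bar>x - s\<bar> \<le> 1/2 - \<delta>" using s x by (auto simp: half_J_def)
    have "((\<lambda>j. fourier h (of_int j) * echar (of_int j * (x - s))) has_sum h (x - s)) UNIV"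
      using b \<delta> by (intro fourier_series h) auto
    from has_sum_cmult_right[OF this, of "echar (of_int n * s)"]
    have "((\<lambda>j. echar (of_int n * s) * (fourier h (of_int j) * echar (of_int j * (x - s)))) has_sum
        echar (of_int n * s) * f (u + x - s)) UNIV"
      using h(3)[OF b] by (simp add: add_diff_eq)
    moreover have "echar (of_int n * s) * (fourier h (of_int j) * echar (of_int j * (x - s))) =
        fourier h (of_int j) * echar (of_int j * x) * echar ((of_int n - of_int j) * s)" for j
    proof -
      have "echar (of_int n * s) * echar (of_int j * (x - s)) = echar (of_int j * x) * echar ((of_int n - of_int j) * s)"
        unfolding echar_add[symmetric] by (simp add: algebra_simps)
      then show ?thesis by (simp add: mult_ac)
    qed
    ultimately show ?thesis by simp
  qed
  define V where "V = (\<lambda>((n, m), (j, i)). \<phi> (n, m) * (ch j * ck i * A (j - n, i - m)))"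
  define W where "W = (\<lambda>((p, q), (j, i)). \<phi> (j - p, i - q) * (ch j * ck i * A (p, q)))"
  have W_abs: "(\<lambda>z. cmod (W z)) summable_on UNIV"
  proof (rule summable_on_comparison_test)
    have "(\<lambda>z. cmod (A z)) summable_on UNIV"
      using a by (simp add: A_def case_prod_unfold)
    moreover have "(\<lambda>z. cmod (case z of (j, i) \<Rightarrow> ch j * ck i)) summable_on UNIV"
      using has_sum_tensor(1)[OF sum_h sum_k] by (simp add: case_prod_unfold)
    ultimately have "(\<lambda>(pq, ji). cmod (A pq * (case ji of (j, i) \<Rightarrow> ch j * ck i))) summable_on UNIV"
      by (rule has_sum_tensor(1))
    from summable_on_cmult_right[OF this, of M]
    show "(\<lambda>z. M * (case z of (pq, ji) \<Rightarrow> cmod (A pq * (case ji of (j, i) \<Rightarrow> ch j * ck i)))) summable_on UNIV" .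
    show "cmod (W z) \<le> M * (case z of (pq, ji) \<Rightarrow> cmod (A pq * (case ji of (j, i) \<Rightarrow> ch j * ck i)))" for z
    proof -
      obtain p q j i where z: "z = ((p, q), (j, i))" by (metis prod.exhaust)
      have "cmod (W z) = cmod (\<phi> (j - p, i - q)) * cmod (A (p, q) * (ch j * ck i))"
        by (simp add: W_def z norm_mult mult_ac)
      also have "\<dots> \<le> M * cmod (A (p, q) * (ch j * ck i))"
        by (intro mult_right_mono \<phi>) simp
      finally show ?thesis by (simp add: z)
    qed
  qed simp
  define w where "w = infsum W UNIV"
  have W: "(W has_sum w) UNIV"
    unfolding w_def by (rule has_sum_infsum[OF abs_summable_summable[OF W_abs]])
  have V: "(V has_sum w) UNIV"
  proof -
    \<comment> \<open>The change of indices \<open>(n, m) = (j - p, i - q)\<close> is an involution, and it identifies the two groupings.\<close>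
    define b where "b = (\<lambda>((p, q), (j, i)). ((j - p, i - q), (j, i)) :: (int \<times> int) \<times> (int \<times> int))"
    have "bij_betw b UNIV UNIV" by (rule bij_betwI[where g = b]) (auto simp: b_def)
    from has_sum_reindex_bij_betw[OF this, of V w] have "((\<lambda>z. V (b z)) has_sum w) UNIV = (V has_sum w) UNIV" .
    moreover have "(\<lambda>z. V (b z)) = W" by (auto simp: V_def W_def b_def fun_eq_iff)
    ultimately show ?thesis using W by simp
  qed
  define I where "I = (\<lambda>(n, m). LINT w|lborel. S w * (echar (real_of_int n * fst w) * f (u + x - fst w) *
      (echar (real_of_int m * snd w) * g (u + x - snd w))))"
  have inner: "((\<lambda>ji. V (nm, ji)) has_sum \<phi> nm * I nm) UNIV" for nm
  proof -
    obtain n m where nm: "nm = (n, m)" by fastforce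
    have "((\<lambda>(j, l). ch j * ck l * fourier2 S (- (real_of_int n - real_of_int j), - (real_of_int m - real_of_int l))) has_sum I nm) UNIV"
      unfolding I_def nm prod.case
      by (rule integral_expand_exponentials[OF S supp sum_h sum_k])
         (use expand[OF _ h] expand[OF _ k] in \<open>auto simp: ch_def ck_def\<close>)
    from has_sum_cmult_right[OF this, of "\<phi> nm"] show ?thesis
      by (simp add: V_def A_def nm case_prod_unfold)
  qed
  have "((\<lambda>nm. \<phi> nm * I nm) has_sum w) UNIV"
    by (rule has_sum_SigmaD[where f = V and A = UNIV and B = "\<lambda>_. UNIV"]) (use V inner in auto)
  moreover have "((\<lambda>nm. \<phi> nm * I nm) has_sum bilin_R (extended_symbol \<phi> S) f g (u + x)) UNIV"
    using bilin_R_extended_symbol[where \<phi> = \<phi> and x = "u + x", OF S supp a \<phi> f g] by (simp add: I_def case_prod_unfold)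
  ultimately have w: "w = bilin_R (extended_symbol \<phi> S) f g (u + x)" by (rule has_sum_unique)
  define Z where "Z = (\<lambda>N. {- int N..int N})"
  have "(\<lambda>N. sum W ((Z N \<times> Z N) \<times> (Z N \<times> Z N))) \<longlonglongrightarrow> w"
  proof (rule has_sum_tendsto_exhaustion[OF W])
    show "finite ((Z N \<times> Z N) \<times> (Z N \<times> Z N))" for N by (simp add: Z_def)
    fix z :: "(int \<times> int) \<times> int \<times> int"
    obtain p q j i where z: "z = ((p, q), (j, i))" by (metis prod.exhaust)
    show "\<forall>\<^sub>F N in sequentially. z \<in> (Z N \<times> Z N) \<times> (Z N \<times> Z N)"
      using eventually_mem_sym_int[of p] eventually_mem_sym_int[of q] eventually_mem_sym_int[of j] eventually_mem_sym_int[of i]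
      by eventually_elim (simp add: z Z_def)
  qed
  moreover have "sum W ((Z N \<times> Z N) \<times> (Z N \<times> Z N)) =
      (\<Sum>(p, q)\<in>Z N \<times> Z N. fourier2 S (real_of_int p, real_of_int q) *
      (\<Sum>n\<in>Z N. \<Sum>m\<in>Z N. fourier h (of_int n) * fourier k (of_int m) *
         \<phi> (n - p, m - q) * echar (of_int (n + m) * x)))" for N
  proof -
    have "W ((p, q), (n, m)) = fourier2 S (real_of_int p, real_of_int q) *
       (fourier h (of_int n) * fourier k (of_int m) * \<phi> (n - p, m - q) * echar (of_int (n + m) * x))" for p q n m
    proof -
      have "echar (of_int (n + m) * x) = echar (of_int n * x) * echar (of_int m * x)"
        by (simp add: echar_add[symmetric] algebra_simps)
      then show ?thesis by (simp add: W_def A_def ch_def ck_def mult_ac del: of_int_add)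
    qed
    then show ?thesis
      by (simp only: sum.cartesian_product' case_prod_unfold sum_distrib_left fst_conv snd_conv prod.collapse)
  qed
  ultimately show ?thesis unfolding w Z_def by simp
qed


section \<open>The local estimate\<close>

lemma Lp_norm_mono:
  assumes "f \<in> borel_measurable M" "0 < p" "\<And>x. cmod (f x) \<le> cmod (g x)"
  shows "Lp_norm p M f \<le> Lp_norm p M g"
proof (cases "Lp_norm p M g")
  case (real B)
  have [measurable]: "f \<in> borel_measurable M" by fact
  show ?thesis
  proof (cases "p = \<infinity>")
    case True
    then show ?thesis using assms(3)
      unfolding Lp_norm_def by (auto intro!: esssup_mono ennreal_leI)
  next
    case False
    have q: "0 < enn2real p" using False assms(2) by (simp add: enn2real_positive_iff less_top)
    have "(\<integral>\<^sup>+ x. ennreal (cmod (f x) powr enn2real p) \<partial>M) \<le> (\<integral>\<^sup>+ x. ennreal (cmod (g x) powr enn2real p) \<partial>M)"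
      using assms(3) q by (intro nn_integral_mono ennreal_leI powr_mono2) auto
    also have "\<dots> \<le> ennreal (B powr enn2real p)"
      using Lp_norm_le_iff[OF False q, of B M g] real by simp
    finally show ?thesis
      using Lp_norm_le_iff[OF False q, of B M f] real by simp
  qed
qed simp

lemma Lp_norm_fatou:
  assumes p: "0 < p" and meas: "\<And>n. F n \<in> borel_measurable M" "f \<in> borel_measurable M"
    and lim: "\<And>x. x \<in> space M \<Longrightarrow> (\<lambda>n. F n x) \<longlonglongrightarrow> f x" and B: "0 \<le> B"
    and bd: "\<forall>\<^sub>F n in sequentially. Lp_norm p M (F n) \<le> ennreal B"
  shows "Lp_norm p M f \<le> ennreal B"
proof -
  obtain n0 where n0: "\<And>n. n0 \<le> n \<Longrightarrow> Lp_norm p M (F n) \<le> ennreal B"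
    using bd unfolding eventually_sequentially by blast
  show ?thesis
  proof (cases "p = \<infinity>")
    case True
    have "AE x in M. \<forall>n. cmod (F (n0 + n) x) \<le> B"
      unfolding AE_all_countable
      using n0 meas True B by (auto simp: Lp_norm_infinity_le_iff[unfolded infinity_ennreal_def, symmetric])
    then have "AE x in M. cmod (f x) \<le> B"
    proof (rule AE_mp, intro AE_I2 impI)
      fix x assume x: "x \<in> space M" and b: "\<forall>n. cmod (F (n0 + n) x) \<le> B"
      have "(\<lambda>n. cmod (F n x)) \<longlonglongrightarrow> cmod (f x)" by (intro tendsto_norm lim x)
      moreover have "cmod (F n x) \<le> B" if "n0 \<le> n" for n
        using b[rule_format, of "n - n0"] that by simp
      ultimately show "cmod (f x) \<le> B"
        by (intro LIMSEQ_le_const2) auto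
    qed
    then show ?thesis using True meas B by (simp add: Lp_norm_infinity_le_iff[unfolded infinity_ennreal_def])
  next
    case False
    define q where "q = enn2real p"
    have q: "0 < q" using False p by (simp add: q_def enn2real_positive_iff less_top)
    note iff = Lp_norm_le_iff[OF False q[unfolded q_def] B, folded q_def]
    have "(\<integral>\<^sup>+ x. ennreal (cmod (f x) powr q) \<partial>M) = (\<integral>\<^sup>+ x. liminf (\<lambda>n. ennreal (cmod (F n x) powr q)) \<partial>M)"
    proof (rule nn_integral_cong)
      fix x assume "x \<in> space M"
      then have "(\<lambda>n. ennreal (cmod (F n x) powr q)) \<longlonglongrightarrow> ennreal (cmod (f x) powr q)"
        using q lim by (intro tendsto_ennrealI tendsto_powr' tendsto_norm tendsto_const) auto
      then show "ennreal (cmod (f x) powr q) = liminf (\<lambda>n. ennreal (cmod (F n x) powr q))"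
        by (intro lim_imp_Liminf[symmetric] trivial_limit_sequentially)
    qed
    also have "\<dots> \<le> liminf (\<lambda>n. \<integral>\<^sup>+ x. ennreal (cmod (F n x) powr q) \<partial>M)"
      using meas by (intro nn_integral_liminf) auto
    also have "\<dots> \<le> ennreal (B powr q)"
    proof -
      have "\<forall>\<^sub>F n in sequentially. (\<integral>\<^sup>+ x. ennreal (cmod (F n x) powr q) \<partial>M) \<le> ennreal (B powr q)"
        using bd by eventually_elim (simp add: iff)
      from Liminf_mono[OF this] show ?thesis by (simp add: Liminf_const)
    qed
    finally show ?thesis by (simp add: iff)
  qed
qed

lemma borel_imp_lebesgue_on_J: "f \<in> borel_measurable borel \<Longrightarrow> f \<in> borel_measurable (lebesgue_on J)"
  by (intro measurable_restrict_space1 measurable_completion) simp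

lemma nn_integral_lebesgue_on_J:
  "(\<integral>\<^sup>+ x. G x \<partial>lebesgue_on J) = (\<integral>\<^sup>+ x. G x * indicator J x \<partial>lborel)"
  by (subst nn_integral_restrict_space) (simp_all add: nn_integral_completion J_def)

lemma AE_lebesgue_on_J_less_half: "AE x in lebesgue_on J. \<bar>x\<bar> < 1/2"
proof -
  have "AE x in lborel. x \<noteq> (- 1/2 :: real)" by (rule AE_lborel_singleton)
  then have "AE x in lebesgue. x \<noteq> (- 1/2 :: real)" by (rule AE_completion)
  then have "AE x in lebesgue. x \<in> J \<longrightarrow> \<bar>x\<bar> < 1/2"
    by eventually_elim (auto simp: J_def)
  then show ?thesis by (subst AE_restrict_space_iff) (auto simp: J_def)
qed

text \<open>
The partial sums of the Fourier series of \<open>h\<close> converge uniformly, since the coefficients are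
absolutely summable, and the unit interval has finite measure; so all norms pass to the limit.
\<close>

lemma trig_partial_sum_norm:
  assumes h: "C2_decay h" and supp: "\<And>t. 1/2 \<le> \<bar>t\<bar> \<Longrightarrow> h t = 0"
    and p: "1 \<le> p" and X: "0 \<le> X" "Lp_norm p (lebesgue_on J) h \<le> ennreal X" and \<epsilon>: "0 < \<epsilon>"
  shows "\<forall>\<^sub>F N in sequentially. Lp_norm p (lebesgue_on J) (trig {- int N..int N} (\<lambda>n. fourier h (of_int n))) \<le> ennreal (X + \<epsilon>)"
proof -
  define T where "T = (\<lambda>N. trig {- int N..int N} (\<lambda>n. fourier h (of_int n)))"
  have [measurable]: "T N \<in> borel_measurable borel" for N unfolding T_def by measurable
  have hm [measurable]: "h \<in> borel_measurable borel" using C2_decay_measurable[OF h] .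
  note abs = summable_fourier_int[OF h]
  define R where "R = (\<Sum>\<^sub>\<infinity>n::int. cmod (fourier h (of_int n)))"
  define r where "r = (\<lambda>N. R - (\<Sum>n\<in>{- int N..int N}. cmod (fourier h (of_int n))))"
  have "(\<lambda>N. R - (\<Sum>n\<in>{- int N..int N}. cmod (fourier h (of_int n)))) \<longlonglongrightarrow> R - R"
    unfolding R_def
    by (intro tendsto_diff tendsto_const has_sum_tendsto_exhaustion[OF has_sum_infsum[OF abs]]
        finite_sym_int eventually_mem_sym_int)
  then have r0: "r \<longlonglongrightarrow> 0" by (simp add: r_def)
  have close: "cmod (T N t - h t) \<le> r N" if t: "\<bar>t\<bar> < 1/2" for N t
  proof -
    define a where "a = (\<lambda>n::int. fourier h (of_int n) * echar (of_int n * t))"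
    have "(a has_sum h t) UNIV" unfolding a_def by (rule fourier_series[OF h supp t])
    moreover have "(a has_sum T N t) {- int N..int N}" by (simp add: T_def trig_def a_def has_sum_finite_iff)
    ultimately have 1: "(a has_sum (h t - T N t)) (UNIV - {- int N..int N})"
      by (intro has_sum_Diff) auto
    have 2: "((\<lambda>n::int. cmod (fourier h (of_int n))) has_sum r N) (UNIV - {- int N..int N})"
      unfolding r_def R_def
      by (intro has_sum_Diff has_sum_infsum abs) (auto simp: has_sum_finite_iff)
    have "cmod (h t - T N t) \<le> r N"
      by (rule norm_has_sum_bound[OF _ 1]) (use 2 in \<open>simp add: a_def norm_mult\<close>)
    then show ?thesis by (simp add: norm_minus_commute)
  qed
  have conv: "(\<lambda>N. T N t) \<longlonglongrightarrow> h t" if "\<bar>t\<bar> < 1/2" for t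
  proof -
    have "(\<lambda>N. T N t - h t) \<longlonglongrightarrow> 0"
      by (rule Lim_null_comparison[OF _ r0]) (use close[OF that] in auto)
    then show ?thesis by (simp add: LIM_zero_iff)
  qed
  have TR: "cmod (T N t) \<le> R" for N t
  proof -
    have "cmod (T N t) \<le> (\<Sum>n\<in>{- int N..int N}. cmod (fourier h (of_int n)))"
      unfolding T_def trig_def by (rule order_trans[OF norm_sum]) (simp add: norm_mult)
    also have "\<dots> \<le> R" unfolding R_def by (intro finite_sum_le_infsum abs) auto
    finally show ?thesis .
  qed
  show ?thesis
  proof (cases "p = \<infinity>")
    case True
    have "AE t in lebesgue_on J. cmod (h t) \<le> X"
      using X True Lp_norm_infinity_le_iff[OF borel_imp_lebesgue_on_J[OF hm] X(1)] by simp
    then have AE: "AE t in lebesgue_on J. \<bar>t\<bar> < 1/2 \<and> cmod (h t) \<le> X"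
      using AE_lebesgue_on_J_less_half by eventually_elim auto
    have "\<forall>\<^sub>F N in sequentially. r N < \<epsilon>" using order_tendstoD(2)[OF r0 \<epsilon>] .
    then show ?thesis
    proof eventually_elim
      case (elim N)
      have "AE t in lebesgue_on J. cmod (T N t) \<le> X + \<epsilon>"
        using AE
      proof eventually_elim
        case (elim t)
        have "cmod (T N t) \<le> cmod (h t) + cmod (T N t - h t)"
          using norm_triangle_ineq[of "h t" "T N t - h t"] by simp
        then show ?case using elim close[of t N] \<open>r N < \<epsilon>\<close> by linarith
      qed
      then show ?case
        using X(1) \<epsilon> Lp_norm_infinity_le_iff[OF borel_imp_lebesgue_on_J, of "T N" "X + \<epsilon>"]
        by (simp add: True T_def)
    qed
  next
    case False
    define q where "q = enn2real p"
    have q: "1 \<le> q" using False p enn2real_mono[of 1 p] by (simp add: q_def less_top)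
    then have q0: "0 < q" by simp
    note iff = Lp_norm_le_iff[OF False q0[unfolded q_def], folded q_def]
    have "(\<lambda>N. \<integral>\<^sup>+ t. ennreal (cmod (T N t) powr q) \<partial>lebesgue_on J) \<longlonglongrightarrow> (\<integral>\<^sup>+ t. ennreal (cmod (h t) powr q) \<partial>lebesgue_on J)"
    proof (rule nn_integral_dominated_convergence[where w = "\<lambda>_. ennreal (R powr q)"])
      show "AE t in lebesgue_on J. ennreal (cmod (T N t) powr q) \<le> ennreal (R powr q)" for N
        using TR q by (intro AE_I2 ennreal_leI powr_mono2) auto
      have "emeasure (lebesgue_on J) (space (lebesgue_on J)) = 1"
        by (simp add: J_def emeasure_restrict_space)
      then show "(\<integral>\<^sup>+ t. ennreal (R powr q) \<partial>lebesgue_on J) < \<infinity>" by simp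
      show "AE t in lebesgue_on J. (\<lambda>N. ennreal (cmod (T N t) powr q)) \<longlonglongrightarrow> ennreal (cmod (h t) powr q)"
        using AE_lebesgue_on_J_less_half
      proof eventually_elim
        case (elim t)
        then show ?case
          using q conv by (intro tendsto_ennrealI tendsto_powr' tendsto_norm tendsto_const) auto
      qed
    qed (auto intro!: borel_imp_lebesgue_on_J)
    moreover have "(\<integral>\<^sup>+ t. ennreal (cmod (h t) powr q) \<partial>lebesgue_on J) < ennreal ((X + \<epsilon>) powr q)"
    proof -
      have "(\<integral>\<^sup>+ t. ennreal (cmod (h t) powr q) \<partial>lebesgue_on J) \<le> ennreal (X powr q)"
        using X(2) iff[OF X(1), of "lebesgue_on J" h] by simp
      also have "\<dots> < ennreal ((X + \<epsilon>) powr q)"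
        using X \<epsilon> q by (intro ennreal_lessI powr_less_mono2) auto
      finally show ?thesis .
    qed
    ultimately have "\<forall>\<^sub>F N in sequentially. (\<integral>\<^sup>+ t. ennreal (cmod (T N t) powr q) \<partial>lebesgue_on J) < ennreal ((X + \<epsilon>) powr q)"
      by (rule order_tendstoD(2))
    then show ?thesis
    proof eventually_elim
      case (elim N)
      then show ?case
        using X(1) \<epsilon> iff[of "X + \<epsilon>" "lebesgue_on J" "T N"] by (simp add: T_def del: ennreal_plus)
    qed
  qed
qed

text \<open>
Apply the torus estimate to partial sums of the Fourier series of the localised functions. Their norms
are eventually at most \<open>X + \<epsilon>\<close> and \<open>Y + \<epsilon>\<close>, Fatou's lemma passes to the limit in the partial sums, and then
\<open>\<epsilon> \<rightarrow> 0\<close>. The norms of \<open>f\<close> and \<open>g\<close> are taken over the unit interval around \<open>u\<close>; the operator is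
controlled on an interval of nearly half that length.
\<close>

lemma local_estimate:
  fixes S :: "real \<times> real \<Rightarrow> complex"
  assumes bound: "bilin_bound_T p1 p2 p3 \<phi> C" and p12: "1 \<le> p1" "1 \<le> p2" and p3: "0 < p3"
    and p: "p = enn2real (min 1 p3)"
    and S: "integrable lborel S" and supp: "\<And>z. z \<notin> half_J \<times> half_J \<Longrightarrow> S z = 0"
    and a: "(\<lambda>(n, m). cmod (fourier2 S (real_of_int n, real_of_int m))) summable_on UNIV"
    and ap: "(\<lambda>(n, m). cmod (fourier2 S (real_of_int n, real_of_int m)) powr p) summable_on UNIV"
    and f: "C2_decay f" and g: "C2_decay g"
    and X: "0 \<le> X" "Lp_norm p1 (lebesgue_on J) (\<lambda>t. f (u + t)) \<le> ennreal X"
    and Y: "0 \<le> Y" "Lp_norm p2 (lebesgue_on J) (\<lambda>t. g (u + t)) \<le> ennreal Y"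
    and \<delta>: "0 < \<delta>"
  shows "Lp_norm p3 (lebesgue_on J) (\<lambda>x. indicator {-(1/4 - \<delta>)..1/4 - \<delta>} x * bilin_R (extended_symbol \<phi> S) f g (u + x))
    \<le> ennreal ((\<Sum>\<^sub>\<infinity>(n, m)\<in>UNIV. cmod (fourier2 S (real_of_int n, real_of_int m)) powr p) powr (1 / p) * (C * X * Y))"
proof -
  define A where "A = (\<lambda>(n, m). fourier2 S (real_of_int n, real_of_int m))"
  define c where "c = (\<Sum>\<^sub>\<infinity>z. cmod (A z) powr p) powr (1 / p)"
  have ap': "(\<lambda>z. cmod (A z) powr p) summable_on UNIV" using ap by (simp add: A_def case_prod_unfold)
  have C: "0 \<le> C" using bound by (simp add: bilin_bound_T_def)
  have p0: "0 < p"
  proof -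
    have "min 1 p3 \<le> 1" by simp
    then have "min 1 p3 < top" using le_less_trans ennreal_one_less_top by blast
    then show ?thesis using p p3 by (simp add: enn2real_positive_iff)
  qed
  have \<phi>b: "cmod (\<phi> z) \<le> C" for z
  proof -
    have "0 < p1" "0 < p2"
      by (rule less_le_trans[OF zero_less_one p12(1)], rule less_le_trans[OF zero_less_one p12(2)])
    then show ?thesis using bilin_bound_T_imp_bounded[OF bound _ _ p3, of "fst z" "snd z"] by simp
  qed
  obtain \<kappa> :: "real \<Rightarrow> real" where \<kappa>: "C2 \<kappa>" "\<And>t. 0 \<le> \<kappa> t" "\<And>t. \<kappa> t \<le> 1"
    "\<And>t. \<bar>t\<bar> \<le> 1/2 - \<delta> \<Longrightarrow> \<kappa> t = 1" "\<And>t. 1/2 \<le> \<bar>t\<bar> \<Longrightarrow> \<kappa> t = 0"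
    by (rule smooth_cutoff[OF \<delta>], rule that)
  define cut where "cut = (\<lambda>f t. complex_of_real (\<kappa> t) * f (u + t))"
  have cut: "C2_decay (cut f)" "\<And>t. 1/2 \<le> \<bar>t\<bar> \<Longrightarrow> cut f t = 0" "\<And>t. \<bar>t\<bar> \<le> 1/2 - \<delta> \<Longrightarrow> cut f t = f (u + t)"
    if "C2_decay f" for f
  proof -
    show z: "cut f t = 0" if "1/2 \<le> \<bar>t\<bar>" for t using \<kappa>(5)[OF that] by (simp add: cut_def)
    show "C2_decay (cut f)"
      by (rule C2_compact_support_decay[OF _ z], unfold cut_def,
          rule C2_mult[OF C2_of_real[OF \<kappa>(1)] C2_shift[OF C2_decay_imp_C2[OF that]]])
    show "cut f t = f (u + t)" if "\<bar>t\<bar> \<le> 1/2 - \<delta>" for t using \<kappa>(4)[OF that] by (simp add: cut_def)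
  qed
  have cut_norm: "Lp_norm q (lebesgue_on J) (cut f) \<le> Lp_norm q (lebesgue_on J) (\<lambda>t. f (u + t))"
    if "C2_decay f" "1 \<le> q" for f q
  proof (rule Lp_norm_mono)
    show "cut f \<in> borel_measurable (lebesgue_on J)"
      by (rule borel_imp_lebesgue_on_J[OF C2_decay_measurable[OF cut(1)[OF that(1)]]])
    show "0 < q" using that(2) by (auto intro: less_le_trans[of 0 1])
    show "cmod (cut f t) \<le> cmod (f (u + t))" for t
      using \<kappa>(2,3) by (simp add: cut_def norm_mult mult_left_le_one_le)
  qed
  define D where "D = (\<lambda>N x. \<Sum>(p, q)\<in>{- int N..int N} \<times> {- int N..int N}. A (p, q) *
      (\<Sum>n\<in>{- int N..int N}. \<Sum>m\<in>{- int N..int N}. fourier (cut f) (of_int n) * fourier (cut g) (of_int m) *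
         \<phi> (n - p, m - q) * echar (of_int (n + m) * x)))"
  define I where "I = {-(1/4 - \<delta>)..1/4 - \<delta>}"
  have [measurable]: "I \<in> sets borel" by (simp add: I_def)
  have [measurable]: "D N \<in> borel_measurable borel" for N
    unfolding D_def case_prod_unfold by measurable
  obtain P where P: "\<And>z. cmod (extended_symbol \<phi> S z) \<le> P" "extended_symbol \<phi> S \<in> borel_measurable borel"
    by (rule extended_symbol_bounded[where \<phi> = \<phi> and M = C, OF S supp a \<phi>b]) (assumption, rule that)
  have [measurable]: "bilin_R (extended_symbol \<phi> S) f g \<in> borel_measurable borel"
    by (rule bilin_R_eq_lborel(2)[OF f g P(2,1)])
  have est: "Lp_norm p3 (lebesgue_on J) (\<lambda>x. indicator I x * bilin_R (extended_symbol \<phi> S) f g (u + x))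
      \<le> ennreal (c * (C * (X + \<epsilon>) * (Y + \<epsilon>)))" if \<epsilon>: "0 < \<epsilon>" for \<epsilon>
  proof (rule Lp_norm_fatou[OF p3])
    show "(\<lambda>x. indicator I x * D N x) \<in> borel_measurable (lebesgue_on J)" for N
      by (rule borel_imp_lebesgue_on_J) measurable
    show "(\<lambda>x. indicator I x * bilin_R (extended_symbol \<phi> S) f g (u + x)) \<in> borel_measurable (lebesgue_on J)"
      by (rule borel_imp_lebesgue_on_J) measurable
    show "(\<lambda>N. indicator I x * D N x) \<longlonglongrightarrow> indicator I x * bilin_R (extended_symbol \<phi> S) f g (u + x)" for x
    proof (cases "x \<in> I")
      case True
      then have x: "\<bar>x\<bar> \<le> 1/4 - \<delta>" by (auto simp: I_def)
      have "(\<lambda>N. D N x) \<longlonglongrightarrow> bilin_R (extended_symbol \<phi> S) f g (u + x)"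
        unfolding D_def A_def prod.case
        by (rule bilin_R_local_limit[where \<phi> = \<phi>, OF S supp a \<phi>b f g cut[OF f] cut[OF g] \<delta> x])
      then show ?thesis using True by simp
    qed simp
    show "0 \<le> c * (C * (X + \<epsilon>) * (Y + \<epsilon>))" using C X(1) Y(1) \<epsilon> by (simp add: c_def)
    have "\<forall>\<^sub>F N in sequentially. Lp_norm p1 (lebesgue_on J) (trig {- int N..int N} (\<lambda>n. fourier (cut f) (of_int n))) \<le> ennreal (X + \<epsilon>)"
      by (rule trig_partial_sum_norm[OF cut(1,2)[OF f] p12(1) X(1) order_trans[OF cut_norm[OF f p12(1)] X(2)] \<epsilon>])
    moreover have "\<forall>\<^sub>F N in sequentially. Lp_norm p2 (lebesgue_on J) (trig {- int N..int N} (\<lambda>n. fourier (cut g) (of_int n))) \<le> ennreal (Y + \<epsilon>)"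
      by (rule trig_partial_sum_norm[OF cut(1,2)[OF g] p12(2) Y(1) order_trans[OF cut_norm[OF g p12(2)] Y(2)] \<epsilon>])
    ultimately show "\<forall>\<^sub>F N in sequentially. Lp_norm p3 (lebesgue_on J) (\<lambda>x. indicator I x * D N x) \<le> ennreal (c * (C * (X + \<epsilon>) * (Y + \<epsilon>)))"
    proof eventually_elim
      case (elim N)
      have "Lp_norm p3 (lebesgue_on J) (\<lambda>x. indicator I x * D N x) \<le> Lp_norm p3 (lebesgue_on J) (D N)"
        by (rule Lp_norm_mono[OF _ p3]) (auto intro!: borel_imp_lebesgue_on_J simp: indicator_def)
      also have "\<dots> \<le> ennreal ((\<Sum>z\<in>{- int N..int N} \<times> {- int N..int N}. cmod (A z) powr p) powr (1 / p) * (C * (X + \<epsilon>) * (Y + \<epsilon>)))"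
        unfolding D_def
        by (rule torus_estimate[OF bound p3 p _ _ _ _ elim(1) _ elim(2)]) (use X(1) Y(1) \<epsilon> in auto)
      also have "\<dots> \<le> ennreal (c * (C * (X + \<epsilon>) * (Y + \<epsilon>)))"
        unfolding c_def
        using C X(1) Y(1) \<epsilon> p0
        by (intro ennreal_leI mult_right_mono powr_mono2 finite_sum_le_infsum[OF ap'])
           (auto intro!: sum_nonneg mult_nonneg_nonneg)
      finally show ?case .
    qed
  qed
  have "(\<lambda>k. ennreal (c * (C * (X + 1 / real (Suc k)) * (Y + 1 / real (Suc k))))) \<longlonglongrightarrow> ennreal (c * (C * X * Y))"
    by (intro tendsto_ennrealI) real_asymp
  then have "Lp_norm p3 (lebesgue_on J) (\<lambda>x. indicator I x * bilin_R (extended_symbol \<phi> S) f g (u + x)) \<le> ennreal (c * (C * X * Y))"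
    by (rule LIMSEQ_le_const) (use est in auto)
  then show ?thesis by (simp add: c_def A_def I_def case_prod_unfold)
qed


section \<open>Averaging the local estimate\<close>

text \<open>
Every point of the line is seen with the same total weight when a window \<open>A\<close> is moved along it.
\<close>

lemma nn_integral_average_translates:
  fixes G :: "real \<Rightarrow> ennreal"
  assumes [measurable]: "G \<in> borel_measurable borel" "A \<in> sets borel"
  shows "(\<integral>\<^sup>+ u. \<integral>\<^sup>+ x. G (u + x) * indicator A x \<partial>lborel \<partial>lborel) =
    emeasure lborel A * (\<integral>\<^sup>+ x. G x \<partial>lborel)"
proof -
  have "(\<integral>\<^sup>+ u. \<integral>\<^sup>+ x. G (u + x) * indicator A x \<partial>lborel \<partial>lborel) =
      (\<integral>\<^sup>+ x. \<integral>\<^sup>+ u. G (u + x) * indicator A x \<partial>lborel \<partial>lborel)"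
    by (rule lborel_pair.Fubini') measurable
  also have "\<dots> = (\<integral>\<^sup>+ x. (\<integral>\<^sup>+ y. G y \<partial>lborel) * indicator A x \<partial>lborel)"
  proof (rule nn_integral_cong)
    fix x :: real
    have "(\<integral>\<^sup>+ u. G (u + x) \<partial>lborel) = (\<integral>\<^sup>+ y. G y \<partial>lborel)"
      using nn_integral_real_affine[of G 1 x] by (simp add: add.commute)
    then show "(\<integral>\<^sup>+ u. G (u + x) * indicator A x \<partial>lborel) = (\<integral>\<^sup>+ y. G y \<partial>lborel) * indicator A x"
      by (simp add: nn_integral_multc)
  qed
  also have "\<dots> = (\<integral>\<^sup>+ y. G y \<partial>lborel) * emeasure lborel A"
    by (rule nn_integral_cmult_indicator) simp
  finally show ?thesis by (simp only: mult.commute)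
qed

lemma Lp_norm_translate_le:
  assumes [measurable]: "f \<in> borel_measurable borel" and p: "0 < p"
  shows "Lp_norm p (lebesgue_on J) (\<lambda>t. f (u + t)) \<le> Lp_norm p lebesgue f"
proof (cases "Lp_norm p lebesgue f")
  case (real B)
  have fm: "f \<in> borel_measurable lebesgue" by (simp add: measurable_completion)
  have fu: "(\<lambda>t. f (u + t)) \<in> borel_measurable (lebesgue_on J)"
    by (rule borel_imp_lebesgue_on_J) measurable
  show ?thesis
  proof (cases "p = \<infinity>")
    case True
    have "AE y in lebesgue. cmod (f y) \<le> B"
      using Lp_norm_infinity_le_iff[OF fm real(1)] real True by simp
    then have "AE y in lborel. cmod (f y) \<le> B" by (simp add: AE_completion_iff)
    then have "AE t in lborel. cmod (f (u + 1 * t)) \<le> B"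
      by (rule AE_borel_affine[rotated 2]) auto
    then have "AE t in lebesgue. cmod (f (u + t)) \<le> B" by (simp add: AE_completion)
    then have "AE t in lebesgue_on J. cmod (f (u + t)) \<le> B"
      by (subst AE_restrict_space_iff) (auto simp: J_def)
    then show ?thesis
      using Lp_norm_infinity_le_iff[OF fu real(1)] real True by simp
  next
    case False
    define q where "q = enn2real p"
    have q: "0 < q" using False p by (simp add: q_def enn2real_positive_iff less_top)
    note iff = Lp_norm_le_iff[OF False q[unfolded q_def] real(1), folded q_def]
    have "(\<integral>\<^sup>+ t. ennreal (cmod (f (u + t)) powr q) \<partial>lebesgue_on J) \<le> (\<integral>\<^sup>+ t. ennreal (cmod (f (u + t)) powr q) \<partial>lborel)"
      unfolding nn_integral_lebesgue_on_J by (intro nn_integral_mono) (simp add: indicator_def)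
    also have "\<dots> = (\<integral>\<^sup>+ t. ennreal (cmod (f t) powr q) \<partial>lborel)"
      using nn_integral_real_affine[of "\<lambda>t. ennreal (cmod (f t) powr q)" 1 u] by simp
    also have "\<dots> \<le> ennreal (B powr q)"
      using iff[of lebesgue f] real by (simp add: nn_integral_completion)
    finally show ?thesis using iff[of "lebesgue_on J" "\<lambda>t. f (u + t)"] real by simp
  qed
qed simp

lemma C2_decay_Lp_norm_finite:
  assumes f: "C2_decay f" and p: "1 \<le> p"
  obtains N where "0 \<le> N" "Lp_norm p lebesgue f = ennreal N"
proof -
  have [measurable]: "f \<in> borel_measurable borel" using C2_decay_measurable[OF f] .
  obtain K where K: "\<And>x. cmod (f x) \<le> K" using C2_decay_bounded[OF f] by blast
  have K0: "0 \<le> K" using order_trans[OF norm_ge_zero K[of 0]] .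
  have "Lp_norm p lebesgue f < \<infinity>"
  proof (cases "p = \<infinity>")
    case True
    have "Lp_norm p lebesgue f \<le> ennreal K"
      using Lp_norm_infinity_le_iff[of f lebesgue K] K K0 True by (simp add: measurable_completion)
    then show ?thesis by (rule le_less_trans) simp
  next
    case False
    define q where "q = enn2real p"
    have q: "1 \<le> q" using False p enn2real_mono[of 1 p] by (simp add: q_def less_top)
    have "(\<integral>\<^sup>+ x. ennreal (cmod (f x) powr q) \<partial>lebesgue) \<le> (\<integral>\<^sup>+ x. ennreal (K powr (q - 1)) * ennreal (cmod (f x)) \<partial>lborel)"
      unfolding nn_integral_completion
    proof (rule nn_integral_mono)
      fix x
      have "cmod (f x) powr q = cmod (f x) powr (q - 1) * cmod (f x)"
        using q by (cases "f x = 0") (auto simp: powr_diff)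
      also have "\<dots> \<le> K powr (q - 1) * cmod (f x)"
        using q K by (intro mult_right_mono powr_mono2) auto
      finally show "ennreal (cmod (f x) powr q) \<le> ennreal (K powr (q - 1)) * ennreal (cmod (f x))"
        by (simp add: ennreal_mult[symmetric])
    qed
    also have "\<dots> < \<infinity>"
      using C2_decay_integrable[OF f]
      by (simp add: nn_integral_cmult ennreal_mult_less_top integrable_iff_bounded)
    finally show ?thesis
      using False by (simp add: Lp_norm_def ennreal_pow_def q_def)
  qed
  then show ?thesis using that by (cases "Lp_norm p lebesgue f") auto
qed

text \<open>
The local norms of \<open>f\<close> are written as \<open>N \<alpha>(u)^(1/p)\<close> with a profile \<open>\<alpha>\<close> of total mass at most \<open>1\<close>: it is the
normalised mass of \<open>\<bar>f\<bar>^p\<close> in the unit window around \<open>u\<close>. For \<open>p = \<infinity>\<close> the exponent \<open>1/p\<close> is \<open>0\<close> and the constant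
profile \<open>1\<close> serves; its weight \<open>\<theta>\<close> in Hoelder's inequality is \<open>0\<close> then, which is why the mass is stated with
the factor \<open>\<theta>\<close>.
\<close>

lemma local_norm_profile:
  assumes [measurable]: "f \<in> borel_measurable borel" and p: "1 \<le> p" and N: "0 < N"
    and le: "Lp_norm p lebesgue f \<le> ennreal N"
  obtains \<alpha> :: "real \<Rightarrow> real" where "\<alpha> \<in> borel_measurable borel" "\<And>u. 0 \<le> \<alpha> u"
    "\<And>u. Lp_norm p (lebesgue_on J) (\<lambda>t. f (u + t)) \<le> ennreal (N * \<alpha> u powr enn2real (1 / p))"
    "\<And>\<theta>. 0 \<le> \<theta> \<Longrightarrow> (p = \<infinity> \<Longrightarrow> \<theta> = 0) \<Longrightarrow> (\<integral>\<^sup>+ u. ennreal (\<theta> * \<alpha> u) \<partial>lborel) \<le> ennreal \<theta>"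
proof (cases "p = \<infinity>")
  case True
  show ?thesis
  proof
    show "Lp_norm p (lebesgue_on J) (\<lambda>t. f (u + t)) \<le> ennreal (N * 1 powr enn2real (1 / p))" for u
      using order_trans[OF Lp_norm_translate_le le, of u] True by simp
  qed (use True in auto)
next
  case False
  define q where "q = enn2real p"
  have q: "1 \<le> q" using False p enn2real_mono[of 1 p] by (simp add: q_def less_top)
  then have q0: "0 < q" by simp
  have pq: "p = ennreal q" using False by (simp add: q_def less_top)
  have inv: "enn2real (1 / p) = 1 / q"
    unfolding pq using q0 by (subst divide_ennreal[of 1 q, simplified]) (auto simp flip: ennreal_1)
  note iff = Lp_norm_le_iff[OF False q0[unfolded q_def], folded q_def]
  define A where "A = (\<lambda>u. \<integral>\<^sup>+ t. ennreal (cmod (f (u + t)) powr q) * indicator J t \<partial>lborel)"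
  have [measurable]: "A \<in> borel_measurable borel" unfolding A_def by measurable
  have tot: "(\<integral>\<^sup>+ t. ennreal (cmod (f t) powr q) \<partial>lborel) \<le> ennreal (N powr q)"
    using iff[of N lebesgue f] N le by (simp add: nn_integral_completion)
  have Ale: "A u \<le> ennreal (N powr q)" for u
  proof -
    have "A u \<le> (\<integral>\<^sup>+ t. ennreal (cmod (f (u + t)) powr q) \<partial>lborel)"
      unfolding A_def by (intro nn_integral_mono) (simp add: indicator_def)
    also have "\<dots> = (\<integral>\<^sup>+ t. ennreal (cmod (f t) powr q) \<partial>lborel)"
      using nn_integral_real_affine[of "\<lambda>t. ennreal (cmod (f t) powr q)" 1 u] by simp
    finally show ?thesis using tot by simp
  qed
  have Afin: "A u = ennreal (enn2real (A u))" for u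
    using le_less_trans[OF Ale[of u], of \<infinity>] by simp
  define \<alpha> where "\<alpha> = (\<lambda>u. enn2real (A u) / N powr q)"
  have Np: "0 < N powr q" using N by simp
  show ?thesis
  proof
    show "\<alpha> \<in> borel_measurable borel" unfolding \<alpha>_def by measurable
    show \<alpha>0: "0 \<le> \<alpha> u" for u by (simp add: \<alpha>_def)
    show "Lp_norm p (lebesgue_on J) (\<lambda>t. f (u + t)) \<le> ennreal (N * \<alpha> u powr enn2real (1 / p))" for u
    proof -
      have "(N * \<alpha> u powr (1 / q)) powr q = N powr q * \<alpha> u"
        using N \<alpha>0[of u] q0 by (simp add: powr_mult powr_powr)
      also have "\<dots> = enn2real (A u)" using Np by (simp add: \<alpha>_def)
      finally have "(N * \<alpha> u powr (1 / q)) powr q = enn2real (A u)" .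
      then have "(\<integral>\<^sup>+ t. ennreal (cmod (f (u + t)) powr q) \<partial>lebesgue_on J) \<le> ennreal ((N * \<alpha> u powr (1 / q)) powr q)"
        unfolding nn_integral_lebesgue_on_J using Afin[of u] by (simp add: A_def)
      then show ?thesis unfolding inv using N by (subst iff) auto
    qed
    show "(\<integral>\<^sup>+ u. ennreal (\<theta> * \<alpha> u) \<partial>lborel) \<le> ennreal \<theta>" if "0 \<le> \<theta>" for \<theta>
    proof -
      have "(\<integral>\<^sup>+ u. ennreal (\<theta> * \<alpha> u) \<partial>lborel) = (\<integral>\<^sup>+ u. ennreal (\<theta> / N powr q) * A u \<partial>lborel)"
      proof (rule nn_integral_cong)
        fix u
        have "ennreal (\<theta> * \<alpha> u) = ennreal (\<theta> / N powr q) * ennreal (enn2real (A u))"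
          using that Np by (simp add: \<alpha>_def ennreal_mult[symmetric])
        then show "ennreal (\<theta> * \<alpha> u) = ennreal (\<theta> / N powr q) * A u"
          by (simp only: Afin[symmetric])
      qed
      also have "\<dots> = ennreal (\<theta> / N powr q) * (\<integral>\<^sup>+ u. A u \<partial>lborel)"
        by (simp add: nn_integral_cmult)
      also have "(\<integral>\<^sup>+ u. A u \<partial>lborel) = (\<integral>\<^sup>+ t. ennreal (cmod (f t) powr q) \<partial>lborel)"
        unfolding A_def
        using nn_integral_average_translates[of "\<lambda>t. ennreal (cmod (f t) powr q)" J] by (simp add: J_def)
      also have "ennreal (\<theta> / N powr q) * (\<integral>\<^sup>+ t. ennreal (cmod (f t) powr q) \<partial>lborel) \<le> ennreal (\<theta> / N powr q) * ennreal (N powr q)"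
        by (intro mult_left_mono tot) simp
      also have "\<dots> = ennreal \<theta>" using that Np by (simp add: ennreal_mult[symmetric])
      finally show ?thesis .
    qed
  qed
qed

text \<open>
A summable family is bounded, and \<open>\<bar>a\<bar> = \<bar>a\<bar>^p (\<bar>a\<bar>^p)^((1 - p)/p)\<close>.
\<close>

lemma summable_of_summable_powr:
  fixes a :: "'i \<Rightarrow> complex"
  assumes p: "0 < p" "p \<le> 1" and sm: "(\<lambda>z. cmod (a z) powr p) summable_on UNIV"
  shows "(\<lambda>z. cmod (a z)) summable_on UNIV"
proof -
  define T where "T = (\<Sum>\<^sub>\<infinity>z. cmod (a z) powr p)"
  have le: "cmod (a z) powr p \<le> T" for z
    using finite_sum_le_infsum[OF sm, of "{z}"] by (simp add: T_def)
  have "cmod (a z) \<le> T powr ((1 - p) / p) * cmod (a z) powr p" for z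
  proof -
    have "cmod (a z) = (cmod (a z) powr p) powr ((1 - p) / p) * cmod (a z) powr p"
      using p by (cases "a z = 0") (auto simp: powr_powr simp flip: powr_add)
    also have "\<dots> \<le> T powr ((1 - p) / p) * cmod (a z) powr p"
      using p le by (intro mult_right_mono powr_mono2) auto
    finally show ?thesis .
  qed
  then show ?thesis
    by (intro summable_on_comparison_test[OF summable_on_cmult_right[OF sm]]) auto
qed

lemma Hoelder_related_pos:
  assumes "Hoelder_related p1 p2 p3"
  shows "0 < p1" "0 < p2" "0 < p3"
proof -
  have "(0::ennreal) < 1 / 2" by (simp add: ennreal_zero_less_divide)
  then show "0 < p1" "0 < p2" "0 < p3"
    using assms less_le_trans[OF zero_less_one] less_le_trans by (auto simp: Hoelder_related_def)
qed

lemma Hoelder_related_reciprocals: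
  assumes "Hoelder_related p1 p2 p3" and "p3 \<noteq> \<infinity>"
  shows "enn2real p3 * enn2real (1 / p1) + enn2real p3 * enn2real (1 / p2) = 1"
    and "0 < enn2real p3"
proof -
  have h: "1 \<le> p1" "1 \<le> p2" "1 / 2 \<le> p3" "1 / p1 + 1 / p2 = 1 / p3"
    using assms by (auto simp: Hoelder_related_def)
  show q: "0 < enn2real p3" using Hoelder_related_pos(3)[OF assms(1)] assms(2) by (simp add: enn2real_positive_iff less_top)
  have fin: "1 / p < \<infinity>" if "1 \<le> p" for p :: ennreal
  proof -
    have "p \<noteq> 0" using that by auto
    then show ?thesis by (simp add: ennreal_divide_eq_top_iff less_top[symmetric])
  qed
  have "enn2real (1 / p1) + enn2real (1 / p2) = enn2real (1 / p3)"
    using enn2real_plus[of "1 / p1" "1 / p2"] fin h by simp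
  also have "\<dots> = 1 / enn2real p3"
  proof -
    have "p3 = ennreal (enn2real p3)" using assms(2) by (simp add: less_top)
    then have "1 / p3 = ennreal (1 / enn2real p3)"
      using divide_ennreal[of 1 "enn2real p3"] q by simp
    then show ?thesis by simp
  qed
  finally show "enn2real p3 * enn2real (1 / p1) + enn2real p3 * enn2real (1 / p2) = 1"
    using q by (simp add: field_simps)
qed

text \<open>
Let \<open>q = p3 < \<infinity>\<close>, and let \<open>F\<close> and \<open>G\<close> be the global norms of \<open>f\<close> and \<open>g\<close>. By the local estimate, the integral of
\<open>\<bar>b\<bar>^q\<close> over the window of length \<open>1/2 - 2 \<delta>\<close> at \<open>u\<close> is at most \<open>(c0 C F G)^q \<alpha>(u)^\<theta>1 \<beta>(u)^\<theta>2\<close>, where \<open>\<alpha>\<close>, \<open>\<beta>\<close>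
are the profiles of \<open>f\<close> and \<open>g\<close>, and \<open>\<theta>1 = q/p1\<close> and \<open>\<theta>2 = q/p2\<close> add up to \<open>1\<close>. The product of the profiles is at most
\<open>\<theta>1 \<alpha>(u) + \<theta>2 \<beta>(u)\<close>, which has integral at most \<open>1\<close> over all centres \<open>u\<close>, while the windows average to
\<open>1/2 - 2 \<delta>\<close> times the integral of \<open>\<bar>b\<bar>^q\<close>. Letting \<open>\<delta> \<rightarrow> 0\<close> costs the factor \<open>2\<close>. If \<open>p3 = \<infinity>\<close>, all windows
give the same bound and cover the line.
\<close>

lemma bilin_bound_R_extended_symbol:
  fixes S :: "real \<times> real \<Rightarrow> complex"
  assumes hoelder: "Hoelder_related p1 p2 p3" and bound: "bilin_bound_T p1 p2 p3 \<phi> C"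
    and p: "p = enn2real (min 1 p3)"
    and S: "integrable lborel S" and supp: "\<And>z. z \<notin> half_J \<times> half_J \<Longrightarrow> S z = 0"
    and a: "(\<lambda>(n, m). cmod (fourier2 S (real_of_int n, real_of_int m))) summable_on UNIV"
    and ap: "(\<lambda>(n, m). cmod (fourier2 S (real_of_int n, real_of_int m)) powr p) summable_on UNIV"
    and c: "c = 2 powr (1 / p) * (\<Sum>\<^sub>\<infinity>(n, m)\<in>UNIV. cmod (fourier2 S (real_of_int n, real_of_int m)) powr p) powr (1 / p)"
  shows "bilin_bound_R p1 p2 p3 (extended_symbol \<phi> S) (c * C)"
  unfolding bilin_bound_R_def
proof (intro conjI ballI)
  have p12: "1 \<le> p1" "1 \<le> p2" using hoelder by (auto simp: Hoelder_related_def)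
  note p12' = Hoelder_related_pos(1,2)[OF hoelder] and p3 = Hoelder_related_pos(3)[OF hoelder]
  have C: "0 \<le> C" using bound by (simp add: bilin_bound_T_def)
  define c0 where "c0 = (\<Sum>\<^sub>\<infinity>(n, m)\<in>UNIV. cmod (fourier2 S (real_of_int n, real_of_int m)) powr p) powr (1 / p)"
  have c0: "0 \<le> c0" and cc0: "c = 2 powr (1 / p) * c0" by (simp_all add: c0_def c)
  show "0 \<le> c * C" using C c0 cc0 by simp
  fix f g assume "f \<in> schwartz" "g \<in> schwartz"
  then have f: "C2_decay f" and g: "C2_decay g" by (auto intro: schwartz_C2_decay)
  have [measurable]: "f \<in> borel_measurable borel" "g \<in> borel_measurable borel"
    using C2_decay_measurable f g by auto
  obtain F where F: "0 \<le> F" "Lp_norm p1 lebesgue f = ennreal F"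
    using C2_decay_Lp_norm_finite[OF f p12(1)] by blast
  obtain G where G: "0 \<le> G" "Lp_norm p2 lebesgue g = ennreal G"
    using C2_decay_Lp_norm_finite[OF g p12(2)] by blast
  have \<phi>b: "cmod (\<phi> z) \<le> C" for z
    using bilin_bound_T_imp_bounded[OF bound p12' p3, of "fst z" "snd z"] by simp
  define b where "b = bilin_R (extended_symbol \<phi> S) f g"
  obtain P where P: "\<And>z. cmod (extended_symbol \<phi> S z) \<le> P" "extended_symbol \<phi> S \<in> borel_measurable borel"
    by (rule extended_symbol_bounded[where \<phi> = \<phi> and M = C, OF S supp a \<phi>b]) (assumption, rule that)
  have [measurable]: "b \<in> borel_measurable borel"
    unfolding b_def by (rule bilin_R_eq_lborel(2)[OF f g P(2,1)])
  have bm: "b \<in> borel_measurable lebesgue" by (simp add: measurable_completion)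
  define I where "I = (\<lambda>\<delta>::real. {-(1/4 - \<delta>)..1/4 - \<delta>})"
  have [measurable]: "I \<delta> \<in> sets borel" for \<delta> by (simp add: I_def)
  have local: "Lp_norm p3 (lebesgue_on J) (\<lambda>x. indicator (I \<delta>) x * b (u + x)) \<le> ennreal (c0 * (C * X * Y))"
    if "0 \<le> X" "Lp_norm p1 (lebesgue_on J) (\<lambda>t. f (u + t)) \<le> ennreal X"
      "0 \<le> Y" "Lp_norm p2 (lebesgue_on J) (\<lambda>t. g (u + t)) \<le> ennreal Y" "0 < \<delta>" for X Y u \<delta>
    using local_estimate[OF bound p12 p3 p S supp a ap f g that] by (simp add: c0_def b_def I_def)
  have trans: "Lp_norm p1 (lebesgue_on J) (\<lambda>t. f (u + t)) \<le> ennreal F"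
    "Lp_norm p2 (lebesgue_on J) (\<lambda>t. g (u + t)) \<le> ennreal G" for u
    using Lp_norm_translate_le[of f p1 u] Lp_norm_translate_le[of g p2 u] p12' F G by auto
  have I_sub: "I \<delta> \<subseteq> J" if "0 < \<delta>" for \<delta> using that by (auto simp: I_def J_def)
  have goal: "Lp_norm p3 lebesgue b \<le> ennreal (c * C * F * G)"
  proof (cases "p3 = \<infinity>")
    case True
    define B where "B = c0 * (C * F * G)"
    have B: "0 \<le> B" using c0 C F(1) G(1) by (simp add: B_def)
    define E where "E = (\<lambda>y. indicator {y. B < cmod (b y)} y :: ennreal)"
    have [measurable]: "E \<in> borel_measurable borel" unfolding E_def by measurable
    \<comment> \<open>\<open>E\<close> marks the points where the bound fails; any \<open>\<delta>\<close> strictly between \<open>0\<close> and \<open>1/4\<close> serves here, since each window then has positive length.\<close>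
    have "(\<integral>\<^sup>+ x. E (u + x) * indicator (I (1/8)) x \<partial>lborel) = 0" for u
    proof -
      have m: "(\<lambda>x. indicator (I (1/8)) x * b (u + x)) \<in> borel_measurable (lebesgue_on J)"
        by (rule borel_imp_lebesgue_on_J) measurable
      have "Lp_norm \<infinity> (lebesgue_on J) (\<lambda>x. indicator (I (1/8)) x * b (u + x)) \<le> ennreal B"
        using local[OF F(1) trans(1) G(1) trans(2), of "1/8" u] True by (simp add: B_def)
      then have "AE x in lebesgue_on J. cmod (indicator (I (1/8)) x * b (u + x)) \<le> B"
        using Lp_norm_infinity_le_iff[OF m B] by simp
      then have "AE x in lebesgue. x \<in> J \<longrightarrow> cmod (indicator (I (1/8)) x * b (u + x)) \<le> B"
        by (subst (asm) AE_restrict_space_iff) (auto simp: J_def)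
      then have "AE x in lborel. x \<in> J \<longrightarrow> cmod (indicator (I (1/8)) x * b (u + x)) \<le> B"
        by (simp add: AE_completion_iff)
      then have "AE x in lborel. E (u + x) * indicator (I (1/8)) x = 0"
        by eventually_elim (use I_sub[of "1/8"] in \<open>auto simp: E_def indicator_def split: if_splits\<close>)
      then show ?thesis by (subst nn_integral_0_iff_AE) auto
    qed
    then have "emeasure lborel (I (1/8)) * (\<integral>\<^sup>+ y. E y \<partial>lborel) = 0"
      using nn_integral_average_translates[of E "I (1/8)"] by simp
    moreover have "emeasure lborel (I (1/8)) = ennreal (1/4)" by (simp add: I_def)
    ultimately have "(\<integral>\<^sup>+ y. E y \<partial>lborel) = 0" by simp
    then have "AE y in lborel. E y = 0" by (subst (asm) nn_integral_0_iff_AE) auto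
    then have "AE y in lborel. cmod (b y) \<le> B"
      by eventually_elim (auto simp: E_def indicator_def split: if_splits)
    then have "AE y in lebesgue. cmod (b y) \<le> B" by (rule AE_completion)
    then have "Lp_norm p3 lebesgue b \<le> ennreal B"
      using Lp_norm_infinity_le_iff[OF bm B] True by simp
    also have "\<dots> \<le> ennreal (c * C * F * G)"
    proof (rule ennreal_leI)
      have "1 * B \<le> 2 powr (1 / p) * B"
        using B p by (intro mult_right_mono) (auto simp: ge_one_powr_ge_zero)
      then show "B \<le> c * C * F * G" by (simp add: B_def cc0 mult_ac)
    qed
    finally show ?thesis .
  next
    case False
    define q where "q = enn2real p3"
    have q: "0 < q" and recip: "q * enn2real (1 / p1) + q * enn2real (1 / p2) = 1"
      using Hoelder_related_reciprocals[OF hoelder False] by (auto simp: q_def)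
    define B where "B = c0 * (C * F * G)"
    have B: "0 \<le> B" using c0 C F(1) G(1) by (simp add: B_def)
    note iff = Lp_norm_le_iff[OF False q[unfolded q_def], folded q_def]
    define E where "E = (\<lambda>y. ennreal (cmod (b y) powr q))"
    have [measurable]: "E \<in> borel_measurable borel" unfolding E_def by measurable
    have loc: "(\<integral>\<^sup>+ x. E (u + x) * indicator (I \<delta>) x \<partial>lborel) \<le> ennreal ((c0 * (C * X * Y)) powr q)"
      if X: "0 \<le> X" "Lp_norm p1 (lebesgue_on J) (\<lambda>t. f (u + t)) \<le> ennreal X"
      and Y: "0 \<le> Y" "Lp_norm p2 (lebesgue_on J) (\<lambda>t. g (u + t)) \<le> ennreal Y" and \<delta>: "0 < \<delta>" for X Y u \<delta>
    proof -
      have "(\<integral>\<^sup>+ x. E (u + x) * indicator (I \<delta>) x \<partial>lborel) =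
          (\<integral>\<^sup>+ x. ennreal (cmod (indicator (I \<delta>) x * b (u + x)) powr q) \<partial>lebesgue_on J)"
        unfolding nn_integral_lebesgue_on_J
        by (intro nn_integral_cong) (use I_sub[OF \<delta>] q in \<open>auto simp: E_def indicator_def\<close>)
      also have "\<dots> \<le> ennreal ((c0 * (C * X * Y)) powr q)"
        using local[OF X Y \<delta>] c0 C X(1) Y(1) by (subst (asm) iff) auto
      finally show ?thesis .
    qed
    have avg: "(\<integral>\<^sup>+ u. \<integral>\<^sup>+ x. E (u + x) * indicator (I \<delta>) x \<partial>lborel \<partial>lborel) \<le> ennreal (B powr q)"
      if \<delta>: "0 < \<delta>" for \<delta>
    proof (cases "F = 0 \<or> G = 0")
      case True
      then have B0: "B = 0" by (auto simp: B_def)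
      have "(\<integral>\<^sup>+ x. E (u + x) * indicator (I \<delta>) x \<partial>lborel) = 0" for u
        using loc[OF F(1) trans(1) G(1) trans(2) \<delta>, of u, folded B_def] B0 by simp
      then show ?thesis by simp
    next
      case False
      then have FG: "0 < F" "0 < G" using F(1) G(1) by auto
      obtain \<alpha> where \<alpha>: "\<alpha> \<in> borel_measurable borel" "\<And>u. 0 \<le> \<alpha> u"
        "\<And>u. Lp_norm p1 (lebesgue_on J) (\<lambda>t. f (u + t)) \<le> ennreal (F * \<alpha> u powr enn2real (1 / p1))"
        "\<And>\<theta>. 0 \<le> \<theta> \<Longrightarrow> (p1 = \<infinity> \<Longrightarrow> \<theta> = 0) \<Longrightarrow> (\<integral>\<^sup>+ u. ennreal (\<theta> * \<alpha> u) \<partial>lborel) \<le> ennreal \<theta>"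
        by (rule local_norm_profile[of f p1 F]) (use F FG p12 in auto)
      obtain \<beta> where \<beta>: "\<beta> \<in> borel_measurable borel" "\<And>u. 0 \<le> \<beta> u"
        "\<And>u. Lp_norm p2 (lebesgue_on J) (\<lambda>t. g (u + t)) \<le> ennreal (G * \<beta> u powr enn2real (1 / p2))"
        "\<And>\<theta>. 0 \<le> \<theta> \<Longrightarrow> (p2 = \<infinity> \<Longrightarrow> \<theta> = 0) \<Longrightarrow> (\<integral>\<^sup>+ u. ennreal (\<theta> * \<beta> u) \<partial>lborel) \<le> ennreal \<theta>"
        by (rule local_norm_profile[of g p2 G]) (use G FG p12 in auto)
      have [measurable]: "\<alpha> \<in> borel_measurable borel" "\<beta> \<in> borel_measurable borel" by fact+
      define \<theta>1 where "\<theta>1 = q * enn2real (1 / p1)"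
      define \<theta>2 where "\<theta>2 = q * enn2real (1 / p2)"
      have \<theta>: "0 \<le> \<theta>1" "0 \<le> \<theta>2" "\<theta>1 + \<theta>2 = 1" using q recip by (auto simp: \<theta>1_def \<theta>2_def)
      have young: "\<alpha> u powr \<theta>1 * \<beta> u powr \<theta>2 \<le> \<theta>1 * \<alpha> u + \<theta>2 * \<beta> u" for u
      proof (cases "\<alpha> u = 0 \<or> \<beta> u = 0")
        case True
        then show ?thesis using \<theta> \<alpha>(2)[of u] \<beta>(2)[of u] by auto
      next
        case False
        then show ?thesis using \<theta> \<alpha>(2)[of u] \<beta>(2)[of u] by (intro Youngs_inequality_0) auto
      qed
      have "(\<integral>\<^sup>+ u. \<integral>\<^sup>+ x. E (u + x) * indicator (I \<delta>) x \<partial>lborel \<partial>lborel) \<le>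
          (\<integral>\<^sup>+ u. ennreal (B powr q) * (ennreal (\<theta>1 * \<alpha> u) + ennreal (\<theta>2 * \<beta> u)) \<partial>lborel)"
      proof (rule nn_integral_mono)
        fix u
        have "(\<integral>\<^sup>+ x. E (u + x) * indicator (I \<delta>) x \<partial>lborel) \<le>
            ennreal ((c0 * (C * (F * \<alpha> u powr enn2real (1 / p1)) * (G * \<beta> u powr enn2real (1 / p2)))) powr q)"
          by (rule loc[OF _ \<alpha>(3) _ \<beta>(3) \<delta>]) (use F G in auto)
        also have "(c0 * (C * (F * \<alpha> u powr enn2real (1 / p1)) * (G * \<beta> u powr enn2real (1 / p2)))) powr q =
            B powr q * (\<alpha> u powr \<theta>1 * \<beta> u powr \<theta>2)"
        proof -
          have eq: "c0 * (C * (F * \<alpha> u powr enn2real (1 / p1)) * (G * \<beta> u powr enn2real (1 / p2))) =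
              B * (\<alpha> u powr enn2real (1 / p1) * \<beta> u powr enn2real (1 / p2))"
            by (simp add: B_def mult_ac)
          show ?thesis unfolding eq using B by (simp add: powr_mult powr_powr \<theta>1_def \<theta>2_def mult.commute[of q])
        qed
        also have "ennreal (B powr q * (\<alpha> u powr \<theta>1 * \<beta> u powr \<theta>2)) \<le> ennreal (B powr q * (\<theta>1 * \<alpha> u + \<theta>2 * \<beta> u))"
          by (intro ennreal_leI mult_left_mono young) simp
        also have "\<dots> = ennreal (B powr q) * (ennreal (\<theta>1 * \<alpha> u) + ennreal (\<theta>2 * \<beta> u))"
        proof -
          have nn: "0 \<le> \<theta>1 * \<alpha> u" "0 \<le> \<theta>2 * \<beta> u" using \<theta> \<alpha>(2) \<beta>(2) by auto
          then show ?thesis unfolding ennreal_plus[OF nn, symmetric] by (intro ennreal_mult) auto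
        qed
        finally show "(\<integral>\<^sup>+ x. E (u + x) * indicator (I \<delta>) x \<partial>lborel) \<le>
            ennreal (B powr q) * (ennreal (\<theta>1 * \<alpha> u) + ennreal (\<theta>2 * \<beta> u))" .
      qed
      also have "\<dots> = ennreal (B powr q) * ((\<integral>\<^sup>+ u. ennreal (\<theta>1 * \<alpha> u) \<partial>lborel) + (\<integral>\<^sup>+ u. ennreal (\<theta>2 * \<beta> u) \<partial>lborel))"
        by (simp add: nn_integral_cmult nn_integral_add)
      also have "\<dots> \<le> ennreal (B powr q) * (ennreal \<theta>1 + ennreal \<theta>2)"
        by (intro mult_left_mono add_mono \<alpha>(4) \<beta>(4) \<theta>) (auto simp: \<theta>1_def \<theta>2_def)
      also have "\<dots> = ennreal (B powr q)"
        using \<theta> by (simp add: ennreal_plus[symmetric] del: ennreal_plus)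
      finally show ?thesis .
    qed
    have scaled: "ennreal (1/2 - 2 * \<delta>) * (\<integral>\<^sup>+ y. E y \<partial>lborel) \<le> ennreal (B powr q)" if "0 < \<delta>" "\<delta> < 1/4" for \<delta>
    proof -
      have "emeasure lborel (I \<delta>) = ennreal (1/2 - 2 * \<delta>)" using that by (simp add: I_def)
      then show ?thesis
        using avg[OF that(1)] nn_integral_average_translates[of E "I \<delta>"] by simp
    qed
    have total: "(\<integral>\<^sup>+ y. E y \<partial>lborel) \<le> ennreal (2 * B powr q)"
    proof (cases "\<integral>\<^sup>+ y. E y \<partial>lborel")
      case (real r)
      \<comment> \<open>The sequence \<open>\<delta> = 1 / (8 (k + 1))\<close> stays below \<open>1/4\<close> and tends to \<open>0\<close>.\<close>
      have "(1/2 - 2 * (1 / (8 * real (Suc k)))) * r \<le> B powr q" for k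
      proof -
        have d: "0 < 1 / (8 * real (Suc k))" "1 / (8 * real (Suc k)) < 1/4" by (auto simp: field_simps)
        then have "ennreal ((1/2 - 2 * (1 / (8 * real (Suc k)))) * r) \<le> ennreal (B powr q)"
          using scaled[OF d] real by (subst ennreal_mult) auto
        then show ?thesis by (simp add: ennreal_le_iff)
      qed
      moreover have "(\<lambda>k. (1/2 - 2 * (1 / (8 * real (Suc k)))) * r) \<longlonglongrightarrow> (1/2) * r" by real_asymp
      ultimately have "(1/2) * r \<le> B powr q" by (intro LIMSEQ_le_const2) auto
      then show ?thesis using real by (simp add: ennreal_leI)
    next
      case top
      then show ?thesis using scaled[of "1/8"] by (simp add: ennreal_mult_top top_unique)
    qed
    have "p \<le> q" "0 < p"
    proof -
      have "min 1 p3 < \<infinity>" using False by (simp add: less_top min_less_iff_disj)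
      then show "0 < p" using p p3 by (simp add: enn2real_positive_iff)
      show "p \<le> q" unfolding p q_def using False by (intro enn2real_mono) (auto simp: less_top)
    qed
    \<comment> \<open>Since \<open>p \<le> q\<close>, the factor \<open>2^(1/q)\<close> is at most \<open>2^(1/p)\<close>.\<close>
    then have "2 powr 1 \<le> (2 :: real) powr (q / p)" by (intro powr_mono) auto
    then have "2 * B powr q \<le> 2 powr (q / p) * B powr q" by (intro mult_right_mono) auto
    also have "\<dots> = (2 powr (1 / p) * B) powr q" using B by (simp add: powr_mult powr_powr)
    also have "2 powr (1 / p) * B = c * C * F * G" by (simp add: B_def cc0 mult_ac)
    finally have "(\<integral>\<^sup>+ y. E y \<partial>lebesgue) \<le> ennreal ((c * C * F * G) powr q)"
      using order_trans[OF total ennreal_leI] by (simp add: nn_integral_completion)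
    moreover have "0 \<le> c * C * F * G" using \<open>0 \<le> c * C\<close> F(1) G(1) by simp
    ultimately show ?thesis by (simp add: iff E_def)
  qed
  have "ennreal (c * C * F * G) = ennreal (c * C) * Lp_norm p1 lebesgue f * Lp_norm p2 lebesgue g"
    using \<open>0 \<le> c * C\<close> F G by (simp add: ennreal_mult)
  then show "Lp_norm p3 lebesgue (bilin_R (extended_symbol \<phi> S) f g)
      \<le> ennreal (c * C) * Lp_norm p1 lebesgue f * Lp_norm p2 lebesgue g"
    using goal by (simp add: b_def)
qed

section \<open>Lebesgue measurable kernels and the transference theorem\<close>

lemma borel_representative:
  fixes S :: "real \<times> real \<Rightarrow> complex"
  assumes S: "integrable lebesgue S" and supp: "\<And>z. z \<notin> half_J \<times> half_J \<Longrightarrow> S z = 0"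
  obtains S' where "integrable lborel S'" "\<And>z. z \<notin> half_J \<times> half_J \<Longrightarrow> S' z = 0"
    "AE z in lborel. S z = S' z"
proof -
  have Re: "(\<lambda>z. Re (S z)) \<in> borel_measurable (completion lborel)"
    and Im: "(\<lambda>z. Im (S z)) \<in> borel_measurable (completion lborel)"
    using S by auto
  obtain R where R: "R \<in> borel_measurable lborel" "AE z in lborel. Re (S z) = R z"
    using completion_ex_borel_measurable_real[OF Re] by blast
  obtain I where I: "I \<in> borel_measurable lborel" "AE z in lborel. Im (S z) = I z"
    using completion_ex_borel_measurable_real[OF Im] by blast
  have [measurable]: "R \<in> borel_measurable borel" "I \<in> borel_measurable borel" using R I by auto
  have [measurable]: "half_J \<times> half_J \<in> sets (borel :: (real \<times> real) measure)"
    unfolding borel_prod[symmetric] by (intro pair_measureI) (auto simp: half_J_def)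
  define S' where "S' = (\<lambda>z. indicat_real (half_J \<times> half_J) z *\<^sub>R (complex_of_real (R z) + \<i> * complex_of_real (I z)))"
  have [measurable]: "S' \<in> borel_measurable borel" unfolding S'_def by measurable
  have ae: "AE z in lborel. S z = S' z"
    using R(2) I(2)
  proof eventually_elim
    case (elim z)
    then have "S z = complex_of_real (R z) + \<i> * complex_of_real (I z)" by (simp add: complex_eq_iff)
    then show ?case using supp[of z] by (auto simp: S'_def indicator_def)
  qed
  have "integrable lebesgue S'"
    using S by (rule Bochner_Integration.integrable_cong_AE_imp)
       (use ae in \<open>auto intro: measurable_completion AE_completion simp: eq_commute\<close>)
  then have "integrable lborel S'" by (simp add: integrable_completion)
  moreover have "S' z = 0" if "z \<notin> half_J \<times> half_J" for z using that by (simp add: S'_def)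
  ultimately show ?thesis using ae that by blast
qed

lemma fourier2_AE_cong:
  assumes S': "S' \<in> borel_measurable borel" and ae: "AE z in lborel. S z = S' z"
  shows "fourier2 S = fourier2 S'"
proof
  fix w :: "real \<times> real"
  have [measurable]: "S' \<in> borel_measurable borel" by fact
  obtain \<xi> \<eta> where w: "w = (\<xi>, \<eta>)" by fastforce
  have "fourier2 S (\<xi>, \<eta>) = (LINT z|lebesgue. S z * cis (- 2 * pi * (fst z * \<xi> + snd z * \<eta>)))"
    by (simp add: fourier2_def case_prod_unfold)
  also have "\<dots> = (LINT z|lborel. S' z * echar (- (fst z * \<xi> + snd z * \<eta>)))"
  proof (rule lebesgue_integral_eq_lborel_AE)
    show "AE z in lborel. S z * cis (- 2 * pi * (fst z * \<xi> + snd z * \<eta>)) = S' z * echar (- (fst z * \<xi> + snd z * \<eta>))"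
      using ae by eventually_elim (simp add: echar_def algebra_simps)
  qed measurable
  finally show "fourier2 S w = fourier2 S' w" by (simp add: w fourier2_eq_lborel[OF S'])
qed

text \<open>
On \<open>J \<times> J\<close> the periodic function is \<open>S\<close>, which vanishes on the rest of the plane; so its Fourier
coefficients are values of the transform of \<open>S\<close> at integer points. Almost every slice of \<open>S\<close> agrees almost
everywhere with the Borel slice of \<open>S'\<close>, by Fubini's theorem for null sets.
\<close>

lemma fcoeff2_eq_fourier2:
  fixes S S' Ssharp :: "real \<times> real \<Rightarrow> complex"
  assumes S': "integrable lborel S'" and ae: "AE z in lborel. S z = S' z"
    and supp: "\<And>z. z \<notin> half_J \<times> half_J \<Longrightarrow> S z = 0" and sharp: "\<And>z. z \<in> J \<times> J \<Longrightarrow> Ssharp z = S z"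
  shows "fcoeff2 Ssharp (n, m) = fourier2 S' (real_of_int n, real_of_int m)"
proof -
  have [measurable]: "S' \<in> borel_measurable borel" using S' by auto
  define e where "e = (\<lambda>x y. echar (- (x * real_of_int n + y * real_of_int m)))"
  have [measurable]: "(\<lambda>z. S' z * e (fst z) (snd z)) \<in> borel_measurable borel" unfolding e_def by measurable
  then have [measurable]: "(\<lambda>z. S' z * e (fst z) (snd z)) \<in> borel_measurable (borel \<Otimes>\<^sub>M borel)" by (simp add: borel_prod)
  have J: "J \<in> sets lebesgue" by (simp add: J_def)
  have e: "cis (- 2 * pi * (real_of_int n * x + real_of_int m * y)) = e x y" for x y
    by (simp add: e_def echar_def algebra_simps)
  have sub: "half_J \<subseteq> J" by (auto simp: half_J_def J_def)
  have "fcoeff2 Ssharp (n, m) = (LINT x|lebesgue_on J. LINT y|lebesgue_on J. Ssharp (x, y) * e x y)"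
    unfolding fcoeff2_def prod.case e ..
  also have "\<dots> = (LINT x|lebesgue. indicator J x *\<^sub>R (LINT y|lebesgue. indicator J y *\<^sub>R (Ssharp (x, y) * e x y)))"
    using J by (simp add: integral_restrict_space)
  also have "\<dots> = (LINT x|lebesgue. LINT y|lebesgue. S (x, y) * e x y)"
  proof (rule Bochner_Integration.integral_cong[OF refl])
    fix x
    have "indicator J x *\<^sub>R (indicator J y *\<^sub>R (Ssharp (x, y) * e x y)) = S (x, y) * e x y" for y
      using sharp[of "(x, y)"] supp[of "(x, y)"] sub by (auto simp: indicator_def)
    then show "indicator J x *\<^sub>R (LINT y|lebesgue. indicator J y *\<^sub>R (Ssharp (x, y) * e x y)) = (LINT y|lebesgue. S (x, y) * e x y)"
      by (simp flip: integral_scaleR_right)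
  qed
  also have "\<dots> = (LINT x|lborel. LINT y|lborel. S' (x, y) * e x y)"
  proof (rule lebesgue_integral_eq_lborel_AE)
    show "(\<lambda>x. LINT y|lborel. S' (x, y) * e x y) \<in> borel_measurable borel"
    proof -
      have "(\<lambda>(x, y). S' (x, y) * e x y) \<in> borel_measurable (borel \<Otimes>\<^sub>M lborel)"
        using \<open>(\<lambda>z. S' z * e (fst z) (snd z)) \<in> borel_measurable (borel \<Otimes>\<^sub>M borel)\<close>
        by (simp add: case_prod_unfold cong: measurable_cong_sets sets_pair_measure_cong)
      then show ?thesis by (rule lborel.borel_measurable_lebesgue_integral)
    qed
    have "AE z in (lborel \<Otimes>\<^sub>M lborel). S z = S' z" by (subst lborel_prod) (rule ae)
    then have "AE x in lborel. AE y in lborel. S (x, y) = S' (x, y)" by (rule lborel_pair.AE_pair)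
    then show "AE x in lborel. (LINT y|lebesgue. S (x, y) * e x y) = (LINT y|lborel. S' (x, y) * e x y)"
    proof eventually_elim
      case (elim x)
      show ?case
      proof (rule lebesgue_integral_eq_lborel_AE)
        show "AE y in lborel. S (x, y) * e x y = S' (x, y) * e x y"
          using elim by eventually_elim simp
        have "(\<lambda>y. (x, y)) \<in> borel_measurable borel"
          by (intro borel_measurable_continuous_onI continuous_intros)
        from measurable_compose[OF this \<open>(\<lambda>z. S' z * e (fst z) (snd z)) \<in> borel_measurable borel\<close>]
        show "(\<lambda>y. S' (x, y) * e x y) \<in> borel_measurable borel" by simp
      qed
    qed
  qed
  also have "\<dots> = (LINT z|(lborel \<Otimes>\<^sub>M lborel). S' z * e (fst z) (snd z))"
  proof -
    have "integrable lborel (\<lambda>z. S' z * e (fst z) (snd z))"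
      by (rule Bochner_Integration.integrable_bound[OF S']) (auto simp: e_def norm_mult)
    then have "integrable (lborel \<Otimes>\<^sub>M lborel) (\<lambda>z. S' z * e (fst z) (snd z))" by (simp add: lborel_prod)
    from lborel_pair.integral_fst'[OF this] show ?thesis by simp
  qed
  also have "\<dots> = fourier2 S' (real_of_int n, real_of_int m)"
    by (simp add: lborel_prod fourier2_eq_lborel e_def)
  finally show ?thesis .
qed

theorem theorem4p3:
  fixes p1 p2 p3 :: ennreal
    and p c :: real
    and \<phi> :: "int \<times> int \<Rightarrow> complex"
    and S Ssharp :: "real \<times> real \<Rightarrow> complex"
    and \<psi> :: "real \<times> real \<Rightarrow> complex"
  assumes "Hoelder_related p1 p2 p3"
    and "p = enn2real (min 1 p3)"
    and "\<phi> \<in> multipliers_T p1 p2 p3"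
    and "integrable lebesgue S"
    and "\<And>z. z \<notin> half_J \<times> half_J \<Longrightarrow> S z = 0"
    and "\<And>x y. Ssharp (x + 1, y) = Ssharp (x, y)"
    and "\<And>x y. Ssharp (x, y + 1) = Ssharp (x, y)"
    and "\<And>z. z \<in> J \<times> J \<Longrightarrow> Ssharp z = S z"
    and "(\<lambda>k. cmod (fcoeff2 Ssharp k) powr p) summable_on UNIV"
    and "c = 2 powr (1 / p) * (\<Sum>\<^sub>\<infinity>k\<in>UNIV. cmod (fcoeff2 Ssharp k) powr p) powr (1 / p)"
    and "\<psi> = (\<lambda>(\<xi>, \<eta>). \<Sum>\<^sub>\<infinity>(n, m)\<in>UNIV.
               \<phi> (n, m) * fourier2 S (\<xi> - real_of_int n, \<eta> - real_of_int m))"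
  shows "(\<forall>\<xi> \<eta>. (\<lambda>(n, m). \<phi> (n, m) * fourier2 S (\<xi> - real_of_int n, \<eta> - real_of_int m))
            summable_on UNIV) \<and>
         \<psi> \<in> multipliers_R p1 p2 p3 \<and>
         mult_norm_R p1 p2 p3 \<psi> \<le> c * mult_norm_T p1 p2 p3 \<phi>"
proof -
  note pos = Hoelder_related_pos[OF assms(1)]
  have p: "0 < p" "p \<le> 1"
  proof -
    have "min 1 p3 < top" using le_less_trans[of "min 1 p3" 1 top] by simp
    then show "0 < p" using assms(2) pos by (simp add: enn2real_positive_iff)
    show "p \<le> 1" using enn2real_mono[of "min 1 p3" 1] assms(2) by simp
  qed
  obtain S' where S': "integrable lborel S'" "\<And>z. z \<notin> half_J \<times> half_J \<Longrightarrow> S' z = 0"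
    and ae: "AE z in lborel. S z = S' z"
    using borel_representative[OF assms(4,5)] by blast
  have SS': "fourier2 S = fourier2 S'"
    by (rule fourier2_AE_cong[OF _ ae]) (use S'(1) in auto)
  have coeff: "fcoeff2 Ssharp = (\<lambda>(n, m). fourier2 S' (real_of_int n, real_of_int m))"
    using fcoeff2_eq_fourier2[OF S'(1) ae assms(5,8)] by auto
  have ap: "(\<lambda>(n, m). cmod (fourier2 S' (real_of_int n, real_of_int m)) powr p) summable_on UNIV"
    using assms(9) by (simp add: coeff case_prod_unfold)
  have a: "(\<lambda>(n, m). cmod (fourier2 S' (real_of_int n, real_of_int m))) summable_on UNIV"
    using summable_of_summable_powr[OF p assms(9)] by (simp add: coeff case_prod_unfold)
  have c: "c = 2 powr (1 / p) * (\<Sum>\<^sub>\<infinity>(n, m)\<in>UNIV. cmod (fourier2 S' (real_of_int n, real_of_int m)) powr p) powr (1 / p)"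
    using assms(10) by (simp add: coeff case_prod_unfold)
  have c0: "0 \<le> c" by (simp add: c)
  have \<psi>: "\<psi> = extended_symbol \<phi> S'" using assms(11) by (simp add: extended_symbol_def SS')
  have transfer: "bilin_bound_R p1 p2 p3 \<psi> (c * C)" if "bilin_bound_T p1 p2 p3 \<phi> C" for C
    unfolding \<psi> by (rule bilin_bound_R_extended_symbol[OF assms(1) that assms(2) S' a ap c])
  obtain C where C: "bilin_bound_T p1 p2 p3 \<phi> C" using assms(3) by (auto simp: multipliers_T_def)
  have \<phi>b: "cmod (\<phi> z) \<le> C" for z
    using bilin_bound_T_imp_bounded[OF C pos, of "fst z" "snd z"] by simp
  obtain P where P1: "\<And>\<xi> \<eta>. (\<lambda>(n, m). cmod (\<phi> (n, m) * fourier2 S' (\<xi> - real_of_int n, \<eta> - real_of_int m))) summable_on UNIV"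
    and P2: "\<And>z. cmod (extended_symbol \<phi> S' z) \<le> P" and P3: "extended_symbol \<phi> S' \<in> borel_measurable borel"
    by (rule extended_symbol_bounded[where \<phi> = \<phi> and M = C, OF S' a \<phi>b]) (assumption, rule that)
  have 1: "(\<lambda>(n, m). \<phi> (n, m) * fourier2 S (\<xi> - real_of_int n, \<eta> - real_of_int m)) summable_on UNIV" for \<xi> \<eta>
    using P1[of \<xi> \<eta>] unfolding SS' by - (rule abs_summable_summable, simp add: case_prod_unfold)
  have 2: "\<psi> \<in> multipliers_R p1 p2 p3"
  proof -
    have m: "\<psi> \<in> borel_measurable lebesgue" unfolding \<psi> using P3 by (simp add: measurable_completion)
    have "0 \<le> P" using order_trans[OF norm_ge_zero P2] .
    then have "Lp_norm \<infinity> lebesgue \<psi> \<le> ennreal P"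
      using Lp_norm_infinity_le_iff[OF m] P2 by (simp add: \<psi>)
    then have "Lp_norm \<infinity> lebesgue \<psi> < \<infinity>" by (rule le_less_trans) simp
    then show ?thesis using m transfer[OF C] by (auto simp: multipliers_R_def Linfty_def)
  qed
  have bdd: "bdd_below {C. bilin_bound_R p1 p2 p3 \<psi> C}"
    by (rule bdd_belowI[of _ 0]) (simp add: bilin_bound_R_def)
  have le: "mult_norm_R p1 p2 p3 \<psi> \<le> c * C" if "bilin_bound_T p1 p2 p3 \<phi> C" for C
    unfolding mult_norm_R_def by (rule cInf_lower[OF _ bdd]) (use transfer[OF that] in simp)
  have 3: "mult_norm_R p1 p2 p3 \<psi> \<le> c * mult_norm_T p1 p2 p3 \<phi>"
  proof (cases "c = 0")
    case True
    then show ?thesis using le[OF C] by simp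
  next
    case False
    then have c: "0 < c" using c0 by simp
    have "mult_norm_R p1 p2 p3 \<psi> / c \<le> mult_norm_T p1 p2 p3 \<phi>"
      unfolding mult_norm_T_def
    proof (rule cInf_greatest)
      show "{C. bilin_bound_T p1 p2 p3 \<phi> C} \<noteq> {}" using C by blast
      show "mult_norm_R p1 p2 p3 \<psi> / c \<le> K" if "K \<in> {C. bilin_bound_T p1 p2 p3 \<phi> C}" for K
        using le[of K] that c by (simp add: divide_le_eq mult.commute)
    qed
    then show ?thesis using c by (simp add: divide_le_eq mult.commute)
  qed
  show ?thesis using 1 2 3 by blast
qed

end
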